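(* Let $C=\{(x,y)\in\mathbb{R}^2 \mid a_{11}x^2+a_{22}y^2+2a_{12}xy+2a_1x+2a_2y+c=0\}$ (real coefficients) be an irreducible quadratic curve, and let $\mathscr{I}(C)$ be its inversion. Then $\mathscr{I}(C)$ is a cubic or quartic curve and each irreducible component of it is a front set. Moreover: (1) If $C$ is an ellipse, then the origin is an isolated point of $\mathscr{I}(C)$, and $\mathscr{I}(C)\setminus\{(0,0)\}$ is regular as a parametrized curve. (2) If $C$ is a hyperbola, then $\mathscr{I}(C)$ is regular as a parametrized curve and it has a node at the origin as an algebraic curve. The tangent directions of the curve at the node are equal to the asymptotic directions of the hyperbola $C$. (3) If $C$ is a parabola, then $\mathscr{I}(C)$ has an ordinary cusp at the origin, and $\mathscr{I}(C)\setminus\{(0,0)\}$ is regular as a parametrized curve. The tangent direction of the curve at the cusp is equal to the direction of the axis of the parabola $C$.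
   Context: The quadratic curve $C$ is irreducible if it is not a union of two (possibly equal) lines, equivalently $\Delta=\det\begin{pmatrix} a_{11} & a_{12} & a_1 \\ a_{12} & a_{22} & a_2 \\ a_1 & a_2 & c \end{pmatrix}\neq0$; $C$ is a non-empty real curve, hence an ellipse, hyperbola or parabola. The inversion of $C$ (under $\Psi(\boldsymbol{x})=\boldsymbol{x}/\|\boldsymbol{x}\|^2$ on $\mathbb{R}^2\setminus\{(0,0)\}$) is the algebraic curve $\mathscr{I}(C)=\{(x,y)\in\mathbb{R}^2\mid G_3[C](x,y)=0\}$, where $$G_3[C](x,y)=c(x^2+y^2)^2+2a_1x(x^2+y^2)+2a_2y(x^2+y^2)+a_{11}x^2+2a_{12}xy+a_{22}y^2 .$$ It contains the origin, and $\mathscr{I}(C)\setminus\{(0,0)\}=\Psi(C\setminus\{(0,0)\})$. "Cubic or quartic" means $G_3[C]$ has degree $3$ or $4$. A smooth map $\boldsymbol{\gamma}:I\to\mathbb{R}^2$ on an interval is a frontal if there is a smooth $\boldsymbol{\nu}:I\to S^1$ with $\langle\dot{\boldsymbol{\gamma}}(t),\boldsymbol{\nu}(t)\rangle=0$ for all $t\in I$; it is a front if moreover $\boldsymbol{\nu}$ can be chosen such that $(\boldsymbol{\gamma},\boldsymbol{\nu}):I\to\mathbb{R}^2\times S^1$ is an immersion (so a constant map is a front). A set $S\subset\mathbb{R}^2$ is a front set if for every $\boldsymbol{x}_0\in S$ there are an open neighbourhood $U$ of $\boldsymbol{x}_0$ and finitely many fronts $\boldsymbol{\gamma}_i:(t_i-\varepsilon_i,t_i+\varepsilon_i)\to\mathbb{R}^2$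 ($i=1,\dots,r$) with $\boldsymbol{\gamma}_i(t_i)=\boldsymbol{x}_0$ and $\bigcup_i\boldsymbol{\gamma}_i((t_i-\varepsilon_i,t_i+\varepsilon_i))=U\cap S$. "Regular as a parametrized curve" means that, near each of its points, the set is a finite union of images of such $\boldsymbol{\gamma}_i$ that are regular ($\dot{\boldsymbol{\gamma}}_i\neq0$). A node is a point where exactly two regular branches with distinct tangent lines cross. A curve has an ordinary cusp at a point if near that point it is locally diffeomorphic to $\{(t^2,t^3)\mid t\in\mathbb{R}\}$ near the origin. *)

theory Defs
  imports "HOL-Analysis.Analysis" "HOL-Computational_Algebra.Polynomial"
begin

section \<open>Quadratic curves\<close>

definition quadratic_curve ::
    "real \<Rightarrow> real \<Rightarrow> real \<Rightarrow> real \<Rightarrow> real \<Rightarrow> real \<Rightarrow> (real \<times> real) set" where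
  "quadratic_curve a11 a12 a22 a1 a2 c =
     {(x, y). a11 * x\<^sup>2 + a22 * y\<^sup>2 + 2 * a12 * x * y + 2 * a1 * x + 2 * a2 * y + c = 0}"

definition complex_quadratic_curve ::
    "real \<Rightarrow> real \<Rightarrow> real \<Rightarrow> real \<Rightarrow> real \<Rightarrow> real \<Rightarrow> (complex \<times> complex) set" where
  "complex_quadratic_curve a11 a12 a22 a1 a2 c =
     {(x, y). of_real a11 * x\<^sup>2 + of_real a22 * y\<^sup>2 + 2 * of_real a12 * x * y
        + 2 * of_real a1 * x + 2 * of_real a2 * y + of_real c = 0}"

definition complex_line :: "(complex \<times> complex) set \<Rightarrow> bool" where
  "complex_line L \<longleftrightarrow>
     (\<exists>p q r. (p, q) \<noteq> (0, 0) \<and> L = {(x, y). p * x + q * y + r = 0})"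

text \<open>
  A quadratic curve is irreducible if it is not a union of two, possibly equal, lines.  The lines
  are complex: \<open>x\<^sup>2 + y\<^sup>2 = 0\<close> is reducible, although its real locus is a
  point.  The theorem after the definition is the determinant criterion, which confirms this reading.
\<close>

definition irreducible_quadratic_curve ::
    "real \<Rightarrow> real \<Rightarrow> real \<Rightarrow> real \<Rightarrow> real \<Rightarrow> real \<Rightarrow> bool" where
  "irreducible_quadratic_curve a11 a12 a22 a1 a2 c \<longleftrightarrow>
     (a11, a12, a22) \<noteq> (0, 0, 0) \<and>
     \<not> (\<exists>L M. complex_line L \<and> complex_line M \<and>
           complex_quadratic_curve a11 a12 a22 a1 a2 c = L \<union> M)"

lemma quadratic_vanishes_coeffs:
  fixes A B C :: complex
  assumes "\<And>t. A * t\<^sup>2 + 2 * B * t + C = 0"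
  shows "A = 0" "B = 0" "C = 0"
proof -
  have C: "C = 0" using assms[of 0] by simp
  have "A + 2 * B = 0" "A - 2 * B = 0" using assms[of 1] assms[of "-1"] C by simp_all
  then have "2 * A = 0" "4 * B = 0" by algebra+
  then show "A = 0" "B = 0" by simp_all
  show "C = 0" by (rule C)
qed

lemma det_zero_of_contains_line:
  fixes a b d e f g :: complex
  assumes pq: "(p, q) \<noteq> (0, 0)"
    and Z: "\<And>x y. p * x + q * y + r = 0 \<Longrightarrow>
      a * x\<^sup>2 + d * y\<^sup>2 + 2 * b * x * y + 2 * e * x + 2 * f * y + g = 0"
  shows "a * d * g + 2 * b * f * e - a * f\<^sup>2 - b\<^sup>2 * g - d * e\<^sup>2 = 0"
proof (cases "q = 0")
  case False
  define m k where "m = - p / q" and "k = - r / q"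
  have "(a + 2 * b * m + d * m\<^sup>2) * t\<^sup>2 + 2 * (b * k + d * m * k + e + f * m) * t
      + (d * k\<^sup>2 + 2 * f * k + g) = 0" for t
  proof -
    have "p * t + q * (m * t + k) + r = 0" using False by (simp add: m_def k_def field_simps)
    from Z[OF this] show ?thesis by (simp add: algebra_simps power2_eq_square)
  qed
  from quadratic_vanishes_coeffs[OF this]
  have "a = - 2 * b * m - d * m\<^sup>2" "e = - b * k - d * m * k - f * m" "g = - d * k\<^sup>2 - 2 * f * k"
    by algebra+
  then show ?thesis by algebra
next
  case True
  then have p: "p \<noteq> 0" using pq by simp
  define k where "k = - r / p"
  have "d * t\<^sup>2 + 2 * (b * k + f) * t + (a * k\<^sup>2 + 2 * e * k + g) = 0" for t
  proof -
    have "p * k + q * t + r = 0" using True p by (simp add: k_def)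
    from Z[OF this] show ?thesis by (simp add: algebra_simps power2_eq_square)
  qed
  from quadratic_vanishes_coeffs[OF this]
  have "d = 0" "f = - b * k" "g = - a * k\<^sup>2 - 2 * e * k" by algebra+
  then show ?thesis by algebra
qed

lemma splits_of_det_zero_aux:
  fixes a b d e f g :: complex
  assumes d: "d \<noteq> 0"
    and D: "a * d * g + 2 * b * f * e - a * f\<^sup>2 - b\<^sup>2 * g - d * e\<^sup>2 = 0"
  shows "\<exists>\<alpha> \<beta>. \<forall>x y. (a * x\<^sup>2 + d * y\<^sup>2 + 2 * b * x * y + 2 * e * x + 2 * f * y + g = 0 \<longleftrightarrow>
      (b + \<alpha>) * x + d * y + (f + \<beta>) = 0 \<or> (b - \<alpha>) * x + d * y + (f - \<beta>) = 0)"
proof -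
  define A B C where "A = b\<^sup>2 - a * d" and "B = b * f - d * e" and "C = f\<^sup>2 - g * d"
  have "B\<^sup>2 - A * C = d * (- (a * d * g + 2 * b * f * e - a * f\<^sup>2 - b\<^sup>2 * g - d * e\<^sup>2))"
    unfolding A_def B_def C_def by algebra
  then have BAC: "B\<^sup>2 = A * C" using D by simp
  obtain \<alpha> \<beta> where ab: "\<alpha>\<^sup>2 = A" "\<alpha> * \<beta> = B" "\<beta>\<^sup>2 = C"
  proof (cases "A = 0")
    case True
    then show ?thesis using that[of 0 "csqrt C"] BAC by simp
  next
    case False
    then show ?thesis
      using that[of "csqrt A" "B / csqrt A"] BAC by (simp add: power_divide)
  qed
  show ?thesis
  proof (intro exI allI)
    fix x y
    have "d * (a * x\<^sup>2 + d * y\<^sup>2 + 2 * b * x * y + 2 * e * x + 2 * f * y + g)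
        = ((b + \<alpha>) * x + d * y + (f + \<beta>)) * ((b - \<alpha>) * x + d * y + (f - \<beta>))"
      using ab unfolding A_def B_def C_def by algebra
    then show "(a * x\<^sup>2 + d * y\<^sup>2 + 2 * b * x * y + 2 * e * x + 2 * f * y + g = 0) \<longleftrightarrow>
      (b + \<alpha>) * x + d * y + (f + \<beta>) = 0 \<or> (b - \<alpha>) * x + d * y + (f - \<beta>) = 0"
      using d by (metis mult_eq_0_iff)
  qed
qed

lemma splits_of_det_zero:
  fixes a b d e f g :: complex
  assumes quad: "(a, b, d) \<noteq> (0, 0, 0)"
    and D: "a * d * g + 2 * b * f * e - a * f\<^sup>2 - b\<^sup>2 * g - d * e\<^sup>2 = 0"
  shows "\<exists>L M. complex_line L \<and> complex_line M \<and>
    {(x, y). a * x\<^sup>2 + d * y\<^sup>2 + 2 * b * x * y + 2 * e * x + 2 * f * y + g = 0} = L \<union> M"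
proof -
  have goalI: ?thesis
    if "(p, q) \<noteq> (0, 0)" "(p', q') \<noteq> (0, 0)"
      "\<And>x y. (a * x\<^sup>2 + d * y\<^sup>2 + 2 * b * x * y + 2 * e * x + 2 * f * y + g = 0) \<longleftrightarrow>
        p * x + q * y + r = 0 \<or> p' * x + q' * y + r' = 0" for p q r p' q' r'
    using that
    by (intro exI[of _ "{(x, y). p * x + q * y + r = 0}"]
        exI[of _ "{(x, y). p' * x + q' * y + r' = 0}"]) (auto simp: complex_line_def)
  consider "d \<noteq> 0" | "a \<noteq> 0" | "a = 0" "d = 0" "b \<noteq> 0" using quad by auto
  then show ?thesis
  proof cases
    case 1
    from splits_of_det_zero_aux[OF 1 D] obtain \<alpha> \<beta> where
      "\<And>x y. (a * x\<^sup>2 + d * y\<^sup>2 + 2 * b * x * y + 2 * e * x + 2 * f * y + g = 0) \<longleftrightarrow>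
      (b + \<alpha>) * x + d * y + (f + \<beta>) = 0 \<or> (b - \<alpha>) * x + d * y + (f - \<beta>) = 0" by blast
    then show ?thesis using 1 by (intro goalI) auto
  next
    case 2
    have "d * a * g + 2 * b * e * f - d * e\<^sup>2 - b\<^sup>2 * g - a * f\<^sup>2 = 0" using D by algebra
    from splits_of_det_zero_aux[OF 2 this] obtain \<alpha> \<beta> where
      *: "\<And>y x. (d * y\<^sup>2 + a * x\<^sup>2 + 2 * b * y * x + 2 * f * y + 2 * e * x + g = 0) \<longleftrightarrow>
      (b + \<alpha>) * y + a * x + (e + \<beta>) = 0 \<or> (b - \<alpha>) * y + a * x + (e - \<beta>) = 0" by blast
    show ?thesis
    proof (rule goalI[of a "b + \<alpha>" a "b - \<alpha>" "e + \<beta>" "e - \<beta>"])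
      fix x y
      show "(a * x\<^sup>2 + d * y\<^sup>2 + 2 * b * x * y + 2 * e * x + 2 * f * y + g = 0) \<longleftrightarrow>
        a * x + (b + \<alpha>) * y + (e + \<beta>) = 0 \<or> a * x + (b - \<alpha>) * y + (e - \<beta>) = 0"
        using *[of y x] by (simp add: ac_simps)
    qed (use 2 in auto)
  next
    case 3
    have "b * (2 * f * e - b * g) = 0" using D 3(1,2) by algebra
    then have g: "b * g = 2 * f * e" using 3(3) by simp
    show ?thesis
    proof (rule goalI[of b 0 0 b f e])
      fix x y
      have "b * (2 * b * x * y + 2 * e * x + 2 * f * y + g) = 2 * ((b * x + f) * (b * y + e))"
        using g by algebra
      then have "2 * b * x * y + 2 * e * x + 2 * f * y + g = 0 \<longleftrightarrow> b * x + f = 0 \<or> b * y + e = 0"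
        using 3(3) by (metis mult_eq_0_iff zero_neq_numeral)
      then show "(a * x\<^sup>2 + d * y\<^sup>2 + 2 * b * x * y + 2 * e * x + 2 * f * y + g = 0) \<longleftrightarrow>
        b * x + 0 * y + f = 0 \<or> 0 * x + b * y + e = 0"
        using 3(1,2) by simp
    qed (use 3 in auto)
  qed
qed

theorem irreducible_quadratic_curve_iff_det:
  "irreducible_quadratic_curve a11 a12 a22 a1 a2 c \<longleftrightarrow>
     det (vector [vector [a11, a12, a1], vector [a12, a22, a2], vector [a1, a2, c]] :: real^3^3) \<noteq> 0"
proof -
  define D where "D = a11 * a22 * c + 2 * a12 * a2 * a1 - a11 * a2\<^sup>2 - a12\<^sup>2 * c - a22 * a1\<^sup>2"
  have det: "det (vector [vector [a11, a12, a1], vector [a12, a22, a2], vector [a1, a2, c]]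
      :: real^3^3) = D"
    unfolding D_def by (simp add: det_3 power2_eq_square algebra_simps)
  have cD: "(of_real a11 * of_real a22 * of_real c + 2 * of_real a12 * of_real a2 * of_real a1
      - of_real a11 * (of_real a2)\<^sup>2 - (of_real a12)\<^sup>2 * of_real c
      - of_real a22 * (of_real a1)\<^sup>2 :: complex) = of_real D"
    unfolding D_def by simp
  have "irreducible_quadratic_curve a11 a12 a22 a1 a2 c \<longleftrightarrow> D \<noteq> 0"
  proof
    assume irr: "irreducible_quadratic_curve a11 a12 a22 a1 a2 c"
    show "D \<noteq> 0"
    proof
      assume "D = 0"
      then have "(of_real a11 * of_real a22 * of_real c + 2 * of_real a12 * of_real a2 * of_real a1
        - of_real a11 * (of_real a2)\<^sup>2 - (of_real a12)\<^sup>2 * of_real c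
        - of_real a22 * (of_real a1)\<^sup>2 :: complex) = 0" using cD by simp
      moreover have "(complex_of_real a11, complex_of_real a12, complex_of_real a22) \<noteq> (0, 0, 0)"
        using irr unfolding irreducible_quadratic_curve_def by simp
      ultimately have "\<exists>L M. complex_line L \<and> complex_line M \<and>
          complex_quadratic_curve a11 a12 a22 a1 a2 c = L \<union> M"
        unfolding complex_quadratic_curve_def by (rule splits_of_det_zero[rotated])
      then show False using irr unfolding irreducible_quadratic_curve_def by blast
    qed
  next
    assume D: "D \<noteq> 0"
    have "(a11, a12, a22) \<noteq> (0, 0, 0)" using D by (auto simp: D_def)
    moreover have False if line: "complex_line L"
      and eq: "complex_quadratic_curve a11 a12 a22 a1 a2 c = L \<union> M" for L M
    proof -
      obtain p q r where pq: "(p, q) \<noteq> (0, 0)" and L: "L = {(x, y). p * x + q * y + r = 0}"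
        using line unfolding complex_line_def by blast
      have "of_real a11 * x\<^sup>2 + of_real a22 * y\<^sup>2 + 2 * of_real a12 * x * y
        + 2 * of_real a1 * x + 2 * of_real a2 * y + of_real c = 0"
        if "p * x + q * y + r = 0" for x y
      proof -
        have "(x, y) \<in> complex_quadratic_curve a11 a12 a22 a1 a2 c"
          unfolding eq L using that by simp
        then show ?thesis
          unfolding complex_quadratic_curve_def by (simp only: mem_Collect_eq prod.case)
      qed
      from det_zero_of_contains_line[OF pq this] have "(of_real D :: complex) = 0"
        unfolding cD .
      then show False using D by simp
    qed
    ultimately show "irreducible_quadratic_curve a11 a12 a22 a1 a2 c"
      unfolding irreducible_quadratic_curve_def by blast
  qed
  then show ?thesis using det by simp
qed

text \<open>
  Conic types are Euclidean: normal forms in an orthonormal frame \<open>(u, v)\<close> based at \<open>p\<close>.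
  Circles count as ellipses.
\<close>

definition orthonormal_frame :: "real \<times> real \<Rightarrow> real \<times> real \<Rightarrow> bool" where
  "orthonormal_frame u v \<longleftrightarrow> norm u = 1 \<and> norm v = 1 \<and> u \<bullet> v = 0"

definition is_ellipse :: "(real \<times> real) set \<Rightarrow> bool" where
  "is_ellipse C \<longleftrightarrow> (\<exists>p u v a b. orthonormal_frame u v \<and> a > 0 \<and> b > 0 \<and>
     C = {p + X *\<^sub>R u + Y *\<^sub>R v | X Y. X\<^sup>2 / a\<^sup>2 + Y\<^sup>2 / b\<^sup>2 = 1})"

definition hyperbola_in_frame ::
    "(real \<times> real) set \<Rightarrow> real \<times> real \<Rightarrow> real \<times> real \<Rightarrow> real \<times> real \<Rightarrow> real \<Rightarrow> real \<Rightarrow> bool" where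
  "hyperbola_in_frame C p u v a b \<longleftrightarrow> orthonormal_frame u v \<and> a > 0 \<and> b > 0 \<and>
     C = {p + X *\<^sub>R u + Y *\<^sub>R v | X Y. X\<^sup>2 / a\<^sup>2 - Y\<^sup>2 / b\<^sup>2 = 1}"

definition is_hyperbola :: "(real \<times> real) set \<Rightarrow> bool" where
  "is_hyperbola C \<longleftrightarrow> (\<exists>p u v a b. hyperbola_in_frame C p u v a b)"

definition parabola_in_frame ::
    "(real \<times> real) set \<Rightarrow> real \<times> real \<Rightarrow> real \<times> real \<Rightarrow> real \<times> real \<Rightarrow> real \<Rightarrow> bool" where
  "parabola_in_frame C p u v k \<longleftrightarrow> orthonormal_frame u v \<and> k > 0 \<and>
     C = {p + X *\<^sub>R u + Y *\<^sub>R v | X Y. Y\<^sup>2 = 4 * k * X}"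

definition is_parabola :: "(real \<times> real) set \<Rightarrow> bool" where
  "is_parabola C \<longleftrightarrow> (\<exists>p u v k. parabola_in_frame C p u v k)"

text \<open>
  A direction is a one-dimensional linear subspace.  In the frame above the asymptotes are
  \<open>Y = (b / a) X\<close> and \<open>Y = - (b / a) X\<close>, and the axis of the parabola is \<open>Y = 0\<close>.
\<close>

definition asymptotic_directions :: "(real \<times> real) set \<Rightarrow> (real \<times> real) set set" where
  "asymptotic_directions C = {L. \<exists>p u v a b. hyperbola_in_frame C p u v a b \<and>
     (L = span {a *\<^sub>R u + b *\<^sub>R v} \<or> L = span {a *\<^sub>R u - b *\<^sub>R v})}"

definition axis_directions :: "(real \<times> real) set \<Rightarrow> (real \<times> real) set set" where
  "axis_directions C = {L. \<exists>p u v k. parabola_in_frame C p u v k \<and> L = span {u}}"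


section \<open>Real plane algebraic curves\<close>

text \<open>
  Bivariate real polynomials are elements of \<open>(\<real>[x])[y]\<close>: the coefficient of
  \<open>x\<^sup>i y\<^sup>j\<close> in \<open>P\<close> is \<open>coeff (coeff P j) i\<close>.
\<close>

abbreviation (input) poly_X :: "real poly poly" where "poly_X \<equiv> [:[:0, 1:]:]"
abbreviation (input) poly_Y :: "real poly poly" where "poly_Y \<equiv> [:0, 1:]"

definition eval2 :: "real poly poly \<Rightarrow> real \<Rightarrow> real \<Rightarrow> real" where
  "eval2 P x y = poly (poly P [:y:]) x"

definition total_degree :: "real poly poly \<Rightarrow> nat" where
  "total_degree P = (LEAST n. \<forall>i j. coeff (coeff P j) i \<noteq> 0 \<longrightarrow> i + j \<le> n)"

definition zero_locus :: "real poly poly \<Rightarrow> (real \<times> real) set" where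
  "zero_locus P = {(x, y). eval2 P x y = 0}"

text \<open>
  A component may be a single point: the inversion of a circle has the component
  \<open>x\<^sup>2 + y\<^sup>2 = 0\<close>.
\<close>

definition irreducible_components :: "real poly poly \<Rightarrow> (real \<times> real) set set" where
  "irreducible_components P = {zero_locus Q | Q. irreducible Q \<and> Q dvd P}"


section \<open>The inversion of a quadratic curve\<close>

definition inversion_map :: "real \<times> real \<Rightarrow> real \<times> real" where
  "inversion_map z = z /\<^sub>R (norm z)\<^sup>2"

definition inversion_poly ::
    "real \<Rightarrow> real \<Rightarrow> real \<Rightarrow> real \<Rightarrow> real \<Rightarrow> real \<Rightarrow> real poly poly" where
  "inversion_poly a11 a12 a22 a1 a2 c =
     smult [:c:] ((poly_X\<^sup>2 + poly_Y\<^sup>2)\<^sup>2)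
     + smult [:2 * a1:] (poly_X * (poly_X\<^sup>2 + poly_Y\<^sup>2))
     + smult [:2 * a2:] (poly_Y * (poly_X\<^sup>2 + poly_Y\<^sup>2))
     + smult [:a11:] (poly_X\<^sup>2) + smult [:2 * a12:] (poly_X * poly_Y) + smult [:a22:] (poly_Y\<^sup>2)"

definition inversion_curve ::
    "real \<Rightarrow> real \<Rightarrow> real \<Rightarrow> real \<Rightarrow> real \<Rightarrow> real \<Rightarrow> (real \<times> real) set" where
  "inversion_curve a11 a12 a22 a1 a2 c = zero_locus (inversion_poly a11 a12 a22 a1 a2 c)"

lemma eval2_inversion_poly:
  "eval2 (inversion_poly a11 a12 a22 a1 a2 c) x y =
     c * (x\<^sup>2 + y\<^sup>2)\<^sup>2 + 2 * a1 * x * (x\<^sup>2 + y\<^sup>2) + 2 * a2 * y * (x\<^sup>2 + y\<^sup>2)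
     + a11 * x\<^sup>2 + 2 * a12 * x * y + a22 * y\<^sup>2"
  by (simp add: eval2_def inversion_poly_def algebra_simps)

lemma inversion_curve_minus_origin:
  "inversion_curve a11 a12 a22 a1 a2 c - {(0, 0)} =
     inversion_map ` (quadratic_curve a11 a12 a22 a1 a2 c - {(0, 0)})"
proof -
  define s where "s = (\<lambda>x y :: real. x\<^sup>2 + y\<^sup>2)"
  have inv: "inversion_map (x, y) = (x / s x y, y / s x y)" for x y
    by (simp add: inversion_map_def s_def norm_Pair divide_inverse mult.commute)
  have s0: "s x y \<noteq> 0" if "(x, y) \<noteq> (0, 0)" for x y
    using that by (auto simp: s_def sum_power2_eq_zero_iff)
  have s_inv: "s (x / s x y) (y / s x y) = 1 / s x y" if "(x, y) \<noteq> (0, 0)" for x y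
  proof -
    have "s (x / s x y) (y / s x y) = s x y / (s x y)\<^sup>2"
      by (simp add: s_def power_divide add_divide_distrib)
    then show ?thesis using s0[OF that] by (simp add: power2_eq_square)
  qed
  have ne_inv: "(x / s x y, y / s x y) \<noteq> (0, 0)" if "(x, y) \<noteq> (0, 0)" for x y
    using s0[OF that] that by auto
  have invol: "inversion_map (inversion_map (x, y)) = (x, y)" if "(x, y) \<noteq> (0, 0)" for x y
    unfolding inv s_inv[OF that] using s0[OF that] by simp
  have memI: "(x, y) \<in> inversion_curve a11 a12 a22 a1 a2 c \<longleftrightarrow>
      (x / s x y, y / s x y) \<in> quadratic_curve a11 a12 a22 a1 a2 c" if "(x, y) \<noteq> (0, 0)" for x y
  proof -
    define w where "w = s x y"
    have w: "w \<noteq> 0" using s0[OF that] by (simp add: w_def)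
    have "eval2 (inversion_poly a11 a12 a22 a1 a2 c) x y =
      c * w\<^sup>2 + 2 * a1 * x * w + 2 * a2 * y * w + a11 * x\<^sup>2 + 2 * a12 * x * y + a22 * y\<^sup>2"
      by (simp add: eval2_inversion_poly w_def s_def)
    also have "\<dots> = w\<^sup>2 * (a11 * (x / w)\<^sup>2 + a22 * (y / w)\<^sup>2 + 2 * a12 * (x / w) * (y / w)
        + 2 * a1 * (x / w) + 2 * a2 * (y / w) + c)"
      using w by (simp add: field_simps power2_eq_square)
    finally show ?thesis using w
      unfolding inversion_curve_def zero_locus_def quadratic_curve_def w_def[symmetric] by simp
  qed
  have mem: "z \<in> inversion_curve a11 a12 a22 a1 a2 c \<longleftrightarrow>
      inversion_map z \<in> quadratic_curve a11 a12 a22 a1 a2 c"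
    and ne: "inversion_map z \<noteq> (0, 0)"
    and invol': "inversion_map (inversion_map z) = z" if "z \<noteq> (0, 0)" for z
  proof -
    obtain x y where z: "z = (x, y)" by (cases z)
    then have xy: "(x, y) \<noteq> (0, 0)" using that by simp
    show "z \<in> inversion_curve a11 a12 a22 a1 a2 c \<longleftrightarrow>
        inversion_map z \<in> quadratic_curve a11 a12 a22 a1 a2 c"
      unfolding z inv by (rule memI[OF xy])
    show "inversion_map z \<noteq> (0, 0)" unfolding z inv by (rule ne_inv[OF xy])
    show "inversion_map (inversion_map z) = z" unfolding z by (rule invol[OF xy])
  qed
  show ?thesis
  proof (intro equalityI subsetI)
    fix z assume "z \<in> inversion_curve a11 a12 a22 a1 a2 c - {(0, 0)}"
    then have z: "z \<noteq> (0, 0)" "z \<in> inversion_curve a11 a12 a22 a1 a2 c" by simp_all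
    have "inversion_map z \<in> quadratic_curve a11 a12 a22 a1 a2 c - {(0, 0)}"
      using mem[OF z(1)] ne[OF z(1)] z(2) by simp
    then show "z \<in> inversion_map ` (quadratic_curve a11 a12 a22 a1 a2 c - {(0, 0)})"
      by (rule rev_image_eqI) (rule invol'[OF z(1), symmetric])
  next
    fix z assume "z \<in> inversion_map ` (quadratic_curve a11 a12 a22 a1 a2 c - {(0, 0)})"
    then obtain w where w: "w \<noteq> (0, 0)" "w \<in> quadratic_curve a11 a12 a22 a1 a2 c"
      and z: "z = inversion_map w" by blast
    show "z \<in> inversion_curve a11 a12 a22 a1 a2 c - {(0, 0)}"
      using mem[OF ne[OF w(1)]] ne[OF w(1)] invol'[OF w(1)] w(2) unfolding z by simp
  qed
qed


section \<open>Smooth maps, fronts and singularities\<close>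

text \<open>
  \<open>C\<close>-infinity maps on an open set of a finite-dimensional space: every iterated directional
  derivative exists and is continuous.  Derivatives are two-sided, so the domain must be open.
\<close>

primrec Ck_on :: "nat \<Rightarrow> ('a::euclidean_space \<Rightarrow> 'b::real_normed_vector) \<Rightarrow> 'a set \<Rightarrow> bool" where
  "Ck_on 0 f S \<longleftrightarrow> continuous_on S f"
| "Ck_on (Suc k) f S \<longleftrightarrow> (\<forall>x\<in>S. f differentiable (at x)) \<and>
     (\<forall>v. Ck_on k (\<lambda>x. frechet_derivative f (at x) v) S)"

definition smooth_on :: "'a::euclidean_space set \<Rightarrow> ('a \<Rightarrow> 'b::real_normed_vector) \<Rightarrow> bool" where
  "smooth_on S f \<longleftrightarrow> (\<forall>k. Ck_on k f S)"

text \<open>In the next definitions \<open>I\<close> is an open interval.\<close>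

definition unit_normal_along ::
    "(real \<Rightarrow> real \<times> real) \<Rightarrow> (real \<Rightarrow> real \<times> real) \<Rightarrow> real set \<Rightarrow> bool" where
  "unit_normal_along \<nu> \<gamma> I \<longleftrightarrow> smooth_on I \<nu> \<and>
     (\<forall>t\<in>I. norm (\<nu> t) = 1 \<and> vector_derivative \<gamma> (at t) \<bullet> \<nu> t = 0)"

definition front :: "(real \<Rightarrow> real \<times> real) \<Rightarrow> real set \<Rightarrow> bool" where
  "front \<gamma> I \<longleftrightarrow> smooth_on I \<gamma> \<and> (\<exists>\<nu>. unit_normal_along \<nu> \<gamma> I \<and>
     (\<forall>t\<in>I. (vector_derivative \<gamma> (at t), vector_derivative \<nu> (at t)) \<noteq> (0, 0)))"

definition regular_curve :: "(real \<Rightarrow> real \<times> real) \<Rightarrow> real set \<Rightarrow> bool" where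
  "regular_curve \<gamma> I \<longleftrightarrow> smooth_on I \<gamma> \<and> (\<forall>t\<in>I. vector_derivative \<gamma> (at t) \<noteq> 0)"

definition locally_finite_union_of ::
    "((real \<Rightarrow> real \<times> real) \<Rightarrow> real set \<Rightarrow> bool) \<Rightarrow> (real \<times> real) set \<Rightarrow> bool" where
  "locally_finite_union_of P S \<longleftrightarrow> (\<forall>x0\<in>S. \<exists>U (r::nat) \<gamma> t \<epsilon>. open U \<and> x0 \<in> U \<and>
     (\<forall>i<r. \<epsilon> i > 0 \<and> P (\<gamma> i) {t i - \<epsilon> i <..< t i + \<epsilon> i} \<and> \<gamma> i (t i) = x0) \<and>
     (\<Union>i<r. \<gamma> i ` {t i - \<epsilon> i <..< t i + \<epsilon> i}) = U \<inter> S)"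

definition front_set :: "(real \<times> real) set \<Rightarrow> bool" where
  "front_set S \<longleftrightarrow> locally_finite_union_of front S"

definition regular_as_parametrized_curve :: "(real \<times> real) set \<Rightarrow> bool" where
  "regular_as_parametrized_curve S \<longleftrightarrow>
     locally_finite_union_of (\<lambda>\<gamma> I. front \<gamma> I \<and> regular_curve \<gamma> I) S"

text \<open>
  The branches are embedded and meet only at \<open>p\<close>; otherwise one \<open>\<gamma>\<close> could return to \<open>p\<close> and
  there would be more than two branches.
\<close>

definition has_node :: "(real \<times> real) set \<Rightarrow> real \<times> real \<Rightarrow> bool" where
  "has_node S p \<longleftrightarrow> (\<exists>U \<gamma>1 t1 \<epsilon>1 \<gamma>2 t2 \<epsilon>2.
     let I1 = {t1 - \<epsilon>1 <..< t1 + \<epsilon>1}; I2 = {t2 - \<epsilon>2 <..< t2 + \<epsilon>2} in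
     open U \<and> p \<in> U \<and> \<epsilon>1 > 0 \<and> \<epsilon>2 > 0 \<and>
     regular_curve \<gamma>1 I1 \<and> (\<exists>g. homeomorphism I1 (\<gamma>1 ` I1) \<gamma>1 g) \<and> \<gamma>1 t1 = p \<and>
     regular_curve \<gamma>2 I2 \<and> (\<exists>g. homeomorphism I2 (\<gamma>2 ` I2) \<gamma>2 g) \<and> \<gamma>2 t2 = p \<and>
     \<gamma>1 ` I1 \<union> \<gamma>2 ` I2 = U \<inter> S \<and> \<gamma>1 ` I1 \<inter> \<gamma>2 ` I2 = {p} \<and>
     span {vector_derivative \<gamma>1 (at t1)} \<noteq> span {vector_derivative \<gamma>2 (at t2)})"

definition has_ordinary_cusp :: "(real \<times> real) set \<Rightarrow> real \<times> real \<Rightarrow> bool" where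
  "has_ordinary_cusp S p \<longleftrightarrow> (\<exists>U V \<phi> \<psi>.
     open U \<and> open V \<and> p \<in> U \<and> \<phi> p = (0, 0) \<and>
     smooth_on U \<phi> \<and> smooth_on V \<psi> \<and> homeomorphism U V \<phi> \<psi> \<and>
     \<phi> ` (U \<inter> S) = V \<inter> range (\<lambda>t::real. (t\<^sup>2, t ^ 3)))"

text \<open>
  Limits of secant directions at \<open>p\<close>.  At a node these are the directions of the velocities of the
  two branches, at an ordinary cusp the limiting tangent direction.
\<close>

definition tangent_directions :: "(real \<times> real) set \<Rightarrow> real \<times> real \<Rightarrow> (real \<times> real) set set" where
  "tangent_directions S p = {span {d} | d. \<exists>q :: nat \<Rightarrow> real \<times> real.
     (\<forall>n. q n \<in> S - {p}) \<and> q \<longlonglongrightarrow> p \<and> (\<lambda>n. sgn (q n - p)) \<longlonglongrightarrow> d}"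

end

theory Submission
  imports Defs
begin

text \<open>
  Write the equation of the conic as \<open>q z + 2 * l z + c = 0\<close> with a quadratic form \<open>q\<close> and a linear form
  \<open>l\<close>, and let \<open>s = \<parallel>z\<parallel>\<^sup>2\<close>.  Its inversion is the zero set of
  \<open>G z = c * s\<^sup>2 + 2 * l z * s + q z\<close>.

  Away from the origin, inversion is a diffeomorphism and an irreducible conic is smooth, so \<open>G\<close> has
  only regular zeros there (\<open>G_regular_zero\<close>), and the implicit function theorem for smooth functions
  of two variables (\<open>implicit_function\<close>) turns each of them into a point on a regular arc.  The origin is
  governed by the lowest order form \<open>q\<close> of \<open>G\<close>, whose discriminant has the sign that corresponds to
  the type of the conic.

  \<^item> Ellipse: \<open>q\<close> is definite and dominates the terms of order 3 and 4, so the origin is isolated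
    (\<open>isolated_IC\<close>).

  \<^item> Hyperbola: \<open>q\<close> vanishes on two lines.  After the substitution \<open>z = x (d + m e)\<close>, with \<open>d\<close> and \<open>e\<close>
    spanning these lines, \<open>G / x\<^sup>2\<close> has a simple zero in the slope \<open>m\<close>, which gives one regular branch
    tangent to \<open>d\<close>; exchanging \<open>d\<close> and \<open>e\<close> gives the other one (\<open>node_arcs\<close>).

  \<^item> Parabola: changing the centre of inversion is a Moebius transformation, hence a diffeomorphism near
    the origin.  Seen from the vertex, the inversion of the parabola is the cissoid
    \<open>Y\<^sup>2 = 4 k X (X\<^sup>2 + Y\<^sup>2)\<close>, which an explicit change of coordinates maps to the
    standard cusp (\<open>has_ordinary_cusp_IC\<close>).

  The limits of secants at the origin are null vectors of \<open>q\<close>.  Conversely, points of the conic that run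
  to infinity along an asymptote or the axis are inverted into points that approach the origin in that
  direction, and the null directions of \<open>q\<close> are the asymptotic directions or the axis direction.

  For an irreducible component, given by a factor \<open>Q\<close> of \<open>G = Q R\<close>, there are two cases at a zero of \<open>Q\<close>:
  either \<open>R\<close> is nonzero there and \<open>Q\<close> has locally the same zeros as \<open>G\<close>, or the zero is the origin and
  \<open>Q\<close> is regular there, because \<open>q\<close> is not zero (\<open>front_arcs_near_component\<close>).  So it suffices that the
  whole curve is locally a finite union of fronts; at an ordinary cusp this is
  \<open>arcs_near_front_cusp\<close>.
\<close>


section \<open>Closure properties of smooth maps\<close>

lemma frechet_derivative_worksI:
  "f differentiable net \<Longrightarrow> (f has_derivative frechet_derivative f net) net"
  by (simp only: frechet_derivative_works)

lemma Ck_on_cong: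
  assumes "open S" "\<And>x. x \<in> S \<Longrightarrow> f x = g x" "Ck_on k f S"
  shows "Ck_on k g S"
  using assms(2,3)
proof (induction k arbitrary: f g)
  case 0
  then show ?case using continuous_on_cong[of S S f g] by simp
next
  case (Suc k)
  have *: "(g has_derivative frechet_derivative f (at x)) (at x)" if "x \<in> S" for x
  proof -
    have "(f has_derivative frechet_derivative f (at x)) (at x)"
      using Suc.prems(2) that frechet_derivative_works by auto
    then show ?thesis
      by (rule has_derivative_transform_within_open[OF _ assms(1) that]) (use Suc.prems(1) in auto)
  qed
  have eq: "frechet_derivative f (at x) = frechet_derivative g (at x)" if "x \<in> S" for x
    using frechet_derivative_at[OF *[OF that]] .
  have "Ck_on k (\<lambda>x. frechet_derivative g (at x) v) S" for v
    by (rule Suc.IH[of "\<lambda>x. frechet_derivative f (at x) v"])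
       (use Suc.prems(2) eq in auto)
  then show ?case using * by (auto simp: differentiable_def)
qed

lemma Ck_on_SucI:
  assumes "open S" "\<And>x. x \<in> S \<Longrightarrow> (f has_derivative f' x) (at x)" "\<And>v. Ck_on k (\<lambda>x. f' x v) S"
  shows "Ck_on (Suc k) f S"
proof -
  have "Ck_on k (\<lambda>x. frechet_derivative f (at x) v) S" for v
    by (rule Ck_on_cong[OF assms(1) _ assms(3)[of v]])
       (simp add: frechet_derivative_at[OF assms(2), symmetric])
  then show ?thesis using assms(2) by (auto simp: differentiable_def)
qed

lemma Ck_on_SucD:
  assumes "Ck_on (Suc k) f S"
  shows "x \<in> S \<Longrightarrow> (f has_derivative frechet_derivative f (at x)) (at x)"
    and "Ck_on k (\<lambda>x. frechet_derivative f (at x) v) S"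
  using assms by (simp_all add: frechet_derivative_worksI)

lemma Ck_on_Suc_imp_Ck_on: "Ck_on (Suc k) f S \<Longrightarrow> Ck_on k f S"
proof (induction k arbitrary: f)
  case 0
  then show ?case
    by (auto intro!: continuous_at_imp_continuous_on differentiable_imp_continuous_within)
next
  case (Suc k)
  have "Ck_on k (\<lambda>x. frechet_derivative f (at x) v) S" for v
    by (rule Suc.IH) (use Suc.prems in simp)
  then show ?case using Suc.prems by simp
qed

lemma Ck_on_subset: "Ck_on k f S \<Longrightarrow> T \<subseteq> S \<Longrightarrow> Ck_on k f T"
proof (induction k arbitrary: f)
  case 0
  then show ?case by (auto intro: continuous_on_subset)
next
  case (Suc k)
  have "Ck_on k (\<lambda>x. frechet_derivative f (at x) v) T" for v
    by (rule Suc.IH) (use Suc.prems in simp_all)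
  then show ?case using Suc.prems by auto
qed

lemma Ck_on_const: "open S \<Longrightarrow> Ck_on k (\<lambda>x. a) S"
proof (induction k arbitrary: a)
  case (Suc k)
  show ?case by (rule Ck_on_SucI[OF Suc.prems has_derivative_const Suc.IH[OF Suc.prems]])
qed simp

lemma Ck_on_bounded_linear:
  assumes L: "bounded_linear L" and S: "open S" and "Ck_on k f S"
  shows "Ck_on k (\<lambda>x. L (f x)) S"
  using assms(3)
proof (induction k arbitrary: f)
  case 0
  then show ?case using bounded_linear.continuous_on[OF L] by simp
next
  case (Suc k)
  show ?case
    by (rule Ck_on_SucI[OF S bounded_linear.has_derivative[OF L Ck_on_SucD(1)[OF Suc.prems]]
          Suc.IH[OF Ck_on_SucD(2)[OF Suc.prems]]])
qed

lemma Ck_on_id: "open S \<Longrightarrow> Ck_on k (\<lambda>x. x) S"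
proof (cases k)
  case (Suc m)
  assume S: "open S"
  show ?thesis unfolding Suc
    by (rule Ck_on_SucI[OF S has_derivative_ident Ck_on_const[OF S]])
qed simp

lemma Ck_on_add:
  assumes S: "open S" and "Ck_on k f S" "Ck_on k g S"
  shows "Ck_on k (\<lambda>x. f x + g x) S"
  using assms(2,3)
proof (induction k arbitrary: f g)
  case 0
  then show ?case by (simp add: continuous_on_add)
next
  case (Suc k)
  show ?case
    by (rule Ck_on_SucI[OF S has_derivative_add[OF Ck_on_SucD(1)[OF Suc.prems(1)] Ck_on_SucD(1)[OF Suc.prems(2)]]
          Suc.IH[OF Ck_on_SucD(2)[OF Suc.prems(1)] Ck_on_SucD(2)[OF Suc.prems(2)]]])
qed

lemma Ck_on_Pair:
  assumes S: "open S" and f: "Ck_on k f S" and g: "Ck_on k g S"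
  shows "Ck_on k (\<lambda>x. (f x, g x)) S"
proof -
  have "bounded_linear (\<lambda>x. (x, 0))" "bounded_linear (\<lambda>x. (0, x))"
    by (intro bounded_linear_Pair bounded_linear_ident bounded_linear_zero)+
  from Ck_on_add[OF S Ck_on_bounded_linear[OF this(1) S f] Ck_on_bounded_linear[OF this(2) S g]]
  show ?thesis by simp
qed

lemma Ck_on_sum:
  assumes S: "open S" and "\<And>i. i \<in> I \<Longrightarrow> Ck_on k (f i) S"
  shows "Ck_on k (\<lambda>x. \<Sum>i\<in>I. f i x) S"
  using assms(2)
  by (induction I rule: infinite_finite_induct) (auto intro: Ck_on_const[OF S] Ck_on_add[OF S])

lemma Ck_on_bilinear:
  assumes B: "bounded_bilinear B" and S: "open S" and "Ck_on k f S" "Ck_on k g S"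
  shows "Ck_on k (\<lambda>x. B (f x) (g x)) S"
  using assms(3,4)
proof (induction k arbitrary: f g)
  case 0
  then show ?case using bounded_bilinear.continuous_on[OF B] by simp
next
  case (Suc k)
  note p = Suc.prems
  have d: "((\<lambda>x. B (f x) (g x)) has_derivative (\<lambda>v. B (f x) (frechet_derivative g (at x) v) +
      B (frechet_derivative f (at x) v) (g x))) (at x)" if "x \<in> S" for x
    by (rule bounded_bilinear.FDERIV[OF B Ck_on_SucD(1)[OF p(1) that] Ck_on_SucD(1)[OF p(2) that]])
  show ?case
  proof (rule Ck_on_SucI[OF S d])
    show "Ck_on k (\<lambda>x. B (f x) (frechet_derivative g (at x) v) +
        B (frechet_derivative f (at x) v) (g x)) S" for v
      by (rule Ck_on_add[OF S Suc.IH[OF Ck_on_Suc_imp_Ck_on[OF p(1)] Ck_on_SucD(2)[OF p(2)]]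
          Suc.IH[OF Ck_on_SucD(2)[OF p(1)] Ck_on_Suc_imp_Ck_on[OF p(2)]]])
  qed auto
qed

text \<open>
  The derivative of a composite along \<open>v\<close> is \<open>Df(g x)(Dg(x) v)\<close>; expanding the
  vector \<open>Dg(x) v\<close> in the standard basis turns this into a sum of products of functions
  that are \<open>C\<^sup>k\<close> by induction.
\<close>

lemma Ck_on_compose:
  fixes g :: "'a::euclidean_space \<Rightarrow> 'b::euclidean_space" and f :: "'b \<Rightarrow> 'c::real_normed_vector"
  assumes S: "open S" and gST: "g ` S \<subseteq> T" and "Ck_on k f T" "Ck_on k g S"
  shows "Ck_on k (\<lambda>x. f (g x)) S"
  using assms(3,4)
proof (induction k arbitrary: f)
  case 0
  then show ?case using continuous_on_compose2[OF _ _ gST] by auto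
next
  case (Suc k)
  let ?Df = "\<lambda>y. frechet_derivative f (at y)" and ?Dg = "\<lambda>x. frechet_derivative g (at x)"
  have d: "((\<lambda>x. f (g x)) has_derivative (\<lambda>v. \<Sum>b\<in>Basis. (?Dg x v \<bullet> b) *\<^sub>R ?Df (g x) b)) (at x)"
    if x: "x \<in> S" for x
  proof -
    have f: "(f has_derivative ?Df (g x)) (at (g x))"
      using Ck_on_SucD(1)[OF Suc.prems(1)] x gST by auto
    then interpret bounded_linear "?Df (g x)" by (rule has_derivative_bounded_linear)
    have "?Df (g x) w = (\<Sum>b\<in>Basis. (w \<bullet> b) *\<^sub>R ?Df (g x) b)" for w
      by (subst euclidean_representation[of w, symmetric]) (simp only: sum scaleR)
    then have "?Df (g x) (?Dg x v) = (\<Sum>b\<in>Basis. (?Dg x v \<bullet> b) *\<^sub>R ?Df (g x) b)" for v .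
    from has_derivative_eq_rhs[OF has_derivative_compose[OF Ck_on_SucD(1)[OF Suc.prems(2) x] f] ext, OF this]
    show ?thesis .
  qed
  show ?case
  proof (rule Ck_on_SucI[OF S d])
    show "Ck_on k (\<lambda>x. \<Sum>b\<in>Basis. (?Dg x v \<bullet> b) *\<^sub>R ?Df (g x) b) S" for v
      by (rule Ck_on_sum[OF S Ck_on_bilinear[OF bounded_bilinear_scaleR S
            Ck_on_bounded_linear[OF bounded_linear_inner_left S Ck_on_SucD(2)[OF Suc.prems(2)]]
            Suc.IH[OF Ck_on_SucD(2)[OF Suc.prems(1)] Ck_on_Suc_imp_Ck_on[OF Suc.prems(2)]]]])
  qed auto
qed

lemma Ck_on_inverse:
  fixes f :: "'a::euclidean_space \<Rightarrow> real"
  assumes S: "open S" and nz: "\<And>x. x \<in> S \<Longrightarrow> f x \<noteq> 0" and "Ck_on k f S"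
  shows "Ck_on k (\<lambda>x. inverse (f x)) S"
  using assms(3)
proof (induction k)
  case 0
  then show ?case using nz by (auto intro: continuous_on_inverse)
next
  case (Suc k)
  let ?Df = "\<lambda>x. frechet_derivative f (at x)"
  have d: "((\<lambda>x. inverse (f x)) has_derivative
      (\<lambda>v. - (inverse (f x) * ?Df x v * inverse (f x)))) (at x)" if "x \<in> S" for x
    by (rule Deriv.has_derivative_inverse[OF nz[OF that] Ck_on_SucD(1)[OF Suc.prems that]])
  have i: "Ck_on k (\<lambda>x. inverse (f x)) S"
    by (rule Suc.IH[OF Ck_on_Suc_imp_Ck_on[OF Suc.prems]])
  show ?case
  proof (rule Ck_on_SucI[OF S d])
    show "Ck_on k (\<lambda>x. - (inverse (f x) * ?Df x v * inverse (f x))) S" for v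
      by (rule Ck_on_bounded_linear[OF bounded_linear_minus[OF bounded_linear_ident] S
          Ck_on_bilinear[OF bounded_bilinear_mult S
            Ck_on_bilinear[OF bounded_bilinear_mult S i Ck_on_SucD(2)[OF Suc.prems]] i]])
  qed auto
qed

lemma Ck_on_sqrt:
  fixes f :: "'a::euclidean_space \<Rightarrow> real"
  assumes S: "open S" and pos: "\<And>x. x \<in> S \<Longrightarrow> f x > 0" and "Ck_on k f S"
  shows "Ck_on k (\<lambda>x. sqrt (f x)) S"
  using assms(3)
proof (induction k)
  case 0
  then show ?case by (auto intro: continuous_on_real_sqrt)
next
  case (Suc k)
  have d: "((\<lambda>x. sqrt (f x)) has_derivative
      (\<lambda>v. frechet_derivative f (at x) v * ((1 / 2) * inverse (sqrt (f x))))) (at x)" if "x \<in> S" for x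
    by (rule has_derivative_eq_rhs[OF has_derivative_compose[OF Ck_on_SucD(1)[OF Suc.prems that]
          DERIV_real_sqrt[OF pos[OF that], unfolded has_field_derivative_def]]])
       (auto simp: inverse_eq_divide)
  have q: "Ck_on k (\<lambda>x. sqrt (f x)) S"
    by (rule Suc.IH[OF Ck_on_Suc_imp_Ck_on[OF Suc.prems]])
  have nz: "sqrt (f x) \<noteq> 0" if "x \<in> S" for x
    using pos[OF that] by simp
  show ?case
  proof (rule Ck_on_SucI[OF S d])
    show "Ck_on k (\<lambda>x. frechet_derivative f (at x) v * ((1 / 2) * inverse (sqrt (f x)))) S" for v
      by (rule Ck_on_bilinear[OF bounded_bilinear_mult S Ck_on_SucD(2)[OF Suc.prems]
          Ck_on_bilinear[OF bounded_bilinear_mult S Ck_on_const[OF S] Ck_on_inverse[OF S nz q]]])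
  qed auto
qed

lemma Ck_on_sin_cos: "Ck_on k (sin :: real \<Rightarrow> real) UNIV \<and> Ck_on k (cos :: real \<Rightarrow> real) UNIV"
proof (induction k)
  case 0
  then show ?case by (simp add: continuous_on_sin continuous_on_cos)
next
  case (Suc k)
  have s: "((sin :: real \<Rightarrow> real) has_derivative (\<lambda>v. v * cos x)) (at x)"
    and c: "((cos :: real \<Rightarrow> real) has_derivative (\<lambda>v. (- v) * sin x)) (at x)" for x
    by (rule has_derivative_eq_rhs[OF DERIV_sin[unfolded has_field_derivative_def]]
        has_derivative_eq_rhs[OF DERIV_cos[unfolded has_field_derivative_def]]; auto)+
  show ?case
    by (intro conjI Ck_on_SucI[OF open_UNIV s] Ck_on_SucI[OF open_UNIV c]
        Ck_on_bilinear[OF bounded_bilinear_mult open_UNIV] Ck_on_const[OF open_UNIV])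
       (use Suc.IH in auto)
qed

lemma smooth_on_cong:
  "open S \<Longrightarrow> (\<And>x. x \<in> S \<Longrightarrow> f x = g x) \<Longrightarrow> smooth_on S f \<Longrightarrow> smooth_on S g"
  unfolding smooth_on_def by (intro allI Ck_on_cong[of S f g]) auto

lemma smooth_on_subset: "smooth_on S f \<Longrightarrow> T \<subseteq> S \<Longrightarrow> smooth_on T f"
  unfolding smooth_on_def using Ck_on_subset[of _ f S T] by auto

lemma smooth_on_compose:
  fixes g :: "'a::euclidean_space \<Rightarrow> 'b::euclidean_space" and f :: "'b \<Rightarrow> 'c::real_normed_vector"
  assumes "open S" "smooth_on T f" "g ` S \<subseteq> T" "smooth_on S g"
  shows "smooth_on S (\<lambda>x. f (g x))"
  using assms unfolding smooth_on_def by (intro allI Ck_on_compose[of S g T _ f]) auto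

lemma smooth_on_const: "open S \<Longrightarrow> smooth_on S (\<lambda>x. a)"
  and smooth_on_id: "open S \<Longrightarrow> smooth_on S (\<lambda>x. x)"
  and smooth_on_sin: "smooth_on UNIV (sin :: real \<Rightarrow> real)"
  and smooth_on_cos: "smooth_on UNIV (cos :: real \<Rightarrow> real)"
  by (simp_all add: smooth_on_def Ck_on_const Ck_on_id Ck_on_sin_cos)

lemma smooth_on_bounded_linear:
  "bounded_linear L \<Longrightarrow> open S \<Longrightarrow> smooth_on S f \<Longrightarrow> smooth_on S (\<lambda>x. L (f x))"
  by (simp add: smooth_on_def Ck_on_bounded_linear)

lemma smooth_on_add: "open S \<Longrightarrow> smooth_on S f \<Longrightarrow> smooth_on S g \<Longrightarrow> smooth_on S (\<lambda>x. f x + g x)"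
  by (simp add: smooth_on_def Ck_on_add)

lemma smooth_on_bilinear:
  "bounded_bilinear B \<Longrightarrow> open S \<Longrightarrow> smooth_on S f \<Longrightarrow> smooth_on S g \<Longrightarrow> smooth_on S (\<lambda>x. B (f x) (g x))"
  by (simp add: smooth_on_def Ck_on_bilinear)

lemmas smooth_on_mult = smooth_on_bilinear[OF bounded_bilinear_mult]
  and smooth_on_scaleR = smooth_on_bilinear[OF bounded_bilinear_scaleR]
  and smooth_on_inner = smooth_on_bilinear[OF bounded_bilinear_inner]
  and smooth_on_minus = smooth_on_bounded_linear[OF bounded_linear_minus[OF bounded_linear_ident]]
  and smooth_on_fst = smooth_on_bounded_linear[OF bounded_linear_fst]
  and smooth_on_snd = smooth_on_bounded_linear[OF bounded_linear_snd]

lemma smooth_on_diff: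
  assumes "open S" "smooth_on S f" "smooth_on S g" shows "smooth_on S (\<lambda>x. f x - g x)"
  using smooth_on_add[OF assms(1,2) smooth_on_minus[OF assms(1,3)]] by simp

lemma smooth_on_Pair:
  "open S \<Longrightarrow> smooth_on S f \<Longrightarrow> smooth_on S g \<Longrightarrow> smooth_on S (\<lambda>x. (f x, g x))"
  by (simp add: smooth_on_def Ck_on_Pair)

lemma smooth_on_inverse:
  fixes f :: "'a::euclidean_space \<Rightarrow> real"
  shows "open S \<Longrightarrow> (\<And>x. x \<in> S \<Longrightarrow> f x \<noteq> 0) \<Longrightarrow> smooth_on S f \<Longrightarrow> smooth_on S (\<lambda>x. inverse (f x))"
  by (simp add: smooth_on_def Ck_on_inverse)

lemma smooth_on_divide:
  fixes f :: "'a::euclidean_space \<Rightarrow> real"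
  shows "open S \<Longrightarrow> (\<And>x. x \<in> S \<Longrightarrow> f x \<noteq> 0) \<Longrightarrow> smooth_on S g \<Longrightarrow> smooth_on S f \<Longrightarrow> smooth_on S (\<lambda>x. g x / f x)"
  unfolding divide_inverse by (intro smooth_on_mult smooth_on_inverse)

lemma smooth_on_sqrt:
  fixes f :: "'a::euclidean_space \<Rightarrow> real"
  shows "open S \<Longrightarrow> (\<And>x. x \<in> S \<Longrightarrow> f x > 0) \<Longrightarrow> smooth_on S f \<Longrightarrow> smooth_on S (\<lambda>x. sqrt (f x))"
  by (simp add: smooth_on_def Ck_on_sqrt)

lemma smooth_on_power:
  fixes f :: "'a::euclidean_space \<Rightarrow> real"
  assumes "open S" "smooth_on S f" shows "smooth_on S (\<lambda>x. f x ^ n)"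
proof (induction n)
  case (Suc n)
  show ?case using smooth_on_mult[OF assms Suc.IH] by simp
qed (use assms(1) in \<open>simp add: smooth_on_const\<close>)

lemmas smooth_intros = smooth_on_const smooth_on_id smooth_on_fst smooth_on_snd smooth_on_add
  smooth_on_diff smooth_on_minus smooth_on_mult smooth_on_scaleR smooth_on_inner smooth_on_power
  smooth_on_Pair

lemma smooth_on_imp_has_derivative:
  assumes "smooth_on S f" "x \<in> S"
  shows "(f has_derivative frechet_derivative f (at x)) (at x)"
  using assms Ck_on_SucD(1)[of 0 f S x] by (simp add: smooth_on_def)

lemma smooth_on_imp_continuous_on: "smooth_on S f \<Longrightarrow> continuous_on S f"
  unfolding smooth_on_def by (drule spec[of _ 0]) simp

lemma smooth_on_frechet_derivative:
  "smooth_on S f \<Longrightarrow> smooth_on S (\<lambda>x. frechet_derivative f (at x) v)"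
  by (simp add: smooth_on_def Ck_on_SucD(2))

lemma smooth_on_imp_has_vector_derivative:
  assumes "smooth_on S \<gamma>" "t \<in> S"
  shows "(\<gamma> has_vector_derivative vector_derivative \<gamma> (at t)) (at t)"
  using smooth_on_imp_has_derivative[OF assms]
  by (meson differentiableI vector_derivative_works)

lemma smooth_on_vector_derivative:
  assumes "open S" "smooth_on S \<gamma>"
  shows "smooth_on S (\<lambda>t. vector_derivative \<gamma> (at t))"
proof (rule smooth_on_cong[OF assms(1) _ smooth_on_frechet_derivative[OF assms(2)]])
  show "frechet_derivative \<gamma> (at t) 1 = vector_derivative \<gamma> (at t)" if "t \<in> S" for t
    using smooth_on_imp_has_derivative[OF assms(2) that]
    by (simp add: differentiableI frechet_derivative_eq_vector_derivative)
qed


section \<open>Smooth implicit functions\<close>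

text \<open>
  The map \<open>\<Phi>(x, y) = (x, H(x, y))\<close> is injective on a small square because \<open>H\<close> is
  strictly monotone in \<open>y\<close> there.  By invariance of domain it has a continuous inverse
  with open domain, which is differentiable because \<open>D\<Phi>\<close> is invertible; the implicit
  function is the second component of \<open>\<Phi>\<^sup>-\<^sup>1(x, 0)\<close>.  It is smooth because its
  derivative is a smooth function of the point \<open>(x, f x)\<close>.  The bound \<open>\<rho>\<close> allows one to
  make the box of validity as small as desired.
\<close>

lemma implicit_function:
  fixes H :: "real \<times> real \<Rightarrow> real"
  assumes H: "smooth_on UNIV H" and H0: "H (0, 0) = 0"
    and nd: "frechet_derivative H (at (0, 0)) (0, 1) \<noteq> 0" and \<rho>: "\<rho> > 0"
  obtains \<epsilon> \<delta> f where "0 < \<epsilon>" "\<epsilon> \<le> \<rho>" "0 < \<delta>" "\<delta> \<le> \<rho>" "smooth_on {- \<epsilon> <..< \<epsilon>} f" "f 0 = 0"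
    "\<And>x. \<bar>x\<bar> < \<epsilon> \<Longrightarrow> \<bar>f x\<bar> < \<delta>"
    "\<And>x y. \<bar>x\<bar> < \<epsilon> \<Longrightarrow> \<bar>y\<bar> < \<delta> \<Longrightarrow> H (x, y) = 0 \<longleftrightarrow> y = f x"
proof -
  define Dx where "Dx p = frechet_derivative H (at p) (1, 0)" for p
  define Dy where "Dy p = frechet_derivative H (at p) (0, 1)" for p
  have dH: "(H has_derivative (\<lambda>v. fst v * Dx p + snd v * Dy p)) (at p)" for p
  proof -
    have d: "(H has_derivative frechet_derivative H (at p)) (at p)"
      using smooth_on_imp_has_derivative[OF H] by simp
    interpret bounded_linear "frechet_derivative H (at p)" by (rule has_derivative_bounded_linear[OF d])
    have "frechet_derivative H (at p) v = fst v * Dx p + snd v * Dy p" for v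
    proof -
      have "v = fst v *\<^sub>R (1, 0) + snd v *\<^sub>R (0, 1)" by (simp add: prod_eq_iff)
      then show ?thesis unfolding Dx_def Dy_def by (metis add scaleR real_scaleR_def)
    qed
    then show ?thesis by (intro has_derivative_eq_rhs[OF d] ext)
  qed
  have sDx: "smooth_on UNIV Dx" and sDy: "smooth_on UNIV Dy"
    unfolding Dx_def Dy_def by (intro smooth_on_frechet_derivative H)+
  define N where "N = {p. Dy p \<noteq> 0}"
  have "open N"
    unfolding N_def using smooth_on_imp_continuous_on[OF sDy] by (intro open_Collect_neq continuous_intros)
  moreover have "(0, 0) \<in> N" using nd by (simp add: N_def Dy_def)
  ultimately obtain r where r: "r > 0" "ball (0, 0) r \<subseteq> N" using openE by blast
  define \<delta> where "\<delta> = min \<rho> (r / 2)"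
  have \<delta>: "0 < \<delta>" "\<delta> \<le> \<rho>" "2 * \<delta> \<le> r" using \<rho> r(1) by (auto simp: \<delta>_def)
  define B where "B = {- \<delta> <..< \<delta>} \<times> {- \<delta> <..< \<delta>}"
  have B: "open B" by (simp add: B_def open_Times)
  have BN: "B \<subseteq> N"
  proof
    fix p assume "p \<in> B"
    then have "\<bar>fst p\<bar> < \<delta>" "\<bar>snd p\<bar> < \<delta>" by (auto simp: B_def)
    then have "norm p < r"
      using norm_Pair_le[of "fst p" "snd p"] \<delta>(3) by simp
    then show "p \<in> N" using r(2) by (auto simp: dist_norm zero_prod_def[symmetric])
  qed
  define \<Phi> where "\<Phi> p = (fst p, H p)" for p
  have d\<Phi>: "(\<Phi> has_derivative (\<lambda>v. (fst v, fst v * Dx p + snd v * Dy p))) (at p)" for p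
    unfolding \<Phi>_def by (intro has_derivative_Pair has_derivative_fst has_derivative_ident dH)
  have c\<Phi>: "continuous_on B \<Phi>"
    by (intro continuous_at_imp_continuous_on ballI has_derivative_continuous[OF d\<Phi>])
  have inj: "inj_on \<Phi> B"
  proof -
    have False if "(x, y) \<in> B" "(x, y') \<in> B" "H (x, y) = H (x, y')" "y < y'" for x y y'
    proof -
      have "((\<lambda>s. H (x, s)) has_real_derivative Dy (x, s)) (at s)" for s
        unfolding has_field_derivative_def
        by (rule has_derivative_eq_rhs[OF has_derivative_compose[OF _ dH]])
           (rule has_derivative_Pair[OF has_derivative_const has_derivative_ident], auto)
      from MVT2[OF that(4) this] obtain \<xi> where \<xi>: "y < \<xi>" "\<xi> < y'"
        "H (x, y') - H (x, y) = (y' - y) * Dy (x, \<xi>)" by blast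
      have "(x, \<xi>) \<in> B" using that(1,2) \<xi>(1,2) by (auto simp: B_def)
      then have "Dy (x, \<xi>) \<noteq> 0" using BN by (auto simp: N_def)
      then show False using \<xi> that(3,4) by simp
    qed
    then show ?thesis
      by (auto simp: inj_on_def \<Phi>_def) (metis linorder_less_linear)
  qed
  obtain g where g: "homeomorphism B (\<Phi> ` B) \<Phi> g"
    by (rule invariance_of_domain_homeomorphism[OF B c\<Phi> order_refl inj])
  have o: "open (\<Phi> ` B)" by (rule invariance_of_domain[OF c\<Phi> B inj])
  have "(0, 0) \<in> \<Phi> ` B"
    using \<delta> H0 by (intro image_eqI[of _ _ "(0, 0)"]) (auto simp: \<Phi>_def B_def)
  with o obtain r' where r': "r' > 0" "ball (0, 0) r' \<subseteq> \<Phi> ` B" using openE by blast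
  define \<epsilon> where "\<epsilon> = min \<delta> r'"
  have \<epsilon>: "0 < \<epsilon>" "\<epsilon> \<le> \<delta>" using \<delta> r' by (auto simp: \<epsilon>_def)
  define f where "f x = snd (g (x, 0))" for x
  have gB: "g (x, 0) = (x, f x)" "(x, f x) \<in> B" "H (x, f x) = 0" if "\<bar>x\<bar> < \<epsilon>" for x
  proof -
    have "(x, 0) \<in> ball (0, 0) r'" using that by (simp add: dist_Pair_Pair \<epsilon>_def)
    then have "(x, 0) \<in> \<Phi> ` B" using r'(2) by blast
    then have *: "g (x, 0) \<in> B" "\<Phi> (g (x, 0)) = (x, 0)"
      using g by (auto simp: homeomorphism_def)
    then show "g (x, 0) = (x, f x)" by (simp add: \<Phi>_def f_def prod_eq_iff)
    then show "(x, f x) \<in> B" "H (x, f x) = 0" using * by (simp_all add: \<Phi>_def)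
  qed
  have uniq: "y = f x" if "\<bar>x\<bar> < \<epsilon>" "\<bar>y\<bar> < \<delta>" "H (x, y) = 0" for x y
  proof -
    have "(x, y) \<in> B" using that \<epsilon> by (auto simp: B_def)
    moreover have "\<Phi> (x, y) = (x, 0)" using that by (simp add: \<Phi>_def)
    ultimately have "g (x, 0) = (x, y)" using g by (metis homeomorphism_apply1)
    then show ?thesis by (simp add: f_def)
  qed
  have df: "(f has_derivative (\<lambda>v. v * (- Dx (x, f x) / Dy (x, f x)))) (at x)" if x: "\<bar>x\<bar> < \<epsilon>" for x
  proof -
    let ?p = "(x, f x)"
    have D: "Dy ?p \<noteq> 0" using gB(2)[OF x] BN by (auto simp: N_def)
    have "(g has_derivative (\<lambda>w. (fst w, (snd w - fst w * Dx ?p) / Dy ?p))) (at (\<Phi> ?p))"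
    proof (rule has_derivative_inverse_strong[OF B gB(2)[OF x] c\<Phi> _ d\<Phi>])
      show "g (\<Phi> p) = p" if "p \<in> B" for p using g that by (simp add: homeomorphism_def)
    qed (use D in \<open>auto simp: fun_eq_iff\<close>)
    then have "(g has_derivative (\<lambda>w. (fst w, (snd w - fst w * Dx ?p) / Dy ?p))) (at (x, 0))"
      using gB(3)[OF x] by (simp add: \<Phi>_def)
    from has_derivative_snd[OF has_derivative_compose[OF has_derivative_Pair[OF has_derivative_ident has_derivative_const] this]]
    show ?thesis
      unfolding f_def[abs_def] by (rule has_derivative_eq_rhs) (simp add: f_def fun_eq_iff)
  qed
  let ?I = "{- \<epsilon> <..< \<epsilon>}"
  have N: "open N" by fact
  have sN: "smooth_on N (\<lambda>p. - Dx p / Dy p)"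
    by (intro smooth_on_divide smooth_on_minus N smooth_on_subset[OF sDx] smooth_on_subset[OF sDy])
      (auto simp: N_def)
  have "Ck_on k f ?I" for k
  proof (induction k)
    case 0
    show ?case using has_derivative_continuous[OF df]
      by (auto intro!: continuous_at_imp_continuous_on)
  next
    case (Suc k)
    show ?case
    proof (rule Ck_on_SucI)
      show "(f has_derivative (\<lambda>v. v * (- Dx (x, f x) / Dy (x, f x)))) (at x)" if "x \<in> ?I" for x
        using df that by auto
      have "(\<lambda>x. (x, f x)) ` ?I \<subseteq> N"
      proof (intro image_subsetI)
        show "(x, f x) \<in> N" if "x \<in> ?I" for x using gB(2)[of x] BN that by auto
      qed
      then have "Ck_on k (\<lambda>x. - Dx (x, f x) / Dy (x, f x)) ?I"
        by (intro Ck_on_compose[of ?I "\<lambda>x. (x, f x)" N k "\<lambda>p. - Dx p / Dy p"] Ck_on_Pair Ck_on_id Suc.IH)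
           (use sN in \<open>auto simp: smooth_on_def\<close>)
      then show "Ck_on k (\<lambda>x. v * (- Dx (x, f x) / Dy (x, f x))) ?I" for v
        by (intro Ck_on_bounded_linear[OF bounded_linear_mult_right]) auto
    qed simp
  qed
  then have "smooth_on ?I f" by (simp add: smooth_on_def)
  moreover have "f 0 = 0" using uniq[of 0 0] \<epsilon> \<delta> H0 by simp
  moreover have "\<bar>f x\<bar> < \<delta>" if "\<bar>x\<bar> < \<epsilon>" for x using gB(2)[OF that] by (auto simp: B_def)
  moreover have "H (x, y) = 0 \<longleftrightarrow> y = f x" if "\<bar>x\<bar> < \<epsilon>" "\<bar>y\<bar> < \<delta>" for x y
    using uniq[OF that] gB(3)[OF that(1)] by auto
  ultimately show ?thesis using that[of \<epsilon> \<delta> f] \<epsilon> \<delta> by fastforce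
qed


section \<open>Finite unions of arcs near a point\<close>

definition arc_nbhd ::
    "((real \<Rightarrow> real \<times> real) \<Rightarrow> real set \<Rightarrow> bool) \<Rightarrow> (real \<times> real) set \<Rightarrow> real \<times> real \<Rightarrow>
      (real \<times> real) set \<Rightarrow> bool"
  where "arc_nbhd P S x0 U \<longleftrightarrow> open U \<and> x0 \<in> U \<and> (\<exists>(r::nat) \<gamma> t \<epsilon>.
     (\<forall>i<r. \<epsilon> i > 0 \<and> P (\<gamma> i) {t i - \<epsilon> i <..< t i + \<epsilon> i} \<and> \<gamma> i (t i) = x0) \<and>
     (\<Union>i<r. \<gamma> i ` {t i - \<epsilon> i <..< t i + \<epsilon> i}) = U \<inter> S)"

text \<open>
  The arcs are required to exist in every neighbourhood \<open>W\<close>.  This makes the notion depend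
  only on the germ of \<open>S\<close>: a given family of arcs cannot simply be cut down to \<open>W\<close>, since
  the part of an arc inside \<open>W\<close> need not be connected.
\<close>

definition arcs_near ::
    "((real \<Rightarrow> real \<times> real) \<Rightarrow> real set \<Rightarrow> bool) \<Rightarrow> (real \<times> real) set \<Rightarrow> real \<times> real \<Rightarrow> bool" where
  "arcs_near P S x0 \<longleftrightarrow> (\<forall>W. open W \<longrightarrow> x0 \<in> W \<longrightarrow> (\<exists>U\<subseteq>W. arc_nbhd P S x0 U))"

lemma locally_finite_union_ofI:
  assumes "\<And>x. x \<in> S \<Longrightarrow> arcs_near P S x"
  shows "locally_finite_union_of P S"
  unfolding locally_finite_union_of_def
proof (intro ballI)
  fix x0 assume "x0 \<in> S"
  from assms[OF this] obtain U where U: "arc_nbhd P S x0 U"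
    unfolding arcs_near_def using open_UNIV UNIV_I by blast
  show "\<exists>U (r::nat) \<gamma> t \<epsilon>. open U \<and> x0 \<in> U \<and>
     (\<forall>i<r. \<epsilon> i > 0 \<and> P (\<gamma> i) {t i - \<epsilon> i <..< t i + \<epsilon> i} \<and> \<gamma> i (t i) = x0) \<and>
     (\<Union>i<r. \<gamma> i ` {t i - \<epsilon> i <..< t i + \<epsilon> i}) = U \<inter> S"
    by (rule exI[of _ U]) (use U in \<open>simp only: arc_nbhd_def ex_simps simp_thms\<close>)
qed

lemma arcs_near_cong:
  assumes N: "open N" "x0 \<in> N" and eq: "N \<inter> S = N \<inter> S'" and a: "arcs_near P S x0"
  shows "arcs_near P S' x0"
  unfolding arcs_near_def
proof (intro allI impI)
  fix W assume W: "open W" "x0 \<in> W"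
  have "open (W \<inter> N)" "x0 \<in> W \<inter> N" using N W by auto
  with a obtain U where U: "U \<subseteq> W \<inter> N" "arc_nbhd P S x0 U"
    unfolding arcs_near_def by blast
  have "U \<inter> S = U \<inter> S'" using U(1) eq by blast
  then have "arc_nbhd P S' x0 U" using U(2) unfolding arc_nbhd_def by simp
  then show "\<exists>U\<subseteq>W. arc_nbhd P S' x0 U" using U(1) by blast
qed

lemma arcs_near_mono:
  assumes a: "arcs_near P S x0" and PQ: "\<And>\<gamma> I. P \<gamma> I \<Longrightarrow> Q \<gamma> I"
  shows "arcs_near Q S x0"
proof -
  have "arc_nbhd Q S x0 U" if "arc_nbhd P S x0 U" for U
  proof -
    from that obtain r :: nat and \<gamma> t \<epsilon> where U: "open U" "x0 \<in> U"
      "\<forall>i<r. \<epsilon> i > 0 \<and> P (\<gamma> i) {t i - \<epsilon> i <..< t i + \<epsilon> i} \<and> \<gamma> i (t i) = x0"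
      "(\<Union>i<r. \<gamma> i ` {t i - \<epsilon> i <..< t i + \<epsilon> i}) = U \<inter> S"
      unfolding arc_nbhd_def by (elim conjE exE)
    show ?thesis
      unfolding arc_nbhd_def using U
      by (intro conjI exI[of _ r] exI[of _ \<gamma>] exI[of _ t] exI[of _ \<epsilon>]) (simp_all add: PQ)
  qed
  then show ?thesis using a unfolding arcs_near_def by meson
qed

lemma arcs_near_single:
  assumes "\<And>W. open W \<Longrightarrow> x0 \<in> W \<Longrightarrow> \<exists>U \<gamma> \<epsilon>. U \<subseteq> W \<and> open U \<and> x0 \<in> U \<and> \<epsilon> > 0 \<and>
    P \<gamma> {- \<epsilon> <..< \<epsilon>} \<and> \<gamma> 0 = x0 \<and> \<gamma> ` {- \<epsilon> <..< \<epsilon>} = U \<inter> S"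
  shows "arcs_near P S x0"
  unfolding arcs_near_def
proof (intro allI impI)
  fix W assume "open W" "x0 \<in> W"
  from assms[OF this] obtain U \<gamma> \<epsilon> where U: "U \<subseteq> W" "open U" "x0 \<in> U" "\<epsilon> > 0"
    "P \<gamma> {- \<epsilon> <..< \<epsilon>}" "\<gamma> 0 = x0" "\<gamma> ` {- \<epsilon> <..< \<epsilon>} = U \<inter> S"
    by (elim exE conjE)
  have "arc_nbhd P S x0 U"
    unfolding arc_nbhd_def using U
    by (intro conjI exI[of _ "1::nat"] exI[of _ "\<lambda>_. \<gamma>"] exI[of _ "\<lambda>_. 0"] exI[of _ "\<lambda>_. \<epsilon>"]) auto
  then show "\<exists>U\<subseteq>W. arc_nbhd P S x0 U" using U(1) by blast
qed

lemma arcs_near_pair: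
  assumes "\<And>W. open W \<Longrightarrow> x0 \<in> W \<Longrightarrow> \<exists>U \<gamma>1 \<gamma>2 \<epsilon>. U \<subseteq> W \<and> open U \<and> x0 \<in> U \<and> \<epsilon> > 0 \<and>
    P \<gamma>1 {- \<epsilon> <..< \<epsilon>} \<and> \<gamma>1 0 = x0 \<and> P \<gamma>2 {- \<epsilon> <..< \<epsilon>} \<and> \<gamma>2 0 = x0 \<and>
    \<gamma>1 ` {- \<epsilon> <..< \<epsilon>} \<union> \<gamma>2 ` {- \<epsilon> <..< \<epsilon>} = U \<inter> S"
  shows "arcs_near P S x0"
  unfolding arcs_near_def
proof (intro allI impI)
  fix W assume "open W" "x0 \<in> W"
  from assms[OF this] obtain U \<gamma>1 \<gamma>2 \<epsilon> where U: "U \<subseteq> W" "open U" "x0 \<in> U" "\<epsilon> > 0"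
    "P \<gamma>1 {- \<epsilon> <..< \<epsilon>}" "\<gamma>1 0 = x0" "P \<gamma>2 {- \<epsilon> <..< \<epsilon>}" "\<gamma>2 0 = x0"
    "\<gamma>1 ` {- \<epsilon> <..< \<epsilon>} \<union> \<gamma>2 ` {- \<epsilon> <..< \<epsilon>} = U \<inter> S"
    by (elim exE conjE)
  have 2: "(\<Union>i<2::nat. A i) = A 0 \<union> A 1" for A :: "nat \<Rightarrow> (real \<times> real) set"
    by (auto simp: less_2_cases_iff)
  have "arc_nbhd P S x0 U"
    unfolding arc_nbhd_def
    by (intro conjI exI[of _ "2::nat"] exI[of _ "\<lambda>i. if i = 0 then \<gamma>1 else \<gamma>2"]
        exI[of _ "\<lambda>_. 0"] exI[of _ "\<lambda>_. \<epsilon>"]) (use U in \<open>simp_all add: 2\<close>)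
  then show "\<exists>U\<subseteq>W. arc_nbhd P S x0 U" using U(1) by blast
qed

text \<open>
  A constant curve is a front only through a rotating unit normal, since the velocity contributes
  nothing to the immersion condition.
\<close>

lemma arcs_near_isolated:
  assumes "open N" "N \<inter> S = {x0}"
  shows "arcs_near front S x0"
proof (rule arcs_near_single)
  fix W assume W: "open W" "x0 \<in> W"
  define \<nu> where "\<nu> t = (cos t, sin t)" for t :: real
  have d: "(\<nu> has_vector_derivative (- sin t, cos t)) (at t)" for t
    unfolding \<nu>_def has_vector_derivative_def
    by (auto intro!: derivative_eq_intros has_derivative_Pair)
  have "smooth_on UNIV \<nu>"
    unfolding \<nu>_def by (intro smooth_on_Pair smooth_on_sin smooth_on_cos) auto
  then have "smooth_on {- 1 <..< 1} \<nu>" by (rule smooth_on_subset) auto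
  then have "front (\<lambda>_. x0) {- 1 <..< 1}"
    unfolding front_def unit_normal_along_def
    by (intro conjI smooth_on_const exI[of _ \<nu>] ballI)
       (auto simp: vector_derivative_at[OF d] vector_derivative_const_at norm_Pair zero_prod_def,
        auto simp: \<nu>_def norm_Pair, metis sin_cos_squared_add zero_power2 add_0 zero_neq_one)
  then show "\<exists>U \<gamma> \<epsilon>. U \<subseteq> W \<and> open U \<and> x0 \<in> U \<and> \<epsilon> > 0 \<and>
    front \<gamma> {- \<epsilon> <..< \<epsilon>} \<and> \<gamma> 0 = x0 \<and> \<gamma> ` {- \<epsilon> <..< \<epsilon>} = U \<inter> S"
    using W assms by (intro exI[of _ "W \<inter> N"] exI[of _ "\<lambda>_. x0"] exI[of _ 1]) (auto simp: image_constant_conv)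
qed

lemma regular_curve_imp_front:
  assumes I: "open I" and r: "regular_curve \<gamma> I"
  shows "front \<gamma> I"
proof -
  let ?d = "\<lambda>t. vector_derivative \<gamma> (at t)"
  have s: "smooth_on I \<gamma>" and nz: "\<And>t. t \<in> I \<Longrightarrow> ?d t \<noteq> 0"
    using r by (auto simp: regular_curve_def)
  have sd: "smooth_on I ?d" by (rule smooth_on_vector_derivative[OF I s])
  define \<nu> where "\<nu> t = inverse (sqrt (?d t \<bullet> ?d t)) *\<^sub>R (- snd (?d t), fst (?d t))" for t
  have "smooth_on I \<nu>"
    unfolding \<nu>_def using nz by (intro smooth_intros smooth_on_inverse smooth_on_sqrt sd I) auto
  moreover have "norm (\<nu> t) = 1" if "t \<in> I" for t
  proof -
    have "norm (- snd (?d t), fst (?d t)) = norm (?d t)"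
      by (simp add: norm_Pair norm_prod_def add.commute)
    then show ?thesis using nz[OF that]
      unfolding \<nu>_def norm_scaleR by (simp add: norm_eq_sqrt_inner[symmetric])
  qed
  moreover have "?d t \<bullet> \<nu> t = 0" for t
    by (simp add: \<nu>_def inner_prod_def)
  ultimately have "unit_normal_along \<nu> \<gamma> I" by (simp add: unit_normal_along_def)
  then show ?thesis using s nz unfolding front_def by auto
qed

abbreviation regular_arcs_near :: "(real \<times> real) set \<Rightarrow> real \<times> real \<Rightarrow> bool" where
  "regular_arcs_near \<equiv> arcs_near (\<lambda>\<gamma> I. front \<gamma> I \<and> regular_curve \<gamma> I)"

lemma regular_arcs_near_regular_zero:
  fixes F :: "real \<times> real \<Rightarrow> real"
  assumes F: "smooth_on UNIV F" and F0: "F x0 = 0" and nz: "frechet_derivative F (at x0) v \<noteq> 0"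
  shows "regular_arcs_near {z. F z = 0} x0"
proof (rule arcs_near_single)
  fix W assume W: "open W" "x0 \<in> W"
  let ?D = "frechet_derivative F (at x0)"
  have dF: "(F has_derivative ?D) (at x0)" using smooth_on_imp_has_derivative[OF F] by simp
  interpret D: bounded_linear ?D by (rule has_derivative_bounded_linear[OF dF])
  have "?D (1, 0) \<noteq> 0 \<or> ?D (0, 1) \<noteq> 0"
  proof (rule ccontr)
    assume "\<not> ?thesis"
    moreover have "v = fst v *\<^sub>R (1, 0) + snd v *\<^sub>R (0, 1)" by (simp add: prod_eq_iff)
    ultimately show False using nz by (metis D.add D.scaleR scaleR_zero_right add_0)
  qed
  then obtain d e :: "real \<times> real" where e: "?D e \<noteq> 0" and de: "d \<bullet> d = 1" "e \<bullet> e = 1" "d \<bullet> e = 0"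
    and rep: "\<And>z. z = (z \<bullet> d) *\<^sub>R d + (z \<bullet> e) *\<^sub>R e"
  proof (elim disjE)
    assume "?D (1, 0) \<noteq> 0"
    then show thesis by (rule that[of "(1, 0)" "(0, 1)"]) (auto simp: prod_eq_iff inner_prod_def)
  next
    assume "?D (0, 1) \<noteq> 0"
    then show thesis by (rule that[of "(0, 1)" "(1, 0)"]) (auto simp: prod_eq_iff inner_prod_def)
  qed
  define L where "L p = x0 + fst p *\<^sub>R d + snd p *\<^sub>R e" for p :: "real \<times> real"
  have dL: "(L has_derivative (\<lambda>v. fst v *\<^sub>R d + snd v *\<^sub>R e)) (at p)" for p
    unfolding L_def by (auto intro!: derivative_eq_intros)
  have sL: "smooth_on UNIV L" unfolding L_def by (intro smooth_intros) auto
  define H where "H p = F (L p)" for p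
  have H: "smooth_on UNIV H" unfolding H_def by (rule smooth_on_compose[OF _ F _ sL]) auto
  have L0: "L (0, 0) = x0" by (simp add: L_def)
  have "(H has_derivative (\<lambda>v. ?D (fst v *\<^sub>R d + snd v *\<^sub>R e))) (at (0, 0))"
    unfolding H_def by (rule has_derivative_compose[OF dL]) (simp add: L0 dF)
  then have "frechet_derivative H (at (0, 0)) = (\<lambda>v. ?D (fst v *\<^sub>R d + snd v *\<^sub>R e))"
    by (rule frechet_derivative_at[symmetric])
  then have nd: "frechet_derivative H (at (0, 0)) (0, 1) \<noteq> 0"
    using e by simp
  obtain r where r: "r > 0" "ball x0 r \<subseteq> W" using W openE by blast
  obtain \<epsilon> \<delta> f where \<epsilon>: "0 < \<epsilon>" "\<epsilon> \<le> r / 2" and \<delta>: "0 < \<delta>" "\<delta> \<le> r / 2"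
    and f: "smooth_on {- \<epsilon> <..< \<epsilon>} f" "f 0 = 0" "\<And>x. \<bar>x\<bar> < \<epsilon> \<Longrightarrow> \<bar>f x\<bar> < \<delta>"
    "\<And>x y. \<bar>x\<bar> < \<epsilon> \<Longrightarrow> \<bar>y\<bar> < \<delta> \<Longrightarrow> H (x, y) = 0 \<longleftrightarrow> y = f x"
    by (rule implicit_function[OF H _ nd, of "r / 2"]) (use F0 L0 r(1) in \<open>auto simp: H_def\<close>)
  define U where "U = {z. \<bar>(z - x0) \<bullet> d\<bar> < \<epsilon> \<and> \<bar>(z - x0) \<bullet> e\<bar> < \<delta>}"
  define \<gamma> where "\<gamma> s = L (s, f s)" for s
  have coord: "(L p - x0) \<bullet> d = fst p" "(L p - x0) \<bullet> e = snd p" for p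
    using de by (simp_all add: L_def inner_add_left inner_commute[of e d])
  have repL: "z = L ((z - x0) \<bullet> d, (z - x0) \<bullet> e)" for z
    using rep[of "z - x0"] by (simp add: L_def algebra_simps)
  have "open U"
    unfolding U_def by (intro open_Collect_conj open_Collect_less continuous_intros)
  moreover have "x0 \<in> U" using \<epsilon> \<delta> by (simp add: U_def)
  moreover have "U \<subseteq> W"
  proof
    fix z assume z: "z \<in> U"
    have "norm (z - x0) \<le> norm (((z - x0) \<bullet> d) *\<^sub>R d) + norm (((z - x0) \<bullet> e) *\<^sub>R e)"
      by (subst rep[of "z - x0"]) (rule norm_triangle_ineq)
    also have "\<dots> = \<bar>(z - x0) \<bullet> d\<bar> + \<bar>(z - x0) \<bullet> e\<bar>"
      using de by (simp add: norm_eq_sqrt_inner)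
    also have "\<dots> < r" using z \<epsilon> \<delta> by (simp add: U_def)
    finally show "z \<in> W" using r(2) by (auto simp: dist_norm norm_minus_commute)
  qed
  moreover have reg: "regular_curve \<gamma> {- \<epsilon> <..< \<epsilon>}"
    unfolding regular_curve_def
  proof
    show s: "smooth_on {- \<epsilon> <..< \<epsilon>} \<gamma>"
      unfolding \<gamma>_def by (rule smooth_on_compose[OF _ sL]) (auto intro!: smooth_intros f)
    show "\<forall>t\<in>{- \<epsilon> <..< \<epsilon>}. vector_derivative \<gamma> (at t) \<noteq> 0"
    proof
      fix t assume "t \<in> {- \<epsilon> <..< \<epsilon>}"
      from smooth_on_imp_has_vector_derivative[OF s this]
      have "((\<lambda>t. (\<gamma> t - x0) \<bullet> d) has_vector_derivative vector_derivative \<gamma> (at t) \<bullet> d) (at t)"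
        by (auto simp: has_vector_derivative_def intro!: derivative_eq_intros)
      moreover have "(\<lambda>t. (\<gamma> t - x0) \<bullet> d) = (\<lambda>t. t)" by (simp add: \<gamma>_def coord)
      ultimately have "((\<lambda>t. t) has_vector_derivative vector_derivative \<gamma> (at t) \<bullet> d) (at t)"
        by simp
      from vector_derivative_at[OF this] vector_derivative_at[OF has_vector_derivative_id[of "at t"]]
      have "vector_derivative \<gamma> (at t) \<bullet> d = 1"
        by simp
      then show "vector_derivative \<gamma> (at t) \<noteq> 0" by auto
    qed
  qed
  moreover have "\<gamma> 0 = x0" by (simp add: \<gamma>_def f(2) L0)
  moreover have "\<gamma> ` {- \<epsilon> <..< \<epsilon>} = U \<inter> {z. F z = 0}"
  proof (intro equalityI subsetI)
    fix z assume "z \<in> \<gamma> ` {- \<epsilon> <..< \<epsilon>}"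
    then obtain s where "s \<in> {- \<epsilon> <..< \<epsilon>}" "z = \<gamma> s" by blast
    then have s: "\<bar>s\<bar> < \<epsilon>" "z = L (s, f s)" by (auto simp: \<gamma>_def)
    then show "z \<in> U \<inter> {z. F z = 0}"
      using f(3)[OF s(1)] f(4)[OF s(1) f(3)[OF s(1)]] by (auto simp: U_def coord H_def)
  next
    fix z assume z: "z \<in> U \<inter> {z. F z = 0}"
    let ?s = "(z - x0) \<bullet> d" and ?y = "(z - x0) \<bullet> e"
    have "H (?s, ?y) = 0" using z repL[of z] by (simp add: H_def)
    then have "?y = f ?s" using f(4)[of ?s ?y] z by (simp add: U_def)
    then have "z = \<gamma> ?s" using repL[of z] by (simp add: \<gamma>_def)
    then show "z \<in> \<gamma> ` {- \<epsilon> <..< \<epsilon>}"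
      by (rule image_eqI) (use z in \<open>auto simp: U_def\<close>)
  qed
  ultimately show "\<exists>U \<gamma> \<epsilon>. U \<subseteq> W \<and> open U \<and> x0 \<in> U \<and> \<epsilon> > 0 \<and>
    (front \<gamma> {- \<epsilon> <..< \<epsilon>} \<and> regular_curve \<gamma> {- \<epsilon> <..< \<epsilon>}) \<and> \<gamma> 0 = x0 \<and> \<gamma> ` {- \<epsilon> <..< \<epsilon>} = U \<inter> {z. F z = 0}"
    using \<epsilon>(1) regular_curve_imp_front[OF _ reg] by (intro exI[of _ U] exI[of _ \<gamma>] exI[of _ \<epsilon>]) auto
qed


section \<open>The inverted conic away from the origin, and its components\<close>

lemma eval2_pCons: "eval2 (pCons p P) x y = poly p x + y * eval2 P x y"
  by (simp add: eval2_def)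

lemma eval2_mult: "eval2 (P * Q) x y = eval2 P x y * eval2 Q x y"
  by (simp add: eval2_def)

lemma smooth_on_poly:
  assumes "open S" "smooth_on S f" shows "smooth_on S (\<lambda>x. poly p (f x :: real))"
proof (induction p)
  case 0
  show ?case using smooth_on_const[OF assms(1)] by simp
next
  case (pCons a p)
  then show ?case using assms by (auto intro!: smooth_intros)
qed

lemma smooth_on_eval2: "smooth_on UNIV (\<lambda>z. eval2 P (fst z) (snd z))"
proof (induction P)
  case 0
  show ?case by (simp add: eval2_def smooth_on_const)
next
  case (pCons p P)
  then show ?case by (auto simp: eval2_pCons intro!: smooth_intros smooth_on_poly)
qed

locale irreducible_conic =
  fixes a11 a12 a22 a1 a2 c :: real
  assumes det_nz: "a11 * a22 * c + 2 * a12 * a2 * a1 - a11 * a2\<^sup>2 - a12\<^sup>2 * c - a22 * a1\<^sup>2 \<noteq> 0"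
begin

text \<open>
  The conic is \<open>F = 0\<close> and its inversion is \<open>G = 0\<close>; \<open>b\<close> is the polar form of \<open>q\<close>, and \<open>l\<close> is
  half of the linear part of \<open>F\<close>.
\<close>

definition q :: "real \<times> real \<Rightarrow> real" where
  "q z = a11 * (fst z)\<^sup>2 + 2 * a12 * fst z * snd z + a22 * (snd z)\<^sup>2"

definition b :: "real \<times> real \<Rightarrow> real \<times> real \<Rightarrow> real" where
  "b z w = a11 * fst z * fst w + a12 * (fst z * snd w + snd z * fst w) + a22 * snd z * snd w"

definition l :: "real \<times> real \<Rightarrow> real" where
  "l z = a1 * fst z + a2 * snd z"

definition F :: "real \<times> real \<Rightarrow> real" where
  "F z = q z + 2 * l z + c"

definition G :: "real \<times> real \<Rightarrow> real" where
  "G z = c * (z \<bullet> z)\<^sup>2 + 2 * l z * (z \<bullet> z) + q z"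

abbreviation "C \<equiv> quadratic_curve a11 a12 a22 a1 a2 c"
abbreviation "IC \<equiv> inversion_curve a11 a12 a22 a1 a2 c"
abbreviation "IP \<equiv> inversion_poly a11 a12 a22 a1 a2 c"

lemma mem_C: "z \<in> C \<longleftrightarrow> F z = 0"
  by (cases z) (simp add: quadratic_curve_def F_def q_def l_def algebra_simps)

lemma eval2_IP: "eval2 IP (fst z) (snd z) = G z"
  by (cases z) (simp add: eval2_inversion_poly G_def q_def l_def power2_eq_square algebra_simps)

lemma mem_IC: "z \<in> IC \<longleftrightarrow> G z = 0"
  using eval2_IP[of z] by (cases z) (simp add: inversion_curve_def zero_locus_def)

lemma IC_eq: "IC = {z. G z = 0}"
  using mem_IC by auto

lemma smooth_on_G: "smooth_on UNIV G"
  using smooth_on_eval2[of IP] by (simp add: eval2_IP)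

lemma G_0: "G 0 = 0"
  by (simp add: G_def q_def)

lemma q_scaleR: "q (t *\<^sub>R z) = t\<^sup>2 * q z"
  by (simp add: q_def power_mult_distrib algebra_simps power2_eq_square)

lemma G_scaleR: "G (t *\<^sub>R z) = t\<^sup>2 * (c * t\<^sup>2 * (z \<bullet> z)\<^sup>2 + 2 * t * l z * (z \<bullet> z) + q z)"
  by (simp add: G_def q_scaleR l_def power2_eq_square algebra_simps)

lemma q_nonzero: "\<exists>v. q v \<noteq> 0"
proof (rule ccontr)
  assume "\<not> ?thesis"
  then have "q (1, 0) = 0" "q (0, 1) = 0" "q (1, 1) = 0" by auto
  then have "a11 = 0 \<and> a22 = 0 \<and> a12 = 0" unfolding q_def by simp
  then show False using det_nz by simp
qed

lemma frechet_derivative_G: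
  "frechet_derivative G (at z) v = 4 * c * (z \<bullet> z) * (z \<bullet> v) + 2 * l v * (z \<bullet> z) + 4 * l z * (z \<bullet> v) + 2 * b z v"
proof -
  have "(G has_derivative (\<lambda>v. 4 * c * (z \<bullet> z) * (z \<bullet> v) + 2 * l v * (z \<bullet> z) + 4 * l z * (z \<bullet> v) + 2 * b z v)) (at z)"
    unfolding G_def[abs_def] l_def q_def b_def
    by (rule derivative_eq_intros refl | simp)+
       (simp add: fun_eq_iff inner_commute power2_eq_square algebra_simps)
  from fun_cong[OF frechet_derivative_at[OF this], of v] show ?thesis by simp
qed

text \<open>
  With \<open>s = \<parallel>z\<parallel>\<^sup>2\<close> and \<open>(E\<^sub>1, E\<^sub>2, E\<^sub>3)\<close> the symmetric coefficient matrix of the conic applied to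
  \<open>(x, y, s)\<close>, one has \<open>G = x E\<^sub>1 + y E\<^sub>2 + s E\<^sub>3\<close> and \<open>\<nabla>G = 2 (E\<^sub>1, E\<^sub>2) + 4 E\<^sub>3 z\<close>.
  At a singular zero \<open>z \<noteq> 0\<close> these relations force \<open>E\<^sub>1 = E\<^sub>2 = E\<^sub>3 = 0\<close>, so that the matrix
  would be singular.
\<close>

lemma G_regular_zero:
  assumes "G z = 0" "z \<noteq> 0"
  shows "\<exists>v. frechet_derivative G (at z) v \<noteq> 0"
proof (rule ccontr)
  assume "\<not> ?thesis"
  then have v: "frechet_derivative G (at z) (1, 0) = 0" "frechet_derivative G (at z) (0, 1) = 0"
    by auto
  obtain x y where z: "z = (x, y)" by (cases z)
  define s where "s = x * x + y * y"
  have s: "s > 0" using assms(2) by (simp add: s_def z zero_prod_def sum_squares_gt_zero_iff)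
  define E1 E2 E3 where "E1 = a11 * x + a12 * y + a1 * s" and "E2 = a12 * x + a22 * y + a2 * s"
    and "E3 = a1 * x + a2 * y + c * s"
  have "2 * E1 + 4 * x * E3 = 0" "2 * E2 + 4 * y * E3 = 0"
    using v by (simp_all add: frechet_derivative_G z b_def l_def E1_def E2_def E3_def s_def algebra_simps)
  then have E12: "E1 = - 2 * x * E3" "E2 = - 2 * y * E3" by simp_all
  have "x * E1 + y * E2 + s * E3 = 0"
    using assms(1) by (simp add: G_def q_def l_def z E1_def E2_def E3_def s_def power2_eq_square algebra_simps)
  then have "s * E3 = 0" unfolding E12 s_def by algebra
  then have E: "E3 = 0" "E1 = 0" "E2 = 0" using s E12 by simp_all
  let ?D = "a11 * a22 * c + 2 * a12 * a2 * a1 - a11 * a2\<^sup>2 - a12\<^sup>2 * c - a22 * a1\<^sup>2"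
  \<comment> \<open>Cramer's rule: the last row of the adjugate matrix, applied to \<open>(E\<^sub>1, E\<^sub>2, E\<^sub>3)\<close>.\<close>
  have "s * ?D = (a12 * a2 - a22 * a1) * E1 + (a12 * a1 - a11 * a2) * E2 + (a11 * a22 - a12\<^sup>2) * E3"
    unfolding E1_def E2_def E3_def by algebra
  then show False using E s det_nz by simp
qed

lemma regular_arcs_near_IC:
  assumes "z \<in> IC" "z \<noteq> 0"
  shows "regular_arcs_near IC z"
proof -
  obtain v where "frechet_derivative G (at z) v \<noteq> 0" using G_regular_zero assms mem_IC by blast
  from regular_arcs_near_regular_zero[OF smooth_on_G _ this] show ?thesis
    using assms mem_IC unfolding IC_eq by auto
qed

lemma regular_minus_origin: "regular_as_parametrized_curve (IC - {(0, 0)})"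
  unfolding regular_as_parametrized_curve_def
proof (rule locally_finite_union_ofI)
  fix z assume "z \<in> IC - {(0, 0)}"
  then have z: "z \<in> IC" "z \<noteq> 0" by (simp_all add: zero_prod_def)
  show "regular_arcs_near (IC - {(0, 0)}) z"
  proof (rule arcs_near_cong[OF _ _ _ regular_arcs_near_IC[OF z]])
    show "open (- {0 :: real \<times> real})" by auto
    show "- {0} \<inter> IC = - {0} \<inter> (IC - {(0, 0)})" by (auto simp: zero_prod_def)
  qed (use z in auto)
qed

text \<open>
  Let \<open>G = Q R\<close> and \<open>Q(z) = 0\<close>.  If \<open>R(z) \<noteq> 0\<close>, then \<open>Q\<close> and \<open>G\<close> have the same zeros
  near \<open>z\<close>.  Otherwise \<open>z\<close> is a singular zero of \<open>G\<close>, hence the origin; as the lowest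
  order form \<open>q\<close> of \<open>G\<close> has degree 2, both factors vanish there to first order only, and
  \<open>Q\<close> is regular.
\<close>

lemma front_arcs_near_component:
  assumes QR: "IP = Q * R" and z: "z \<in> zero_locus Q" and a: "arcs_near front IC z"
  shows "arcs_near front (zero_locus Q) z"
proof -
  define f g where "f w = eval2 Q (fst w) (snd w)" and "g w = eval2 R (fst w) (snd w)" for w
  have G: "G w = f w * g w" for w
    unfolding f_def g_def eval2_mult[symmetric] QR[symmetric] by (rule eval2_IP[symmetric])
  have sf: "smooth_on UNIV f" and sg: "smooth_on UNIV g"
    unfolding f_def g_def by (rule smooth_on_eval2)+
  have Q: "zero_locus Q = {w. f w = 0}" by (auto simp: zero_locus_def f_def)
  have fz: "f z = 0" using z Q by simp
  have df: "(f has_derivative frechet_derivative f (at w)) (at w)"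
    and dg: "(g has_derivative frechet_derivative g (at w)) (at w)" for w
    using smooth_on_imp_has_derivative[OF sf] smooth_on_imp_has_derivative[OF sg] by simp_all
  show ?thesis
  proof (cases "g z = 0")
    case False
    show ?thesis
    proof (rule arcs_near_cong[OF _ _ _ a])
      show "open {w. g w \<noteq> 0}"
        using smooth_on_imp_continuous_on[OF sg] by (intro open_Collect_neq continuous_intros)
    qed (use False G Q IC_eq in auto)
  next
    case True
    have "(G has_derivative (\<lambda>v. f z * frechet_derivative g (at z) v + frechet_derivative f (at z) v * g z)) (at z)"
      unfolding G[abs_def] by (rule has_derivative_mult[OF df dg])
    then have "frechet_derivative G (at z) = (\<lambda>v. 0)"
      using fz True by (simp add: frechet_derivative_at[symmetric])
    then have z0: "z = 0" using G_regular_zero[of z] G[of z] fz by auto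
    obtain v where v: "q v \<noteq> 0" using q_nonzero by blast
    have lim: "((\<lambda>t. h (t *\<^sub>R v) / t) \<longlongrightarrow> D v) (at 0)"
      if h: "(h has_derivative D) (at 0)" "h 0 = 0" for h :: "real \<times> real \<Rightarrow> real" and D
    proof -
      interpret D: bounded_linear D by (rule has_derivative_bounded_linear[OF h(1)])
      have "((\<lambda>t. h (t *\<^sub>R v)) has_derivative (\<lambda>s. D (s *\<^sub>R v))) (at 0)"
        by (rule has_derivative_compose[where f = "\<lambda>t. t *\<^sub>R v" and g = h])
           (auto intro!: derivative_eq_intros h)
      then have "((\<lambda>t. h (t *\<^sub>R v)) has_real_derivative D v) (at 0)"
        unfolding has_field_derivative_def by (rule has_derivative_eq_rhs) (simp add: D.scaleR fun_eq_iff)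
      then show ?thesis unfolding has_field_derivative_iff by (simp add: h(2))
    qed
    have "((\<lambda>t. (f (t *\<^sub>R v) / t) * (g (t *\<^sub>R v) / t)) \<longlongrightarrow> frechet_derivative f (at 0) v * frechet_derivative g (at 0) v) (at 0)"
      using df[of 0] dg[of 0] fz True z0 by (intro tendsto_mult lim) auto
    moreover have "((\<lambda>t. (f (t *\<^sub>R v) / t) * (g (t *\<^sub>R v) / t)) \<longlongrightarrow> q v) (at 0)"
    proof (rule Lim_transform_eventually)
      show "((\<lambda>t. c * t\<^sup>2 * (v \<bullet> v)\<^sup>2 + 2 * t * l v * (v \<bullet> v) + q v) \<longlongrightarrow> q v) (at 0)"
        by (auto intro!: tendsto_eq_intros)
      show "\<forall>\<^sub>F t in at 0. c * t\<^sup>2 * (v \<bullet> v)\<^sup>2 + 2 * t * l v * (v \<bullet> v) + q v = (f (t *\<^sub>R v) / t) * (g (t *\<^sub>R v) / t)"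
        unfolding eventually_at_filter
        using G_scaleR[of _ v] by (simp add: G power2_eq_square)
    qed
    ultimately have "frechet_derivative f (at 0) v * frechet_derivative g (at 0) v = q v"
      by (rule tendsto_unique[rotated]) simp
    then have "frechet_derivative f (at z) v \<noteq> 0" using v z0 by auto
    from regular_arcs_near_regular_zero[OF sf fz this] show ?thesis
      unfolding Q by (rule arcs_near_mono) auto
  qed
qed

lemma IP_coeffs:
  "IP = [:[:0, 0, a11, 2 * a1, c:], [:0, 2 * a12, 2 * a2:], [:a22, 2 * a1, 2 * c:], [:2 * a2:], [:c:]:]"
  by (simp add: inversion_poly_def power2_eq_square algebra_simps)

lemma total_degree_IP: "total_degree IP \<in> {3, 4}"
proof -
  let ?P = "\<lambda>n. \<forall>i j. coeff (coeff IP j) i \<noteq> 0 \<longrightarrow> i + j \<le> n"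
  have 4: "?P 4"
    unfolding IP_coeffs by (auto simp: coeff_pCons split: nat.splits)
  show ?thesis
  proof (cases "c = 0")
    case False
    have "coeff (coeff IP 4) 0 = c" unfolding IP_coeffs by (simp add: coeff_pCons split: nat.splits)
    then have "4 \<le> n" if "?P n" for n using that False by (metis add_0)
    with 4 have "total_degree IP = 4" unfolding total_degree_def by (intro Least_equality)
    then show ?thesis by simp
  next
    case True
    have c: "coeff (coeff IP 0) 3 = 2 * a1" "coeff (coeff IP 3) 0 = 2 * a2"
      unfolding IP_coeffs by (simp_all add: coeff_pCons numeral_3_eq_3 split: nat.splits)
    have "a1 \<noteq> 0 \<or> a2 \<noteq> 0" using det_nz True by auto
    with c have "3 \<le> n" if "?P n" for n
      using that by (metis add_0 add_0_right mult_eq_0_iff zero_neq_numeral)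
    moreover have "?P 3"
      unfolding IP_coeffs using True by (auto simp: coeff_pCons split: nat.splits)
    ultimately have "total_degree IP = 3"
      unfolding total_degree_def by (intro Least_equality)
    then show ?thesis by simp
  qed
qed

end


section \<open>The origin when the conic has two asymptotic directions\<close>

definition cross :: "real \<times> real \<Rightarrow> real \<times> real \<Rightarrow> real" where
  "cross z w = fst z * snd w - snd z * fst w"

lemma cross_coordinates:
  assumes "cross d e \<noteq> 0"
  shows "z = (cross z e / cross d e) *\<^sub>R d + (cross d z / cross d e) *\<^sub>R e"
proof -
  have "cross d e *\<^sub>R z = cross z e *\<^sub>R d + cross d z *\<^sub>R e"
    by (simp add: prod_eq_iff cross_def algebra_simps)
  then have "z = inverse (cross d e) *\<^sub>R (cross z e *\<^sub>R d + cross d z *\<^sub>R e)"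
    using assms by (metis scaleR_left_imp_eq scaleR_scaleR right_inverse scaleR_one)
  then show ?thesis by (simp add: scaleR_add_right divide_inverse mult.commute)
qed

lemma cross_linear:
  "cross (x *\<^sub>R d + y *\<^sub>R e) e = x * cross d e" "cross d (x *\<^sub>R d + y *\<^sub>R e) = y * cross d e"
  by (simp_all add: cross_def algebra_simps)

lemma cross_swap: "cross e d = - cross d e"
  by (simp add: cross_def)

lemma continuous_on_cross: "continuous_on S (\<lambda>z. cross z e)" "continuous_on S (\<lambda>z. cross d z)"
  unfolding cross_def by (intro continuous_intros)+

text \<open>Graphs in skew coordinates are embedded regular arcs; the inverse is the first coordinate.\<close>

lemma skew_graph:
  fixes d e :: "real \<times> real"
  assumes de: "cross d e \<noteq> 0" and I: "open I" and h: "smooth_on I h"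
  defines "\<gamma> \<equiv> \<lambda>x. x *\<^sub>R d + h x *\<^sub>R e"
  shows "regular_curve \<gamma> I" "\<exists>g. homeomorphism I (\<gamma> ` I) \<gamma> g"
    and "\<And>x. x \<in> I \<Longrightarrow> vector_derivative \<gamma> (at x) = d + vector_derivative h (at x) *\<^sub>R e"
proof -
  have s: "smooth_on I \<gamma>" unfolding \<gamma>_def by (intro smooth_intros I h)
  show vd: "vector_derivative \<gamma> (at x) = d + vector_derivative h (at x) *\<^sub>R e" if "x \<in> I" for x
  proof (rule vector_derivative_at)
    have "(h has_vector_derivative vector_derivative h (at x)) (at x)"
      by (rule smooth_on_imp_has_vector_derivative[OF h that])
    then show "(\<gamma> has_vector_derivative d + vector_derivative h (at x) *\<^sub>R e) (at x)"
      unfolding \<gamma>_def has_vector_derivative_def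
      by (auto intro!: derivative_eq_intros simp: scaleR_add_right)
  qed
  have "d + k *\<^sub>R e \<noteq> 0" for k
  proof
    assume "d + k *\<^sub>R e = 0"
    then have "cross (d + k *\<^sub>R e) e = 0" by (simp add: cross_def)
    then show False using cross_linear(1)[of 1 d k e] de by simp
  qed
  then show "regular_curve \<gamma> I" unfolding regular_curve_def using s vd by auto
  have "cross (\<gamma> x) e / cross d e = x" for x using de by (simp add: \<gamma>_def cross_linear)
  then have "homeomorphism I (\<gamma> ` I) \<gamma> (\<lambda>z. cross z e / cross d e)"
    using smooth_on_imp_continuous_on[OF s] de
    by (intro homeomorphismI continuous_intros continuous_on_cross) auto
  then show "\<exists>g. homeomorphism I (\<gamma> ` I) \<gamma> g" by blast
qed

context irreducible_conic
begin

lemma q_add: "q (z + w) = q z + 2 * b z w + q w"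
  by (simp add: q_def b_def power2_eq_square algebra_simps)

lemma b_scaleR: "b z (t *\<^sub>R w) = t * b z w" "b (t *\<^sub>R z) w = t * b z w"
  by (simp_all add: b_def algebra_simps)

lemma b_swap: "b z w = b w z"
  by (simp add: b_def algebra_simps)

lemma q_combination: "q (x *\<^sub>R d + y *\<^sub>R e) = x\<^sup>2 * q d + 2 * x * y * b d e + y\<^sup>2 * q e"
  by (simp add: q_add q_scaleR b_scaleR)

lemma b_nonzero:
  assumes "cross d e \<noteq> 0" "q d = 0" "q e = 0"
  shows "b d e \<noteq> 0"
proof
  assume b: "b d e = 0"
  obtain v where "q v \<noteq> 0" using q_nonzero by blast
  moreover have "q v = 0"
    using assms b by (subst cross_coordinates[OF assms(1), of v]) (simp only: q_combination)
  ultimately show False by simp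
qed

text \<open>
  Blowing up the origin, \<open>G (x (d + m e)) = x\<^sup>2 H(x, m)\<close> with \<open>H(0, m) = q (d + m e)\<close>, which has
  a simple zero at \<open>m = 0\<close>.  Hence the slope \<open>m\<close> of the zeros is a smooth function of \<open>x\<close>.
  Slopes below \<open>1 / 2\<close> keep the two branches at a node in disjoint cones.
\<close>

lemma branch_at_origin:
  assumes d: "q d = 0" and de: "b d e \<noteq> 0"
  obtains \<epsilon> \<delta> f where "0 < \<epsilon>" "0 < \<delta>" "\<delta> \<le> 1 / 2" "smooth_on {- \<epsilon> <..< \<epsilon>} f" "f 0 = 0"
    "\<And>x. \<bar>x\<bar> < \<epsilon> \<Longrightarrow> \<bar>f x\<bar> < \<delta>"
    "\<And>x m. \<bar>x\<bar> < \<epsilon> \<Longrightarrow> \<bar>m\<bar> < \<delta> \<Longrightarrow> x \<noteq> 0 \<Longrightarrow> G (x *\<^sub>R d + (x * m) *\<^sub>R e) = 0 \<longleftrightarrow> m = f x"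
proof -
  define w where "w m = d + m *\<^sub>R e" for m
  define H where "H p = c * (fst p)\<^sup>2 * (w (snd p) \<bullet> w (snd p))\<^sup>2
    + 2 * fst p * l (w (snd p)) * (w (snd p) \<bullet> w (snd p)) + q (w (snd p))" for p
  have G: "G (x *\<^sub>R d + (x * m) *\<^sub>R e) = x\<^sup>2 * H (x, m)" for x m
    using G_scaleR[of x "w m"] by (simp add: H_def w_def scaleR_add_right)
  have H: "smooth_on UNIV H"
    unfolding H_def w_def l_def q_def by (intro smooth_intros open_UNIV)
  have "(H has_derivative frechet_derivative H (at (0, 0))) (at (0, 0))"
    by (rule smooth_on_imp_has_derivative[OF H]) simp
  then have "((\<lambda>m. H (0, m)) has_derivative (\<lambda>m. frechet_derivative H (at (0, 0)) (0, m))) (at 0)"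
    by (rule has_derivative_compose[OF has_derivative_Pair[OF has_derivative_const has_derivative_ident]])
  moreover have "((\<lambda>m. H (0, m)) has_derivative (\<lambda>m. 2 * m * b d e)) (at 0)"
  proof -
    have "(\<lambda>m. H (0, m)) = (\<lambda>m. 2 * m * b d e + m\<^sup>2 * q e)"
      using q_combination[of 1 d _ e] d by (simp add: H_def w_def fun_eq_iff)
    then show ?thesis by (auto intro!: derivative_eq_intros)
  qed
  ultimately have "(\<lambda>m. frechet_derivative H (at (0, 0)) (0, m)) = (\<lambda>m. 2 * m * b d e)"
    by (rule has_derivative_unique)
  then have nd: "frechet_derivative H (at (0, 0)) (0, 1) \<noteq> 0"
    using de by (metis mult_eq_0_iff mult.right_neutral zero_neq_numeral)
  have H0: "H (0, 0) = 0" using d by (simp add: H_def w_def)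
  obtain \<epsilon> \<delta> f where "0 < \<epsilon>" "\<epsilon> \<le> 1 / 2" "0 < \<delta>" "\<delta> \<le> 1 / 2" "smooth_on {- \<epsilon> <..< \<epsilon>} f" "f 0 = 0"
    "\<And>x. \<bar>x\<bar> < \<epsilon> \<Longrightarrow> \<bar>f x\<bar> < \<delta>"
    "\<And>x y. \<bar>x\<bar> < \<epsilon> \<Longrightarrow> \<bar>y\<bar> < \<delta> \<Longrightarrow> H (x, y) = 0 \<longleftrightarrow> y = f x"
    by (rule implicit_function[OF H H0 nd, of "1 / 2"]) auto
  then show ?thesis using that[of \<epsilon> \<delta> f] by (auto simp: G)
qed

lemma abs_l_le: "\<bar>l z\<bar> \<le> norm (a1, a2) * norm z"
  using Cauchy_Schwarz_ineq2[of "(a1, a2)" z] by (simp add: l_def inner_prod_def)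

text \<open>
  Zeros near the origin lie close to one of the two null lines of \<open>q\<close>, because \<open>G - q\<close> has
  order 3.
\<close>

lemma zeros_in_thin_cone:
  assumes de: "b d e \<noteq> 0" and qd: "q d = 0" and qe: "q e = 0" and \<delta>: "\<delta> > 0"
  obtains \<eta> where "\<eta> > 0"
    "\<And>x m. \<bar>x\<bar> < \<eta> \<Longrightarrow> \<bar>m\<bar> \<le> 1 \<Longrightarrow> x \<noteq> 0 \<Longrightarrow> G (x *\<^sub>R d + (x * m) *\<^sub>R e) = 0 \<Longrightarrow> \<bar>m\<bar> < \<delta>"
proof -
  define N where "N = norm d + norm e"
  \<comment> \<open>\<open>N\<close> bounds the vectors \<open>d + m e\<close> with \<open>\<bar>m\<bar> \<le> 1\<close>, and \<open>K\<close> bounds \<open>\<bar>(G - q) (x (d + m e))\<bar> / \<bar>x\<bar>\<^sup>3\<close>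
    for \<open>\<bar>x\<bar> \<le> 1\<close>.\<close>
  define K where "K = \<bar>c\<bar> * N ^ 4 + 2 * norm (a1, a2) * N ^ 3 + 1"
  have N: "N \<ge> 0" by (simp add: N_def)
  then have K: "K > 0" by (simp add: K_def add_nonneg_pos)
  define \<eta> where "\<eta> = min 1 (2 * \<bar>b d e\<bar> * \<delta> / K)"
  show ?thesis
  proof (rule that[of \<eta>])
    show "\<eta> > 0" using de \<delta> K by (simp add: \<eta>_def)
    fix x m :: real
    assume x: "\<bar>x\<bar> < \<eta>" "x \<noteq> 0" and m: "\<bar>m\<bar> \<le> 1" and 0: "G (x *\<^sub>R d + (x * m) *\<^sub>R e) = 0"
    define w where "w = d + m *\<^sub>R e"
    have "norm w \<le> norm d + \<bar>m\<bar> * norm e"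
      unfolding w_def by (metis norm_triangle_ineq norm_scaleR)
    also have "\<dots> \<le> N" using m mult_right_mono[of "\<bar>m\<bar>" 1 "norm e"] by (simp add: N_def)
    finally have w: "norm w \<le> N" .
    have "x\<^sup>2 * (c * x\<^sup>2 * (w \<bullet> w)\<^sup>2 + 2 * x * l w * (w \<bullet> w) + q w) = 0"
      using 0 G_scaleR[of x w] by (simp add: w_def scaleR_add_right)
    then have "c * x\<^sup>2 * (w \<bullet> w)\<^sup>2 + 2 * x * l w * (w \<bullet> w) + q w = 0"
      using x(2) by simp
    then have "q w = - x * (c * x * norm w ^ 4 + 2 * l w * norm w ^ 2)"
      by (simp add: dot_square_norm power2_eq_square power4_eq_xxxx algebra_simps)
    moreover have "q w = 2 * m * b d e"
      using q_combination[of 1 d m e] qd qe by (simp add: w_def)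
    ultimately have "\<bar>2 * m * b d e\<bar> = \<bar>x\<bar> * \<bar>c * x * norm w ^ 4 + 2 * l w * norm w ^ 2\<bar>"
      by (metis abs_minus_cancel abs_mult)
    also have "\<dots> \<le> \<bar>x\<bar> * K"
    proof (rule mult_left_mono)
      have "\<bar>c * x * norm w ^ 4\<bar> \<le> \<bar>c\<bar> * 1 * N ^ 4"
        unfolding abs_mult using x(1) w N
        by (intro mult_mono) (auto simp: \<eta>_def power_mono)
      moreover have "\<bar>2 * l w * norm w ^ 2\<bar> \<le> 2 * (norm (a1, a2) * N) * N ^ 2"
        unfolding abs_mult using w N order_trans[OF abs_l_le[of w] mult_left_mono[OF w]]
        by (intro mult_mono) (auto simp: power_mono)
      ultimately show "\<bar>c * x * norm w ^ 4 + 2 * l w * norm w ^ 2\<bar> \<le> K"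
        using abs_triangle_ineq[of "c * x * norm w ^ 4" "2 * l w * norm w ^ 2"]
        by (simp add: K_def power2_eq_square power3_eq_cube)
    qed simp
    also have "\<dots> < 2 * \<bar>b d e\<bar> * \<delta>"
      using x(1) K by (simp add: \<eta>_def pos_less_divide_eq)
    finally show "\<bar>m\<bar> < \<delta>" using de by (simp add: abs_mult)
  qed
qed

lemma node_arcs:
  assumes cr: "cross d e \<noteq> 0" and qd: "q d = 0" and qe: "q e = 0" and W: "open W" "0 \<in> W"
  obtains U \<gamma>1 \<gamma>2 \<epsilon> where "U \<subseteq> W" "open U" "0 \<in> U" "\<epsilon> > 0"
    "regular_curve \<gamma>1 {- \<epsilon> <..< \<epsilon>}" "\<exists>g. homeomorphism {- \<epsilon> <..< \<epsilon>} (\<gamma>1 ` {- \<epsilon> <..< \<epsilon>}) \<gamma>1 g"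
    "regular_curve \<gamma>2 {- \<epsilon> <..< \<epsilon>}" "\<exists>g. homeomorphism {- \<epsilon> <..< \<epsilon>} (\<gamma>2 ` {- \<epsilon> <..< \<epsilon>}) \<gamma>2 g"
    "\<gamma>1 0 = 0" "\<gamma>2 0 = 0"
    "\<gamma>1 ` {- \<epsilon> <..< \<epsilon>} \<union> \<gamma>2 ` {- \<epsilon> <..< \<epsilon>} = U \<inter> IC"
    "\<gamma>1 ` {- \<epsilon> <..< \<epsilon>} \<inter> \<gamma>2 ` {- \<epsilon> <..< \<epsilon>} = {0}"
    "vector_derivative \<gamma>1 (at 0) = d" "vector_derivative \<gamma>2 (at 0) = e"
proof -
  have de: "b d e \<noteq> 0" and ed: "b e d \<noteq> 0" using b_nonzero[OF cr qd qe] b_swap by auto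
  have rc: "cross e d \<noteq> 0" using cr cross_swap[of e d] by simp
  obtain \<epsilon>1 \<delta>1 f1 where 1: "0 < \<epsilon>1" "0 < \<delta>1" "\<delta>1 \<le> 1 / 2" "smooth_on {- \<epsilon>1 <..< \<epsilon>1} f1" "f1 0 = 0"
    "\<And>x. \<bar>x\<bar> < \<epsilon>1 \<Longrightarrow> \<bar>f1 x\<bar> < \<delta>1"
    "\<And>x m. \<bar>x\<bar> < \<epsilon>1 \<Longrightarrow> \<bar>m\<bar> < \<delta>1 \<Longrightarrow> x \<noteq> 0 \<Longrightarrow> G (x *\<^sub>R d + (x * m) *\<^sub>R e) = 0 \<longleftrightarrow> m = f1 x"
    by (rule branch_at_origin[OF qd de]) (rule that; blast)
  obtain \<epsilon>2 \<delta>2 f2 where 2: "0 < \<epsilon>2" "0 < \<delta>2" "\<delta>2 \<le> 1 / 2" "smooth_on {- \<epsilon>2 <..< \<epsilon>2} f2" "f2 0 = 0"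
    "\<And>x. \<bar>x\<bar> < \<epsilon>2 \<Longrightarrow> \<bar>f2 x\<bar> < \<delta>2"
    "\<And>x m. \<bar>x\<bar> < \<epsilon>2 \<Longrightarrow> \<bar>m\<bar> < \<delta>2 \<Longrightarrow> x \<noteq> 0 \<Longrightarrow> G (x *\<^sub>R e + (x * m) *\<^sub>R d) = 0 \<longleftrightarrow> m = f2 x"
    by (rule branch_at_origin[OF qe ed]) (rule that; blast)
  obtain \<eta>1 where \<eta>1: "\<eta>1 > 0"
    "\<And>x m. \<bar>x\<bar> < \<eta>1 \<Longrightarrow> \<bar>m\<bar> \<le> 1 \<Longrightarrow> x \<noteq> 0 \<Longrightarrow> G (x *\<^sub>R d + (x * m) *\<^sub>R e) = 0 \<Longrightarrow> \<bar>m\<bar> < \<delta>1"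
    by (rule zeros_in_thin_cone[OF de qd qe 1(2)]) (rule that; blast)
  obtain \<eta>2 where \<eta>2: "\<eta>2 > 0"
    "\<And>x m. \<bar>x\<bar> < \<eta>2 \<Longrightarrow> \<bar>m\<bar> \<le> 1 \<Longrightarrow> x \<noteq> 0 \<Longrightarrow> G (x *\<^sub>R e + (x * m) *\<^sub>R d) = 0 \<Longrightarrow> \<bar>m\<bar> < \<delta>2"
    by (rule zeros_in_thin_cone[OF ed qe qd 2(2)]) (rule that; blast)
  obtain r where r: "r > 0" "ball 0 r \<subseteq> W" using W openE by blast
  define N where "N = norm d + norm e"
  have "d \<noteq> 0" using cr by (auto simp: cross_def)
  then have N: "N > 0" by (simp add: N_def add_pos_nonneg)
  define \<epsilon> where "\<epsilon> = Min {\<epsilon>1, \<epsilon>2, \<eta>1, \<eta>2, r / N}"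
  have \<epsilon>: "0 < \<epsilon>" "\<epsilon> \<le> \<epsilon>1" "\<epsilon> \<le> \<epsilon>2" "\<epsilon> \<le> \<eta>1" "\<epsilon> \<le> \<eta>2" "\<epsilon> \<le> r / N"
    using 1(1) 2(1) \<eta>1(1) \<eta>2(1) r(1) N by (auto simp: \<epsilon>_def)
  let ?I = "{- \<epsilon> <..< \<epsilon>}"
  have I: "x \<in> ?I \<longleftrightarrow> \<bar>x\<bar> < \<epsilon>" for x by auto
  define X Y where "X z = cross z e / cross d e" and "Y z = cross d z / cross d e" for z
  have XY: "X (x *\<^sub>R d + y *\<^sub>R e) = x" "Y (x *\<^sub>R d + y *\<^sub>R e) = y" for x y
    using cr by (simp_all add: X_def Y_def cross_linear)
  have rep: "z = X z *\<^sub>R d + Y z *\<^sub>R e" for z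
    unfolding X_def Y_def by (rule cross_coordinates[OF cr])
  define U where "U = {z. \<bar>X z\<bar> < \<epsilon> \<and> \<bar>Y z\<bar> < \<epsilon>}"
  define h1 h2 where "h1 x = x * f1 x" and "h2 x = x * f2 x" for x
  define \<gamma>1 \<gamma>2 where "\<gamma>1 x = x *\<^sub>R d + h1 x *\<^sub>R e" and "\<gamma>2 x = x *\<^sub>R e + h2 x *\<^sub>R d" for x
  have sf: "smooth_on ?I f1" "smooth_on ?I f2"
    by (rule smooth_on_subset[OF 1(4)] smooth_on_subset[OF 2(4)]; use \<epsilon> in auto)+
  have sh: "smooth_on ?I h1" "smooth_on ?I h2"
    unfolding h1_def h2_def by (intro smooth_intros sf open_greaterThanLessThan)+
  have h'0: "vector_derivative (\<lambda>x. x * f x) (at 0) = (0::real)" if "smooth_on ?I f" "f 0 = 0" for f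
  proof (rule vector_derivative_at)
    have "(f has_vector_derivative vector_derivative f (at 0)) (at 0)"
      by (rule smooth_on_imp_has_vector_derivative[OF that(1)]) (use \<epsilon> in auto)
    then show "((\<lambda>x. x * f x) has_vector_derivative 0) (at 0)"
      using that(2) unfolding has_vector_derivative_def by (auto intro!: derivative_eq_intros)
  qed
  have small: "\<bar>h1 x\<bar> \<le> \<bar>x\<bar> / 2" "\<bar>h2 x\<bar> \<le> \<bar>x\<bar> / 2" if "\<bar>x\<bar> < \<epsilon>" for x
  proof -
    have "\<bar>f1 x\<bar> \<le> 1 / 2" "\<bar>f2 x\<bar> \<le> 1 / 2"
      using 1(3) 1(6)[of x] 2(3) 2(6)[of x] that \<epsilon> by linarith+
    then show "\<bar>h1 x\<bar> \<le> \<bar>x\<bar> / 2" "\<bar>h2 x\<bar> \<le> \<bar>x\<bar> / 2"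
      using mult_left_mono[of _ "1 / 2" "\<bar>x\<bar>"] by (fastforce simp: h1_def h2_def abs_mult)+
  qed
  have G0: "G (\<gamma>1 x) = 0" "G (\<gamma>2 x) = 0" if "\<bar>x\<bar> < \<epsilon>" for x
    using 1(7)[of x "f1 x"] 1(6)[of x] 2(7)[of x "f2 x"] 2(6)[of x] that \<epsilon> G_0
    by (cases "x = 0"; simp add: \<gamma>1_def \<gamma>2_def h1_def h2_def)+
  have U1: "\<gamma>1 x \<in> U" "\<gamma>2 x \<in> U" if "\<bar>x\<bar> < \<epsilon>" for x
    using small[OF that] that XY[of x "h1 x"] XY[of "h2 x" x]
    by (simp_all add: U_def \<gamma>1_def \<gamma>2_def add.commute)
  show ?thesis
  proof (rule that[of U \<epsilon> \<gamma>1 \<gamma>2])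
    show "U \<subseteq> W"
    proof
      fix z assume z: "z \<in> U"
      have "norm z \<le> \<bar>X z\<bar> * norm d + \<bar>Y z\<bar> * norm e"
        using norm_triangle_ineq[of "X z *\<^sub>R d" "Y z *\<^sub>R e"] rep[of z] by simp
      also have "\<dots> \<le> max \<bar>X z\<bar> \<bar>Y z\<bar> * norm d + max \<bar>X z\<bar> \<bar>Y z\<bar> * norm e"
        by (intro add_mono mult_right_mono) auto
      also have "\<dots> = max \<bar>X z\<bar> \<bar>Y z\<bar> * N" by (simp add: N_def distrib_left)
      also have "\<dots> < \<epsilon> * N" using z N by (intro mult_strict_right_mono) (auto simp: U_def)
      also have "\<dots> \<le> r" using \<epsilon>(6) N by (simp add: pos_le_divide_eq)
      finally show "z \<in> W" using r(2) by auto
    qed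
    show "open U"
      unfolding U_def X_def Y_def using cr
      by (intro open_Collect_conj open_Collect_less continuous_intros continuous_on_cross) auto
    show "0 \<in> U" using \<epsilon> by (simp add: U_def X_def Y_def cross_def)
    show "regular_curve \<gamma>1 ?I" "\<exists>g. homeomorphism ?I (\<gamma>1 ` ?I) \<gamma>1 g"
      unfolding \<gamma>1_def by (rule skew_graph[OF cr _ sh(1)]; simp)+
    show "regular_curve \<gamma>2 ?I" "\<exists>g. homeomorphism ?I (\<gamma>2 ` ?I) \<gamma>2 g"
      unfolding \<gamma>2_def by (rule skew_graph[OF rc _ sh(2)]; simp)+
    show "\<gamma>1 0 = 0" "\<gamma>2 0 = 0" by (simp_all add: \<gamma>1_def \<gamma>2_def h1_def h2_def)
    have "vector_derivative h1 (at 0) = 0" "vector_derivative h2 (at 0) = 0"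
      using h'0[OF sf(1) 1(5)] h'0[OF sf(2) 2(5)] by (simp_all add: h1_def[abs_def] h2_def[abs_def])
    then show "vector_derivative \<gamma>1 (at 0) = d" "vector_derivative \<gamma>2 (at 0) = e"
      using skew_graph(3)[OF cr _ sh(1), of 0] skew_graph(3)[OF rc _ sh(2), of 0] \<epsilon>(1)
      by (simp_all add: \<gamma>1_def[abs_def] \<gamma>2_def[abs_def])
    show "\<gamma>1 ` ?I \<union> \<gamma>2 ` ?I = U \<inter> IC"
    proof (intro equalityI subsetI)
      fix z assume "z \<in> \<gamma>1 ` ?I \<union> \<gamma>2 ` ?I"
      then obtain x where "x \<in> ?I" "z = \<gamma>1 x \<or> z = \<gamma>2 x" by blast
      then show "z \<in> U \<inter> IC" using G0[of x] U1[of x] mem_IC I by auto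
    next
      fix z assume "z \<in> U \<inter> IC"
      then have z: "\<bar>X z\<bar> < \<epsilon>" "\<bar>Y z\<bar> < \<epsilon>" "G z = 0" by (auto simp: U_def mem_IC)
      consider "X z = 0" "Y z = 0" | "X z \<noteq> 0" "\<bar>Y z\<bar> \<le> \<bar>X z\<bar>" | "Y z \<noteq> 0" "\<bar>X z\<bar> \<le> \<bar>Y z\<bar>" by linarith
      then show "z \<in> \<gamma>1 ` ?I \<union> \<gamma>2 ` ?I"
      proof cases
        case 1
        then have "z = \<gamma>1 0" using rep[of z] by (simp add: \<gamma>1_def h1_def)
        then show ?thesis using \<epsilon>(1) by auto
      next
        case 2
        define m where "m = Y z / X z"
        have Y: "Y z = X z * m" using 2 by (simp add: m_def)
        have G: "G (X z *\<^sub>R d + (X z * m) *\<^sub>R e) = 0" using rep[of z] z(3) Y by simp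
        have "\<bar>m\<bar> \<le> 1" using 2 by (simp add: m_def)
        then have "\<bar>m\<bar> < \<delta>1" using \<eta>1(2)[OF _ _ 2(1) G] z \<epsilon> by linarith
        then have "m = f1 (X z)" using 1(7)[OF _ _ 2(1), of m] G z \<epsilon> by auto
        then have "z = \<gamma>1 (X z)" using rep[of z] Y by (simp add: \<gamma>1_def h1_def)
        moreover have "X z \<in> ?I" using z by auto
        ultimately show ?thesis by blast
      next
        case 3
        define m where "m = X z / Y z"
        have X: "X z = Y z * m" using 3 by (simp add: m_def)
        have G: "G (Y z *\<^sub>R e + (Y z * m) *\<^sub>R d) = 0" using rep[of z] z(3) X by (simp add: add.commute)
        have "\<bar>m\<bar> \<le> 1" using 3 by (simp add: m_def)
        then have "\<bar>m\<bar> < \<delta>2" using \<eta>2(2)[OF _ _ 3(1) G] z \<epsilon> by linarith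
        then have "m = f2 (Y z)" using 2(7)[OF _ _ 3(1), of m] G z \<epsilon> by auto
        then have "z = \<gamma>2 (Y z)" using rep[of z] X by (simp add: \<gamma>2_def h2_def add.commute)
        moreover have "Y z \<in> ?I" using z by auto
        ultimately show ?thesis by blast
      qed
    qed
    show "\<gamma>1 ` ?I \<inter> \<gamma>2 ` ?I = {0}"
    proof (intro equalityI subsetI)
      fix z assume "z \<in> \<gamma>1 ` ?I \<inter> \<gamma>2 ` ?I"
      then obtain x y where "x \<in> ?I" "y \<in> ?I" and z: "z = \<gamma>1 x" "z = \<gamma>2 y" by blast
      then have xy: "\<bar>x\<bar> < \<epsilon>" "\<bar>y\<bar> < \<epsilon>" using I by auto
      have "x = h2 y" "h1 x = y"
        using XY[of x "h1 x"] XY[of "h2 y" y] z by (simp_all add: \<gamma>1_def \<gamma>2_def add.commute)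
      then have "x = 0" using small(1)[OF xy(1)] small(2)[OF xy(2)] by linarith
      then show "z \<in> {0}" using z(1) by (simp add: \<gamma>1_def h1_def)
    next
      fix z :: "real \<times> real" assume "z \<in> {0}"
      moreover have "\<gamma>1 0 = 0" "\<gamma>2 0 = 0" by (simp_all add: \<gamma>1_def \<gamma>2_def h1_def h2_def)
      moreover have "0 \<in> ?I" using \<epsilon>(1) by simp
      ultimately show "z \<in> \<gamma>1 ` ?I \<inter> \<gamma>2 ` ?I" by (metis IntI image_eqI singletonD)
    qed
  qed (rule \<epsilon>(1))
qed

lemma regular_arcs_near_node:
  assumes "cross d e \<noteq> 0" "q d = 0" "q e = 0"
  shows "regular_arcs_near IC 0"
proof (rule arcs_near_pair)
  fix W :: "(real \<times> real) set" assume "open W" "0 \<in> W"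
  then obtain U \<gamma>1 \<gamma>2 \<epsilon> where "U \<subseteq> W" "open U" "0 \<in> U" "\<epsilon> > 0"
    "regular_curve \<gamma>1 {- \<epsilon> <..< \<epsilon>}" "regular_curve \<gamma>2 {- \<epsilon> <..< \<epsilon>}" "\<gamma>1 0 = 0" "\<gamma>2 0 = 0"
    "\<gamma>1 ` {- \<epsilon> <..< \<epsilon>} \<union> \<gamma>2 ` {- \<epsilon> <..< \<epsilon>} = U \<inter> IC"
    using node_arcs[OF assms] by metis
  moreover from this have "front \<gamma>1 {- \<epsilon> <..< \<epsilon>}" "front \<gamma>2 {- \<epsilon> <..< \<epsilon>}"
    using regular_curve_imp_front by simp_all
  ultimately show "\<exists>U \<gamma>1 \<gamma>2 \<epsilon>. U \<subseteq> W \<and> open U \<and> 0 \<in> U \<and> \<epsilon> > 0 \<and>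
    (front \<gamma>1 {- \<epsilon> <..< \<epsilon>} \<and> regular_curve \<gamma>1 {- \<epsilon> <..< \<epsilon>}) \<and> \<gamma>1 0 = 0 \<and>
    (front \<gamma>2 {- \<epsilon> <..< \<epsilon>} \<and> regular_curve \<gamma>2 {- \<epsilon> <..< \<epsilon>}) \<and> \<gamma>2 0 = 0 \<and>
    \<gamma>1 ` {- \<epsilon> <..< \<epsilon>} \<union> \<gamma>2 ` {- \<epsilon> <..< \<epsilon>} = U \<inter> IC"
    by (intro exI[of _ U] exI[of _ \<gamma>1] exI[of _ \<gamma>2] exI[of _ \<epsilon>] conjI)
qed

lemma regular_IC_node:
  assumes "cross d e \<noteq> 0" "q d = 0" "q e = 0"
  shows "regular_as_parametrized_curve IC"
  unfolding regular_as_parametrized_curve_def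
proof (rule locally_finite_union_ofI)
  show "regular_arcs_near IC z" if "z \<in> IC" for z
    using that regular_arcs_near_IC regular_arcs_near_node[OF assms] by (cases "z = 0") auto
qed

lemma span_neq_of_cross:
  assumes "cross d e \<noteq> 0" shows "span {d} \<noteq> span {e}"
proof
  assume "span {d} = span {e}"
  then have "d \<in> span {e}" using span_base by auto
  then obtain k where "d = k *\<^sub>R e" by (auto simp: span_singleton)
  then show False using assms by (simp add: cross_def)
qed

lemma has_node_IC:
  assumes cr: "cross d e \<noteq> 0" "q d = 0" "q e = 0"
  shows "has_node IC (0, 0)"
proof -
  obtain U \<gamma>1 \<gamma>2 \<epsilon> where *: "open U" "0 \<in> U" "\<epsilon> > 0"
    "regular_curve \<gamma>1 {- \<epsilon> <..< \<epsilon>}" "\<exists>g. homeomorphism {- \<epsilon> <..< \<epsilon>} (\<gamma>1 ` {- \<epsilon> <..< \<epsilon>}) \<gamma>1 g"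
    "regular_curve \<gamma>2 {- \<epsilon> <..< \<epsilon>}" "\<exists>g. homeomorphism {- \<epsilon> <..< \<epsilon>} (\<gamma>2 ` {- \<epsilon> <..< \<epsilon>}) \<gamma>2 g"
    "\<gamma>1 0 = 0" "\<gamma>2 0 = 0"
    "\<gamma>1 ` {- \<epsilon> <..< \<epsilon>} \<union> \<gamma>2 ` {- \<epsilon> <..< \<epsilon>} = U \<inter> IC"
    "\<gamma>1 ` {- \<epsilon> <..< \<epsilon>} \<inter> \<gamma>2 ` {- \<epsilon> <..< \<epsilon>} = {0}"
    "vector_derivative \<gamma>1 (at 0) = d" "vector_derivative \<gamma>2 (at 0) = e"
    by (rule node_arcs[OF cr open_UNIV UNIV_I])
  have "span {vector_derivative \<gamma>1 (at 0)} \<noteq> span {vector_derivative \<gamma>2 (at 0)}"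
    unfolding *(12,13) by (rule span_neq_of_cross[OF cr(1)])
  with * show ?thesis
    unfolding has_node_def Let_def zero_prod_def[symmetric]
    by (intro exI[of _ U] exI[of _ \<gamma>1] exI[of _ \<gamma>2] exI[of _ 0] exI[of _ \<epsilon>] conjI) simp_all
qed

end


section \<open>Tangent directions at the origin and conics in frames\<close>

lemma orthonormal_frameD:
  assumes "orthonormal_frame u v"
  shows "u \<bullet> u = 1" "v \<bullet> v = 1" "u \<bullet> v = 0" "v \<bullet> u = 0" "(cross u v)\<^sup>2 = 1"
proof -
  show *: "u \<bullet> u = 1" "v \<bullet> v = 1" "u \<bullet> v = 0" "v \<bullet> u = 0"
    using assms by (simp_all add: orthonormal_frame_def norm_eq_1 inner_commute)
  have "(cross u v)\<^sup>2 = (u \<bullet> u) * (v \<bullet> v) - (u \<bullet> v)\<^sup>2"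
    by (simp add: cross_def inner_prod_def power2_eq_square algebra_simps)
  then show "(cross u v)\<^sup>2 = 1" using * by simp
qed

lemma orthonormal_frame_expand:
  assumes "orthonormal_frame u v"
  shows "z = (z \<bullet> u) *\<^sub>R u + (z \<bullet> v) *\<^sub>R v"
proof -
  have cr: "cross u v \<noteq> 0" using orthonormal_frameD(5)[OF assms] by auto
  obtain x y where "z = x *\<^sub>R u + y *\<^sub>R v" using cross_coordinates[OF cr] by blast
  then show ?thesis using orthonormal_frameD[OF assms] by (simp add: inner_add_left)
qed

lemma span_scaleR: "k \<noteq> 0 \<Longrightarrow> span {k *\<^sub>R d} = span {d :: real \<times> real}"
  by (rule span_image_scale[of "{d}" "\<lambda>_. k", simplified])

lemma span_sgn: "span {sgn d} = span {d :: real \<times> real}"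
  by (cases "d = 0") (simp_all add: sgn_div_norm span_scaleR)

lemma norm_inversion_map: "norm (inversion_map z) = inverse (norm z)"
  by (cases "z = 0") (simp_all add: inversion_map_def power2_eq_square divide_simps)

lemma sgn_inversion_map: "sgn (inversion_map z) = sgn z"
  by (cases "z = 0") (simp_all add: inversion_map_def sgn_scaleR sgn_zero_iff)

context irreducible_conic
begin

definition null_directions :: "(real \<times> real) set set" where
  "null_directions = {span {d} | d. d \<noteq> 0 \<and> q d = 0}"

lemma continuous_on_q: "continuous_on S q"
  unfolding q_def by (intro continuous_intros)

lemma continuous_on_l: "continuous_on S l"
  unfolding l_def by (intro continuous_intros)

lemma q_sgn:
  assumes "G z = 0" "z \<noteq> 0"
  shows "q (sgn z) = - (c * (z \<bullet> z) + 2 * l z)"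
proof -
  have z: "z \<bullet> z \<noteq> 0" using assms(2) by simp
  have "(z \<bullet> z) * (c * (z \<bullet> z) + 2 * l z) + q z = 0"
    using assms(1) by (simp add: G_def power2_eq_square algebra_simps)
  moreover have "q (sgn z) = q z / (z \<bullet> z)"
    by (simp add: sgn_div_norm q_scaleR power_inverse dot_square_norm divide_inverse)
  moreover have "q z = (z \<bullet> z) * - (c * (z \<bullet> z) + 2 * l z)" using calculation(1) by linarith
  ultimately show ?thesis using z by simp
qed

lemma tangent_directions_subset: "tangent_directions IC (0, 0) \<subseteq> null_directions"
proof
  fix L assume "L \<in> tangent_directions IC (0, 0)"
  then obtain d z where L: "L = span {d}" and z: "\<And>n. z n \<in> IC - {(0, 0)}" "z \<longlonglongrightarrow> (0, 0)"
    and d: "(\<lambda>n. sgn (z n - (0, 0))) \<longlonglongrightarrow> d"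
    unfolding tangent_directions_def by blast
  have z0: "G (z n) = 0" "z n \<noteq> 0" for n using z(1)[of n] mem_IC by (auto simp: zero_prod_def)
  have z2: "z \<longlonglongrightarrow> 0" using z(2) by (simp add: zero_prod_def)
  have d: "(\<lambda>n. sgn (z n)) \<longlonglongrightarrow> d" using d by (simp add: zero_prod_def[symmetric])
  from tendsto_norm[OF d] have "norm d = 1"
    using z0(2) by (simp add: norm_sgn LIMSEQ_const_iff)
  moreover have "q d = 0"
  proof (rule LIMSEQ_unique)
    show "(\<lambda>n. q (sgn (z n))) \<longlonglongrightarrow> q d"
      using continuous_on_tendsto_compose[OF continuous_on_q[of UNIV] d] by simp
    have "(\<lambda>n. l (z n)) \<longlonglongrightarrow> l 0"
      using continuous_on_tendsto_compose[OF continuous_on_l[of UNIV] z2] by simp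
    then have "(\<lambda>n. - (c * (z n \<bullet> z n) + 2 * l (z n))) \<longlonglongrightarrow> - (c * ((0 :: real \<times> real) \<bullet> 0) + 2 * l 0)"
      by (intro tendsto_minus tendsto_add tendsto_mult tendsto_const tendsto_inner z2)
    then show "(\<lambda>n. q (sgn (z n))) \<longlonglongrightarrow> 0" using q_sgn z0 by (simp add: l_def)
  qed
  ultimately show "L \<in> null_directions" using L
    unfolding null_directions_def by (intro CollectI exI[of _ d]) auto
qed

text \<open>
  Inversion preserves the rays from the origin: points of the conic that run to infinity along \<open>d\<close>
  become points that approach the origin along \<open>d\<close>.
\<close>

lemma tangent_direction_at_infinity:
  assumes C: "\<And>n. z n \<in> C" and a: "filterlim a at_top sequentially"
    and d: "(\<lambda>n. z n /\<^sub>R a n) \<longlonglongrightarrow> d" "d \<noteq> 0"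
  shows "span {d} \<in> tangent_directions IC (0, 0)"
proof -
  have ev: "\<forall>\<^sub>F n in sequentially. a n > 0" using a by (simp add: filterlim_at_top_dense)
  have "filterlim (\<lambda>n. norm (z n /\<^sub>R a n) * a n) at_top sequentially"
    by (rule filterlim_tendsto_pos_mult_at_top[OF tendsto_norm[OF d(1)] _ a]) (use d in simp)
  then have inf: "filterlim (\<lambda>n. norm (z n)) at_top sequentially"
  proof (rule filterlim_mono_eventually)
    show "\<forall>\<^sub>F n in sequentially. norm (z n /\<^sub>R a n) * a n = norm (z n)"
      using ev by eventually_elim simp
  qed auto
  then have "\<forall>\<^sub>F n in sequentially. norm (z n) > 0"
    unfolding filterlim_at_top_dense by blast
  then obtain N where N: "\<And>n. n \<ge> N \<Longrightarrow> z n \<noteq> 0" by (auto simp: eventually_sequentially)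
  define w where "w n = inversion_map (z (n + N))" for n
  have "w n \<in> IC - {(0, 0)}" for n
    unfolding inversion_curve_minus_origin w_def using C N[of "n + N"] by (auto simp: zero_prod_def)
  moreover have "w \<longlonglongrightarrow> (0, 0)"
    unfolding zero_prod_def[symmetric]
  proof (rule tendsto_norm_zero_cancel)
    have "(\<lambda>n. inverse (norm (z n))) \<longlonglongrightarrow> 0" by (rule tendsto_inverse_0_at_top[OF inf])
    from LIMSEQ_ignore_initial_segment[OF this, of N] show "(\<lambda>n. norm (w n)) \<longlonglongrightarrow> 0"
      by (simp add: w_def norm_inversion_map)
  qed
  moreover have "(\<lambda>n. sgn (w n - (0, 0))) \<longlonglongrightarrow> sgn d"
  proof -
    have "(\<lambda>n. sgn (z n)) \<longlonglongrightarrow> sgn d"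
    proof (rule Lim_transform_eventually[OF tendsto_sgn[OF d]])
      show "\<forall>\<^sub>F n in sequentially. sgn (z n /\<^sub>R a n) = sgn (z n)"
        using ev by eventually_elim (simp add: sgn_scaleR)
    qed
    from LIMSEQ_ignore_initial_segment[OF this, of N] show ?thesis
      by (simp add: w_def sgn_inversion_map zero_prod_def[symmetric])
  qed
  ultimately show ?thesis
    unfolding tangent_directions_def by (subst span_sgn[symmetric]) blast
qed

lemma null_directions_two:
  assumes cr: "cross d e \<noteq> 0" and qd: "q d = 0" and qe: "q e = 0"
  shows "null_directions = {span {d}, span {e}}"
proof -
  have de: "b d e \<noteq> 0" by (rule b_nonzero[OF assms])
  have nz: "d \<noteq> 0" "e \<noteq> 0" using cr by (auto simp: cross_def)
  have "span {z} = span {d} \<or> span {z} = span {e}" if z: "q z = 0" "z \<noteq> 0" for z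
  proof -
    obtain x y where xy: "z = x *\<^sub>R d + y *\<^sub>R e" using cross_coordinates[OF cr] by blast
    then have "2 * x * y * b d e = 0" using z(1) q_combination qd qe by simp
    then have "x = 0 \<or> y = 0" using de by simp
    then show ?thesis
    proof
      assume "x = 0"
      then show ?thesis using xy z(2) span_scaleR[of y e] by (cases "y = 0") simp_all
    next
      assume "y = 0"
      then show ?thesis using xy z(2) span_scaleR[of x d] by (cases "x = 0") simp_all
    qed
  qed
  then show ?thesis unfolding null_directions_def using nz qd qe by blast
qed

lemma F_combination:
  "F (p + X *\<^sub>R u + Y *\<^sub>R v) = q u * X\<^sup>2 + 2 * b u v * X * Y + q v * Y\<^sup>2
     + 2 * (b p u + l u) * X + 2 * (b p v + l v) * Y + F p"
  by (simp add: F_def q_def b_def l_def power2_eq_square algebra_simps)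

text \<open>
  A quadratic polynomial that vanishes on a hyperbola, ellipse or parabola has the expected
  second order part in the given frame.  Rational points such as \<open>(5 \<alpha> / 3, 4 \<beta> / 3)\<close>
  on the hyperbola suffice to determine it.
\<close>

lemma hyperbola_frame_q:
  assumes h: "hyperbola_in_frame C p u v \<alpha> \<beta>"
  shows "q (\<alpha> *\<^sub>R u + \<beta> *\<^sub>R v) = 0" "q (\<alpha> *\<^sub>R u - \<beta> *\<^sub>R v) = 0"
    and "cross (\<alpha> *\<^sub>R u + \<beta> *\<^sub>R v) (\<alpha> *\<^sub>R u - \<beta> *\<^sub>R v) \<noteq> 0"
proof -
  have fr: "orthonormal_frame u v" and ab: "\<alpha> > 0" "\<beta> > 0"
    and CC: "C = {p + X *\<^sub>R u + Y *\<^sub>R v | X Y. X\<^sup>2 / \<alpha>\<^sup>2 - Y\<^sup>2 / \<beta>\<^sup>2 = 1}"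
    using h by (auto simp: hyperbola_in_frame_def)
  define A B D E H where "A = q u * \<alpha>\<^sup>2" and "B = b u v * \<alpha> * \<beta>" and "D = q v * \<beta>\<^sup>2"
    and "E = (b p u + l u) * \<alpha>" and "H = (b p v + l v) * \<beta>"
  have eq: "A * x\<^sup>2 + 2 * B * x * y + D * y\<^sup>2 + 2 * E * x + 2 * H * y + F p = 0" if "x\<^sup>2 - y\<^sup>2 = 1" for x y
  proof -
    have "(x * \<alpha>)\<^sup>2 / \<alpha>\<^sup>2 - (y * \<beta>)\<^sup>2 / \<beta>\<^sup>2 = 1" using ab that by (simp add: power_mult_distrib)
    then have "p + (x * \<alpha>) *\<^sub>R u + (y * \<beta>) *\<^sub>R v \<in> C" unfolding CC by blast
    then have "F (p + (x * \<alpha>) *\<^sub>R u + (y * \<beta>) *\<^sub>R v) = 0" by (simp only: mem_C)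
    then show ?thesis
      unfolding F_combination A_def B_def D_def E_def H_def by (simp add: power_mult_distrib algebra_simps)
  qed
  have "A + D = 0" "B = 0"
    using eq[of 1 0] eq[of "-1" 0] eq[of "5/3" "4/3"] eq[of "5/3" "-4/3"] eq[of "-5/3" "4/3"] eq[of "-5/3" "-4/3"]
    by (simp_all add: power2_eq_square)
  moreover have "q (\<alpha> *\<^sub>R u + s *\<^sub>R \<beta> *\<^sub>R v) = A + 2 * s * B + s\<^sup>2 * D" for s
    by (simp add: q_combination A_def B_def D_def power_mult_distrib algebra_simps)
  from this[of 1] this[of "-1"] show "q (\<alpha> *\<^sub>R u + \<beta> *\<^sub>R v) = 0" "q (\<alpha> *\<^sub>R u - \<beta> *\<^sub>R v) = 0"
    using calculation by simp_all
  have "cross (\<alpha> *\<^sub>R u + \<beta> *\<^sub>R v) (\<alpha> *\<^sub>R u - \<beta> *\<^sub>R v) = - 2 * \<alpha> * \<beta> * cross u v"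
    by (simp add: cross_def algebra_simps)
  then show "cross (\<alpha> *\<^sub>R u + \<beta> *\<^sub>R v) (\<alpha> *\<^sub>R u - \<beta> *\<^sub>R v) \<noteq> 0"
    using ab orthonormal_frameD(5)[OF fr] by auto
qed

lemma hyperbola_tangents:
  assumes "is_hyperbola C"
  shows "tangent_directions IC (0, 0) = asymptotic_directions C"
proof -
  have *: "{span {\<alpha> *\<^sub>R u + \<beta> *\<^sub>R v}, span {\<alpha> *\<^sub>R u - \<beta> *\<^sub>R v}} = null_directions"
    if "hyperbola_in_frame C p u v \<alpha> \<beta>" for p u v \<alpha> \<beta>
    using null_directions_two[OF hyperbola_frame_q(3,1,2)[OF that]] by simp
  obtain p u v \<alpha> \<beta> where h: "hyperbola_in_frame C p u v \<alpha> \<beta>" using assms by (auto simp: is_hyperbola_def)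
  have "asymptotic_directions C = null_directions"
  proof (intro equalityI subsetI)
    fix L assume "L \<in> asymptotic_directions C"
    then obtain p u v \<alpha> \<beta> where h: "hyperbola_in_frame C p u v \<alpha> \<beta>"
      and L: "L = span {\<alpha> *\<^sub>R u + \<beta> *\<^sub>R v} \<or> L = span {\<alpha> *\<^sub>R u - \<beta> *\<^sub>R v}"
      unfolding asymptotic_directions_def by (elim CollectE exE conjE)
    show "L \<in> null_directions" unfolding *[OF h, symmetric] using L by simp
  next
    fix L assume "L \<in> null_directions"
    then have "L = span {\<alpha> *\<^sub>R u + \<beta> *\<^sub>R v} \<or> L = span {\<alpha> *\<^sub>R u - \<beta> *\<^sub>R v}"
      unfolding *[OF h, symmetric] by simp
    with h show "L \<in> asymptotic_directions C"
      unfolding asymptotic_directions_def by (intro CollectI exI conjI)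
  qed
  moreover have "null_directions \<subseteq> tangent_directions IC (0, 0)"
  proof -
    have fr: "orthonormal_frame u v" and ab: "\<alpha> > 0" "\<beta> > 0"
      and CC: "C = {p + X *\<^sub>R u + Y *\<^sub>R v | X Y. X\<^sup>2 / \<alpha>\<^sup>2 - Y\<^sup>2 / \<beta>\<^sup>2 = 1}"
      using h by (auto simp: hyperbola_in_frame_def)
    have "span {\<alpha> *\<^sub>R u + (s * \<beta>) *\<^sub>R v} \<in> tangent_directions IC (0, 0)" if s: "s\<^sup>2 = 1" for s :: real
    proof -
      \<comment> \<open>With \<open>t = n + 1\<close>, the point \<open>X = \<alpha> (t + 1 / t) / 2\<close>, \<open>Y = s \<beta> (t - 1 / t) / 2\<close>.\<close>
      define t where "t n = real (Suc n)" for n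
      define i where "i n = inverse (t n)" for n
      have ti: "t n * i n = 1" "t n > 0" for n by (simp_all add: t_def i_def)
      define z where "z n = p + (\<alpha> * ((t n + i n) / 2)) *\<^sub>R u + (s * \<beta> * ((t n - i n) / 2)) *\<^sub>R v" for n
      have scaled: "(\<alpha> * x)\<^sup>2 / \<alpha>\<^sup>2 - (s * \<beta> * y)\<^sup>2 / \<beta>\<^sup>2 = x\<^sup>2 - s\<^sup>2 * y\<^sup>2" for x y
        using ab by (simp add: power_mult_distrib)
      have "z n \<in> C" for n
      proof -
        have "(\<alpha> * ((t n + i n) / 2))\<^sup>2 / \<alpha>\<^sup>2 - (s * \<beta> * ((t n - i n) / 2))\<^sup>2 / \<beta>\<^sup>2
            = ((t n + i n) / 2)\<^sup>2 - s\<^sup>2 * ((t n - i n) / 2)\<^sup>2"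
          by (rule scaled)
        also have "\<dots> = t n * i n" unfolding s by (simp add: power2_eq_square field_simps)
        finally show ?thesis unfolding CC z_def ti by blast
      qed
      moreover have t: "filterlim t at_top sequentially"
        unfolding t_def by (rule filterlim_compose[OF filterlim_real_sequentially filterlim_Suc])
      moreover have "(\<lambda>n. z n /\<^sub>R t n) \<longlonglongrightarrow> (1 / 2) *\<^sub>R (\<alpha> *\<^sub>R u + (s * \<beta>) *\<^sub>R v)"
      proof -
        have i: "i \<longlonglongrightarrow> 0" unfolding i_def[abs_def] by (rule tendsto_inverse_0_at_top[OF t])
        have "z n /\<^sub>R t n = i n *\<^sub>R p + (\<alpha> * ((1 + (i n)\<^sup>2) / 2)) *\<^sub>R u + (s * \<beta> * ((1 - (i n)\<^sup>2) / 2)) *\<^sub>R v" for n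
        proof -
          have e: "i n * (\<alpha> * ((t n + i n) / 2)) = \<alpha> * ((1 + (i n)\<^sup>2) / 2)"
            "i n * (s * \<beta> * ((t n - i n) / 2)) = s * \<beta> * ((1 - (i n)\<^sup>2) / 2)"
            using ti(1)[of n] by algebra+
          have "z n /\<^sub>R t n = i n *\<^sub>R p + (i n * (\<alpha> * ((t n + i n) / 2))) *\<^sub>R u
              + (i n * (s * \<beta> * ((t n - i n) / 2))) *\<^sub>R v"
            by (simp only: z_def i_def scaleR_add_right scaleR_scaleR)
          then show ?thesis by (simp only: e)
        qed
        moreover have "(\<lambda>n. i n *\<^sub>R p + (\<alpha> * ((1 + (i n)\<^sup>2) / 2)) *\<^sub>R u + (s * \<beta> * ((1 - (i n)\<^sup>2) / 2)) *\<^sub>R v)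
           \<longlonglongrightarrow> 0 *\<^sub>R p + (\<alpha> * ((1 + 0\<^sup>2) / 2)) *\<^sub>R u + (s * \<beta> * ((1 - 0\<^sup>2) / 2)) *\<^sub>R v"
          by (intro tendsto_intros i) auto
        ultimately show ?thesis by (simp add: scaleR_add_right)
      qed
      moreover have "\<alpha> *\<^sub>R u + (s * \<beta>) *\<^sub>R v \<noteq> 0"
      proof
        assume "\<alpha> *\<^sub>R u + (s * \<beta>) *\<^sub>R v = 0"
        then have "cross (\<alpha> *\<^sub>R u + (s * \<beta>) *\<^sub>R v) v = 0" by (simp add: cross_def)
        then show False using ab orthonormal_frameD(5)[OF fr] by (simp add: cross_linear)
      qed
      ultimately show ?thesis
        using tangent_direction_at_infinity[of z t "(1 / 2) *\<^sub>R (\<alpha> *\<^sub>R u + (s * \<beta>) *\<^sub>R v)"]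
        by (simp add: span_scaleR del: scaleR_half_double)
    qed
    from this[of 1] this[of "-1"] show ?thesis unfolding *[OF h, symmetric] by simp
  qed
  ultimately show ?thesis using tangent_directions_subset by auto
qed

lemma discriminant_frame:
  "q u * q v - (b u v)\<^sup>2 = (a11 * a22 - a12\<^sup>2) * (cross u v)\<^sup>2"
  by (simp add: q_def b_def cross_def power2_eq_square algebra_simps)

lemma ellipse_discriminant:
  assumes "is_ellipse C" shows "a11 * a22 - a12\<^sup>2 > 0"
proof -
  obtain p u v \<alpha> \<beta> where fr: "orthonormal_frame u v" and ab: "\<alpha> > 0" "\<beta> > 0"
    and CC: "C = {p + X *\<^sub>R u + Y *\<^sub>R v | X Y. X\<^sup>2 / \<alpha>\<^sup>2 + Y\<^sup>2 / \<beta>\<^sup>2 = 1}"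
    using assms unfolding is_ellipse_def by blast
  define A B D E H where "A = q u * \<alpha>\<^sup>2" and "B = b u v * \<alpha> * \<beta>" and "D = q v * \<beta>\<^sup>2"
    and "E = (b p u + l u) * \<alpha>" and "H = (b p v + l v) * \<beta>"
  have eq: "A * x\<^sup>2 + 2 * B * x * y + D * y\<^sup>2 + 2 * E * x + 2 * H * y + F p = 0" if "x\<^sup>2 + y\<^sup>2 = 1" for x y
  proof -
    have "(x * \<alpha>)\<^sup>2 / \<alpha>\<^sup>2 + (y * \<beta>)\<^sup>2 / \<beta>\<^sup>2 = 1" using ab that by (simp add: power_mult_distrib)
    then have "p + (x * \<alpha>) *\<^sub>R u + (y * \<beta>) *\<^sub>R v \<in> C" unfolding CC by blast
    then have "F (p + (x * \<alpha>) *\<^sub>R u + (y * \<beta>) *\<^sub>R v) = 0" by (simp only: mem_C)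
    then show ?thesis
      unfolding F_combination A_def B_def D_def E_def H_def by (simp add: power_mult_distrib algebra_simps)
  qed
  have "A = D" "B = 0"
    using eq[of 1 0] eq[of "-1" 0] eq[of 0 1] eq[of 0 "-1"] eq[of "3/5" "4/5"]
    by (simp_all add: power2_eq_square)
  then have AD: "q u * \<alpha>\<^sup>2 = q v * \<beta>\<^sup>2" and B: "b u v = 0" using ab by (simp_all add: A_def D_def B_def)
  have cr: "cross u v \<noteq> 0" using orthonormal_frameD(5)[OF fr] by auto
  have "q u \<noteq> 0"
    using b_nonzero[OF cr] B AD ab by auto
  then have "0 < (q u * \<alpha>)\<^sup>2" using ab by simp
  also have "\<dots> = q u * (q u * \<alpha>\<^sup>2)" by (simp add: power2_eq_square)
  also have "\<dots> = (q u * q v) * \<beta>\<^sup>2" unfolding AD by simp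
  finally have "0 < q u * q v" using ab by (simp add: zero_less_mult_iff)
  then show ?thesis
    using discriminant_frame[of u v] B orthonormal_frameD(5)[OF fr] by simp
qed

lemma isolated_IC:
  assumes \<delta>: "a11 * a22 - a12\<^sup>2 > 0"
  shows "(0, 0) isolated_in IC"
proof -
  have def: "z = 0" if "q z = 0" for z
  proof -
    have "a11 * q z = (a11 * fst z + a12 * snd z)\<^sup>2 + (a11 * a22 - a12\<^sup>2) * (snd z)\<^sup>2"
      by (simp add: q_def power2_eq_square algebra_simps)
    then have "(a11 * fst z + a12 * snd z)\<^sup>2 + (a11 * a22 - a12\<^sup>2) * (snd z)\<^sup>2 = 0" using that by simp
    moreover have "(a11 * a22 - a12\<^sup>2) * (snd z)\<^sup>2 \<ge> 0" using \<delta> by simp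
    ultimately have "(a11 * a22 - a12\<^sup>2) * (snd z)\<^sup>2 = 0" "(a11 * fst z + a12 * snd z)\<^sup>2 = 0"
      using zero_le_power2[of "a11 * fst z + a12 * snd z"] by linarith+
    then have "snd z = 0" "a11 * fst z = 0" using \<delta> by auto
    moreover have "a11 \<noteq> 0" using \<delta> by (auto simp: not_less)
    ultimately show ?thesis by (simp add: prod_eq_iff)
  qed
  obtain x :: "real \<times> real" where x: "x \<in> sphere 0 1" "\<And>y. y \<in> sphere 0 1 \<Longrightarrow> \<bar>q x\<bar> \<le> \<bar>q y\<bar>"
  proof -
    have "sphere 0 1 \<noteq> ({} :: (real \<times> real) set)" by simp
    then show ?thesis
      using continuous_attains_inf[OF compact_sphere, of 0 1 "\<lambda>z. \<bar>q z\<bar>"] that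
        continuous_on_rabs[OF continuous_on_q] by blast
  qed
  have \<kappa>: "\<bar>q x\<bar> > 0" using def[of x] x(1) by auto
  define N where "N = {z. \<bar>c * (z \<bullet> z) + 2 * l z\<bar> < \<bar>q x\<bar>}"
  have "open N"
    unfolding N_def by (intro open_Collect_less continuous_intros continuous_on_l)
  moreover have "N \<inter> IC = {(0, 0)}"
  proof (intro equalityI subsetI)
    fix z assume z: "z \<in> N \<inter> IC"
    have "z = 0"
    proof (rule ccontr)
      assume nz: "z \<noteq> 0"
      then have "sgn z \<in> sphere 0 1" by (simp add: norm_sgn)
      then have "\<bar>q x\<bar> \<le> \<bar>q (sgn z)\<bar>" by (rule x(2))
      also have "\<dots> = \<bar>c * (z \<bullet> z) + 2 * l z\<bar>"
        using z q_sgn[OF _ nz] by (simp only: mem_IC Int_iff abs_minus_cancel)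
      finally show False using z by (simp add: N_def)
    qed
    then show "z \<in> {(0, 0)}" by (simp add: zero_prod_def)
  next
    fix z :: "real \<times> real" assume "z \<in> {(0, 0)}"
    then have "z = 0" by (simp add: zero_prod_def)
    then show "z \<in> N \<inter> IC" using \<kappa> G_0 by (simp add: N_def mem_IC l_def)
  qed
  ultimately show ?thesis
    unfolding isolated_in_def using G_0 by (auto simp: mem_IC zero_prod_def)
qed

lemma parabola_frame_q:
  assumes "parabola_in_frame C p u v k"
  shows "q u = 0" "b u v = 0" "q v \<noteq> 0"
proof -
  have fr: "orthonormal_frame u v" and k: "k > 0"
    and CC: "C = {p + X *\<^sub>R u + Y *\<^sub>R v | X Y. Y\<^sup>2 = 4 * k * X}"
    using assms by (auto simp: parabola_in_frame_def)
  define j where "j = inverse (4 * k)"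
  have j: "4 * k * j = 1" "j \<noteq> 0" using k by (simp_all add: j_def)
  define A B E where "A = q u * j\<^sup>2" and "B = b u v * j" and "E = (b p u + l u) * j"
  have eq: "A * s ^ 4 + 2 * B * s ^ 3 + q v * s\<^sup>2 + 2 * E * s\<^sup>2 + 2 * (b p v + l v) * s + F p = 0" for s
  proof -
    have "s\<^sup>2 = 4 * k * (j * s\<^sup>2)" using j(1) by algebra
    then have "p + (j * s\<^sup>2) *\<^sub>R u + s *\<^sub>R v \<in> C" unfolding CC by blast
    then have "F (p + (j * s\<^sup>2) *\<^sub>R u + s *\<^sub>R v) = 0" by (simp only: mem_C)
    then show ?thesis
      unfolding F_combination A_def B_def E_def
      by (simp add: algebra_simps power2_eq_square power3_eq_cube power4_eq_xxxx)
  qed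
  have "A = 0" "B = 0"
    using eq[of 0] eq[of 1] eq[of "-1"] eq[of 2] eq[of "-2"] by simp_all
  then show *: "q u = 0" "b u v = 0" using j by (simp_all add: A_def B_def)
  have "cross u v \<noteq> 0" using orthonormal_frameD(5)[OF fr] by auto
  from b_nonzero[OF this] * show "q v \<noteq> 0" by auto
qed

lemma parabola_tangents:
  assumes "is_parabola C"
  shows "tangent_directions IC (0, 0) = axis_directions C"
proof -
  have *: "null_directions = {span {u}}" if h: "parabola_in_frame C p u v k" for p u v k
  proof -
    have fr: "orthonormal_frame u v" using h by (auto simp: parabola_in_frame_def)
    have sp: "span {z} = span {u}" if "q z = 0" "z \<noteq> 0" for z
    proof -
      have z: "z = (z \<bullet> u) *\<^sub>R u + (z \<bullet> v) *\<^sub>R v" by (rule orthonormal_frame_expand[OF fr])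
      have "q z = q ((z \<bullet> u) *\<^sub>R u + (z \<bullet> v) *\<^sub>R v)" by (rule arg_cong[OF z])
      also have "\<dots> = (z \<bullet> v)\<^sup>2 * q v" by (simp add: q_combination parabola_frame_q[OF h])
      finally have "q z = (z \<bullet> v)\<^sup>2 * q v" .
      then have "z \<bullet> v = 0" using that(1) parabola_frame_q(3)[OF h] by simp
      then have "z = (z \<bullet> u) *\<^sub>R u" using z by simp
      then show ?thesis using span_scaleR[of "z \<bullet> u" u] that(2) by (metis scaleR_zero_left)
    qed
    have u: "u \<noteq> 0" using orthonormal_frameD(1)[OF fr] by auto
    show ?thesis
    proof (intro equalityI subsetI)
      fix L assume "L \<in> null_directions"
      then obtain z where "L = span {z}" "z \<noteq> 0" "q z = 0" unfolding null_directions_def by blast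
      then show "L \<in> {span {u}}" using sp by simp
    next
      fix L assume "L \<in> {span {u}}"
      then show "L \<in> null_directions"
        unfolding null_directions_def using u parabola_frame_q(1)[OF h] by (intro CollectI exI[of _ u]) simp
    qed
  qed
  obtain p u v k where h: "parabola_in_frame C p u v k" using assms by (auto simp: is_parabola_def)
  have "axis_directions C = null_directions"
  proof (intro equalityI subsetI)
    fix L assume "L \<in> axis_directions C"
    then obtain p u v k where h: "parabola_in_frame C p u v k" and L: "L = span {u}"
      unfolding axis_directions_def by (elim CollectE exE conjE)
    show "L \<in> null_directions" unfolding *[OF h] using L by simp
  next
    fix L assume "L \<in> null_directions"
    then have "L = span {u}" unfolding *[OF h] by simp
    with h show "L \<in> axis_directions C" unfolding axis_directions_def by (intro CollectI exI conjI)
  qed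
  moreover have "span {u} \<in> tangent_directions IC (0, 0)"
  proof -
    have fr: "orthonormal_frame u v" and k: "k > 0"
      and CC: "C = {p + X *\<^sub>R u + Y *\<^sub>R v | X Y. Y\<^sup>2 = 4 * k * X}"
      using h by (auto simp: parabola_in_frame_def)
    define t where "t n = real (Suc n)" for n
    define i where "i n = inverse (t n)" for n
    have ti: "t n * i n = 1" for n by (simp add: t_def i_def)
    define z where "z n = p + ((t n)\<^sup>2 / (4 * k)) *\<^sub>R u + t n *\<^sub>R v" for n
    have "(t n)\<^sup>2 = 4 * k * ((t n)\<^sup>2 / (4 * k))" for n using k by simp
    then have "z n \<in> C" for n unfolding CC z_def by blast
    moreover have t: "filterlim t at_top sequentially"
      unfolding t_def by (rule filterlim_compose[OF filterlim_real_sequentially filterlim_Suc])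
    then have "filterlim (\<lambda>n. (t n)\<^sup>2) at_top sequentially"
      by (intro filterlim_pow_at_top) auto
    moreover have "(\<lambda>n. z n /\<^sub>R (t n)\<^sup>2) \<longlonglongrightarrow> (1 / (4 * k)) *\<^sub>R u"
    proof -
      have i: "i \<longlonglongrightarrow> 0" unfolding i_def[abs_def] by (rule tendsto_inverse_0_at_top[OF t])
      have "z n /\<^sub>R (t n)\<^sup>2 = (i n)\<^sup>2 *\<^sub>R p + (1 / (4 * k)) *\<^sub>R u + i n *\<^sub>R v" for n
      proof -
        have "(i n)\<^sup>2 * ((t n)\<^sup>2 / (4 * k)) = 1 / (4 * k)" "(i n)\<^sup>2 * t n = i n"
          using ti[of n] by algebra+
        then show ?thesis by (simp add: z_def i_def[symmetric] scaleR_add_right power_inverse[symmetric])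
      qed
      moreover have "(\<lambda>n. (i n)\<^sup>2 *\<^sub>R p + (1 / (4 * k)) *\<^sub>R u + i n *\<^sub>R v)
         \<longlonglongrightarrow> 0\<^sup>2 *\<^sub>R p + (1 / (4 * k)) *\<^sub>R u + 0 *\<^sub>R v"
        by (intro tendsto_intros i)
      ultimately show ?thesis by simp
    qed
    moreover have "(1 / (4 * k)) *\<^sub>R u \<noteq> 0" using k orthonormal_frameD(1)[OF fr] by auto
    ultimately have "span {(1 / (4 * k)) *\<^sub>R u} \<in> tangent_directions IC (0, 0)"
      by (rule tangent_direction_at_infinity)
    then show ?thesis using span_scaleR[of "1 / (4 * k)" u] k by simp
  qed
  ultimately show ?thesis using tangent_directions_subset *[OF h] by auto
qed

text \<open>
  If \<open>q\<close> is degenerate, the conic is a parabola: in a frame whose first vector \<open>u\<close> spans the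
  kernel of \<open>q\<close>, its equation is \<open>D Y\<^sup>2 + 2 E X + 2 H Y + c = 0\<close>, where \<open>E = l(u) \<noteq> 0\<close> because the conic is
  irreducible.  The sign of \<open>u\<close> is chosen such that \<open>E / D < 0\<close>.
\<close>

lemma parabola_of_discriminant_zero:
  assumes \<delta>: "a11 * a22 - a12\<^sup>2 = 0"
  shows "is_parabola C"
proof -
  obtain w where w: "w \<noteq> 0" "q w = 0"
  proof (cases "a22 = 0 \<and> a12 = 0")
    case True
    then have "q (0, 1) = 0" unfolding q_def by simp
    then show ?thesis using that[of "(0, 1)"] by (simp add: zero_prod_def)
  next
    case False
    have "q (a22, - a12) = a22 * (a11 * a22 - a12\<^sup>2)" by (simp add: q_def power2_eq_square algebra_simps)
    then show ?thesis using that[of "(a22, - a12)"] False \<delta> by (auto simp: zero_prod_def)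
  qed
  define u0 where "u0 = sgn w"
  define v where "v = (- snd u0, fst u0)"
  have "norm u0 = 1" using w by (simp add: u0_def norm_sgn)
  then have fr0: "orthonormal_frame u0 v"
    by (simp add: orthonormal_frame_def v_def norm_prod_def inner_prod_def add.commute)
  have qu0: "q u0 = 0" using w by (simp add: u0_def sgn_div_norm q_scaleR)
  then have "(b u0 v)\<^sup>2 = 0" using discriminant_frame[of u0 v] \<delta> by simp
  then have bu0: "b u0 v = 0" by simp
  have cr: "cross u0 v \<noteq> 0" using orthonormal_frameD(5)[OF fr0] by auto
  define D where "D = q v"
  have D: "D \<noteq> 0" unfolding D_def using b_nonzero[OF cr qu0] bu0 by auto
  have l0: "l u0 \<noteq> 0"
  proof
    assume l0: "l u0 = 0"
    obtain x y where u: "u0 = (x, y)" by (cases u0)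
    \<comment> \<open>The coefficient matrix of the conic then annihilates \<open>(x, y, 0)\<close>.\<close>
    have xy: "x * x + y * y = 1" using orthonormal_frameD(1)[OF fr0] by (simp add: u inner_prod_def)
    have e: "x * (a11 * x + a12 * y) + y * (a12 * x + a22 * y) = 0"
      "- y * (a11 * x + a12 * y) + x * (a12 * x + a22 * y) = 0" "a1 * x + a2 * y = 0"
      using qu0 bu0 l0 by (simp_all add: u v_def q_def b_def l_def power2_eq_square algebra_simps)
    have "a11 * x + a12 * y = 0" "a12 * x + a22 * y = 0" using e(1,2) xy by algebra+
    then have "(a11 * a22 * c + 2 * a12 * a2 * a1 - a11 * a2\<^sup>2 - a12\<^sup>2 * c - a22 * a1\<^sup>2) * x = 0"
      "(a11 * a22 * c + 2 * a12 * a2 * a1 - a11 * a2\<^sup>2 - a12\<^sup>2 * c - a22 * a1\<^sup>2) * y = 0"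
      using e(3) by algebra+
    then have "x = 0" "y = 0" using det_nz by auto
    then show False using xy by simp
  qed
  define s where "s = (if l u0 / D < 0 then 1 else - 1 :: real)"
  define u where "u = s *\<^sub>R u0"
  have s: "s = 1 \<or> s = -1" by (simp add: s_def)
  have fr: "orthonormal_frame u v" using fr0 s by (auto simp: orthonormal_frame_def u_def)
  have qu: "q u = 0" and bu: "b u v = 0" using qu0 bu0 by (simp_all add: u_def q_scaleR b_scaleR)
  have "l u = s * l u0" by (simp add: u_def l_def algebra_simps)
  then have "l u / D < 0" using l0 D by (auto simp: s_def divide_less_0_iff zero_less_divide_iff not_less)
  define k where "k = - l u / (2 * D)"
  define H where "H = l v"
  \<comment> \<open>Completing the square, the vertex \<open>p\<close> has the coordinates \<open>- \<kappa>\<close> and \<open>- H / D\<close> in the frame.\<close>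
  define \<kappa> where "\<kappa> = (c - H\<^sup>2 / D) / (2 * l u)"
  define p where "p = (- \<kappa>) *\<^sub>R u + (- H / D) *\<^sub>R v"
  have lu: "l u \<noteq> 0" using \<open>l u / D < 0\<close> by auto
  have k: "k > 0" using \<open>l u / D < 0\<close> by (simp add: k_def divide_less_0_iff zero_less_divide_iff)
  have F: "F (p + X *\<^sub>R u + Y *\<^sub>R v) = D * (Y\<^sup>2 - 4 * k * X)" for X Y
  proof -
    have "p + X *\<^sub>R u + Y *\<^sub>R v = 0 + (X - \<kappa>) *\<^sub>R u + (Y - H / D) *\<^sub>R v"
      by (simp add: p_def algebra_simps)
    also have "F \<dots> = D * (Y - H / D)\<^sup>2 + 2 * l u * (X - \<kappa>) + 2 * H * (Y - H / D) + c"
      unfolding F_combination qu bu by (simp add: D_def H_def b_def F_def q_def l_def)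
    also have "\<dots> = D * (Y\<^sup>2 - 4 * k * X)"
      using lu D by (simp add: k_def \<kappa>_def power2_eq_square field_simps)
    finally show ?thesis .
  qed
  have "C = {p + X *\<^sub>R u + Y *\<^sub>R v | X Y. Y\<^sup>2 = 4 * k * X}"
  proof (intro equalityI subsetI)
    fix z assume "z \<in> C"
    define X Y where "X = (z - p) \<bullet> u" and "Y = (z - p) \<bullet> v"
    have "z - p = X *\<^sub>R u + Y *\<^sub>R v"
      unfolding X_def Y_def by (rule orthonormal_frame_expand[OF fr])
    then have z: "z = p + X *\<^sub>R u + Y *\<^sub>R v" by (simp add: algebra_simps)
    then have "Y\<^sup>2 = 4 * k * X" using \<open>z \<in> C\<close> F[of X Y] D by (simp add: mem_C)
    then show "z \<in> {p + X *\<^sub>R u + Y *\<^sub>R v | X Y. Y\<^sup>2 = 4 * k * X}" using z by blast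
  next
    fix z assume "z \<in> {p + X *\<^sub>R u + Y *\<^sub>R v | X Y. Y\<^sup>2 = 4 * k * X}"
    then show "z \<in> C" using F by (auto simp: mem_C)
  qed
  then show ?thesis
    unfolding is_parabola_def parabola_in_frame_def using fr k by blast
qed

end


section \<open>Ordinary cusps are fronts\<close>

lemma range_cusp: "range (\<lambda>t::real. (t\<^sup>2, t ^ 3)) = {y. (snd y)\<^sup>2 = fst y ^ 3}"
proof (intro equalityI subsetI)
  fix y :: "real \<times> real" assume "y \<in> {y. (snd y)\<^sup>2 = fst y ^ 3}"
  then have y: "(snd y)\<^sup>2 = fst y ^ 3" by simp
  show "y \<in> range (\<lambda>t::real. (t\<^sup>2, t ^ 3))"
  proof (cases "fst y = 0")
    case True
    then have "y = (0\<^sup>2, 0 ^ 3)" using y by (simp add: prod_eq_iff)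
    then show ?thesis by (rule range_eqI)
  next
    case False
    define t where "t = snd y / fst y"
    have "t\<^sup>2 = fst y" using y False by (simp add: t_def power_divide divide_simps power2_eq_square power3_eq_cube)
    moreover have "t ^ 3 = snd y"
      using calculation False by (simp add: power3_eq_cube power2_eq_square) (simp add: t_def)
    ultimately have "y = (t\<^sup>2, t ^ 3)" by (simp add: prod_eq_iff)
    then show ?thesis by (rule range_eqI)
  qed
qed (auto simp: power_mult[symmetric])

text \<open>
  The direction \<open>g\<close> of the velocity \<open>t g(t)\<close> has no zero, so its rotation is a smooth unit normal
  \<open>\<nu>\<close>.  Differentiating \<open>\<langle>g, \<nu>\<rangle> = 0\<close> at \<open>t = 0\<close> shows that \<open>\<nu>'(0) = 0\<close> would
  make \<open>\<nu>(0)\<close> orthogonal to both \<open>g(0)\<close> and \<open>g'(0)\<close>.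
\<close>

lemma front_of_velocity_multiple:
  assumes I: "open I" and \<gamma>: "smooth_on I \<gamma>" and g: "smooth_on I g"
    and vd: "\<And>t. t \<in> I \<Longrightarrow> vector_derivative \<gamma> (at t) = t *\<^sub>R g t"
    and nz: "\<And>t. t \<in> I \<Longrightarrow> g t \<noteq> 0"
    and cr: "0 \<in> I \<Longrightarrow> cross (g 0) (vector_derivative g (at 0)) \<noteq> 0"
  shows "front \<gamma> I"
proof -
  define \<nu> where "\<nu> t = inverse (sqrt (g t \<bullet> g t)) *\<^sub>R (- snd (g t), fst (g t))" for t
  have s\<nu>: "smooth_on I \<nu>"
    unfolding \<nu>_def using nz by (intro smooth_intros smooth_on_inverse smooth_on_sqrt g I) auto
  have n1: "norm (\<nu> t) = 1" if "t \<in> I" for t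
  proof -
    have "norm (- snd (g t), fst (g t)) = norm (g t)"
      by (simp add: norm_Pair norm_prod_def add.commute)
    then show ?thesis using nz[OF that]
      unfolding \<nu>_def norm_scaleR by (simp add: norm_eq_sqrt_inner[symmetric])
  qed
  have orth: "g t \<bullet> \<nu> t = 0" for t
    by (simp add: \<nu>_def inner_prod_def)
  have "unit_normal_along \<nu> \<gamma> I"
    unfolding unit_normal_along_def using s\<nu> n1 vd orth by simp
  moreover have "(vector_derivative \<gamma> (at t), vector_derivative \<nu> (at t)) \<noteq> (0, 0)" if t: "t \<in> I" for t
  proof
    assume "(vector_derivative \<gamma> (at t), vector_derivative \<nu> (at t)) = (0, 0)"
    then have 0: "t = 0" "vector_derivative \<nu> (at t) = 0" using vd[OF t] nz[OF t] by auto
    let ?g' = "vector_derivative g (at 0)"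
    have d\<nu>: "(\<nu> has_vector_derivative 0) (at 0)" and dg: "(g has_vector_derivative ?g') (at 0)"
      using smooth_on_imp_has_vector_derivative[OF s\<nu> t] smooth_on_imp_has_vector_derivative[OF g t] 0 by auto
    have "((\<lambda>t. g t \<bullet> \<nu> t) has_vector_derivative (g 0 \<bullet> 0 + ?g' \<bullet> \<nu> 0)) (at 0)"
      by (rule bounded_bilinear.has_vector_derivative[OF bounded_bilinear_inner dg d\<nu>])
    then have "((\<lambda>t. 0 :: real) has_vector_derivative (?g' \<bullet> \<nu> 0)) (at 0)" by (simp add: orth)
    then have "?g' \<bullet> \<nu> 0 = 0"
      using vector_derivative_at vector_derivative_const_at by metis
    moreover obtain x y where "\<nu> 0 = x *\<^sub>R g 0 + y *\<^sub>R ?g'"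
      using cross_coordinates[OF cr] t 0(1) by blast
    ultimately have "\<nu> 0 \<bullet> \<nu> 0 = 0"
      using orth[of 0] by (metis inner_add_left inner_scaleR_left mult_zero_right add_0)
    then show False using n1[OF t] 0(1) by auto
  qed
  ultimately show ?thesis unfolding front_def using \<gamma> by blast
qed

lemma arcs_near_front_cusp:
  assumes "has_ordinary_cusp S p"
  shows "arcs_near front S p"
proof (rule arcs_near_single)
  fix W :: "(real \<times> real) set" assume W: "open W" "p \<in> W"
  obtain U V \<phi> \<psi> where U: "open U" "p \<in> U" and V: "open V" and \<phi>p: "\<phi> p = (0, 0)"
    and s\<phi>: "smooth_on U \<phi>" and s\<psi>: "smooth_on V \<psi>" and hom: "homeomorphism U V \<phi> \<psi>"
    and im: "\<phi> ` (U \<inter> S) = V \<inter> range (\<lambda>t::real. (t\<^sup>2, t ^ 3))"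
    using assms unfolding has_ordinary_cusp_def by blast
  have maps: "\<phi> ` U = V" "\<psi> ` V = U" "\<And>z. z \<in> U \<Longrightarrow> \<psi> (\<phi> z) = z" "\<And>y. y \<in> V \<Longrightarrow> \<phi> (\<psi> y) = y"
    using hom by (auto simp: homeomorphism_def)
  have V0: "(0, 0) \<in> V" using imageI[OF U(2), of \<phi>] maps(1) \<phi>p by simp
  have \<psi>0: "\<psi> (0, 0) = p" using maps(3)[OF U(2)] \<phi>p by simp
  have inj: "h = 0" if y: "y \<in> V" and h: "frechet_derivative \<psi> (at y) h = 0" for y h
  proof -
    have "\<psi> y \<in> U" using maps y by blast
    then have "((\<lambda>y. \<phi> (\<psi> y)) has_derivative (\<lambda>h. frechet_derivative \<phi> (at (\<psi> y)) (frechet_derivative \<psi> (at y) h))) (at y)"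
      by (intro has_derivative_compose[OF smooth_on_imp_has_derivative[OF s\<psi> y] smooth_on_imp_has_derivative[OF s\<phi>]])
    then have "((\<lambda>y. y) has_derivative (\<lambda>h. frechet_derivative \<phi> (at (\<psi> y)) (frechet_derivative \<psi> (at y) h))) (at y)"
      by (rule has_derivative_transform_within_open[OF _ V y]) (use maps in auto)
    then have "(\<lambda>h. frechet_derivative \<phi> (at (\<psi> y)) (frechet_derivative \<psi> (at y) h)) = (\<lambda>h. h)"
      by (rule has_derivative_unique) (rule has_derivative_ident)
    then have "frechet_derivative \<phi> (at (\<psi> y)) (frechet_derivative \<psi> (at y) h) = h" by metis
    moreover have "linear (frechet_derivative \<phi> (at (\<psi> y)))"
      using has_derivative_linear[OF smooth_on_imp_has_derivative[OF s\<phi> \<open>\<psi> y \<in> U\<close>]] .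
    ultimately show ?thesis using h linear_0 by metis
  qed
  have "open (V \<inter> \<psi> -` W)"
    by (rule continuous_open_preimage[OF smooth_on_imp_continuous_on[OF s\<psi>] V W(1)])
  moreover have "(0, 0) \<in> V \<inter> \<psi> -` W" using V0 \<psi>0 W by simp
  ultimately obtain r0 where r0: "r0 > 0" "ball (0, 0) r0 \<subseteq> V \<inter> \<psi> -` W" using openE by blast
  \<comment> \<open>The box \<open>B\<close> below is adapted to the cusp: \<open>(t\<^sup>2, t\<^sup>3)\<close> lies in it exactly if \<open>\<bar>t\<bar> < r\<close>.\<close>
  define r where "r = min 1 (r0 / 2)"
  have r: "0 < r" "r \<le> 1" "2 * r \<le> r0" using r0 by (auto simp: r_def)
  let ?I = "{- r <..< r}"
  define B where "B = {- (r\<^sup>2) <..< r\<^sup>2} \<times> {- (r ^ 3) <..< r ^ 3}"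
  have B: "open B" by (simp add: B_def open_Times)
  have BV: "B \<subseteq> V" "\<psi> ` B \<subseteq> W"
  proof -
    have "B \<subseteq> ball (0, 0) r0"
    proof
      fix y assume "y \<in> B"
      then have "\<bar>fst y\<bar> < r\<^sup>2" "\<bar>snd y\<bar> < r ^ 3" by (auto simp: B_def)
      moreover have "r\<^sup>2 \<le> r" "r ^ 3 \<le> r"
        using power_decreasing[of 1 2 r] power_decreasing[of 1 3 r] r by simp_all
      ultimately have "norm y < r0"
        using norm_Pair_le[of "fst y" "snd y"] r(3) by simp
      then show "y \<in> ball (0, 0) r0" by (simp add: dist_norm zero_prod_def[symmetric])
    qed
    then show "B \<subseteq> V" "\<psi> ` B \<subseteq> W" using r0(2) by auto
  qed
  define m where "m t = (t\<^sup>2, t ^ 3)" for t :: real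
  have mB: "m t \<in> B \<longleftrightarrow> t \<in> ?I" for t
  proof -
    have *: "\<bar>t\<bar> ^ n < r ^ n \<longleftrightarrow> \<bar>t\<bar> < r" if "n > 0" for n
      using that r(1) power_strict_mono[of "\<bar>t\<bar>" r n] power_less_imp_less_base[of "\<bar>t\<bar>" n r] by auto
    have "- (r\<^sup>2) < t\<^sup>2" by (rule less_le_trans[of _ 0]) (use r(1) in auto)
    then show ?thesis
      using *[of 2] *[of 3] by (auto simp: m_def B_def power_abs[symmetric] abs_less_iff)
  qed
  have dm: "(m has_derivative (\<lambda>h. (2 * t * h, 3 * t\<^sup>2 * h))) (at t)" for t
    unfolding m_def by (auto intro!: derivative_eq_intros has_derivative_Pair)
  have sm: "smooth_on ?I m" unfolding m_def by (intro smooth_intros) auto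
  have mV: "m ` ?I \<subseteq> V" using mB BV(1) by blast
  define \<gamma> where "\<gamma> t = \<psi> (m t)" for t
  have s\<gamma>: "smooth_on ?I \<gamma>" unfolding \<gamma>_def by (rule smooth_on_compose[OF _ s\<psi> mV sm]) simp
  define P Q where "P y = frechet_derivative \<psi> (at y) (1, 0)" and "Q y = frechet_derivative \<psi> (at y) (0, 1)" for y
  have sPQ: "smooth_on V P" "smooth_on V Q"
    unfolding P_def Q_def by (intro smooth_on_frechet_derivative s\<psi>)+
  have D: "frechet_derivative \<psi> (at y) (x, x') = x *\<^sub>R P y + x' *\<^sub>R Q y" if "y \<in> V" for y x x'
  proof -
    interpret bounded_linear "frechet_derivative \<psi> (at y)"
      by (rule has_derivative_bounded_linear[OF smooth_on_imp_has_derivative[OF s\<psi> that]])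
    have "(x, x') = x *\<^sub>R (1, 0) + x' *\<^sub>R (0, 1 :: real)" by simp
    then show ?thesis unfolding P_def Q_def by (metis add scaleR)
  qed
  define g where "g t = 2 *\<^sub>R P (m t) + (3 * t) *\<^sub>R Q (m t)" for t
  have sP: "smooth_on ?I (\<lambda>t. P (m t))" and sQ: "smooth_on ?I (\<lambda>t. Q (m t))"
    by (rule smooth_on_compose[OF _ sPQ(1) mV sm] smooth_on_compose[OF _ sPQ(2) mV sm]; simp)+
  have sg: "smooth_on ?I g" unfolding g_def by (intro smooth_intros sP sQ) auto
  have "front \<gamma> ?I"
  proof (rule front_of_velocity_multiple[OF _ s\<gamma> sg])
    fix t assume t: "t \<in> ?I"
    then have y: "m t \<in> V" using mV by blast
    have "(\<gamma> has_derivative (\<lambda>h. frechet_derivative \<psi> (at (m t)) (2 * t * h, 3 * t\<^sup>2 * h))) (at t)"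
      unfolding \<gamma>_def by (rule has_derivative_compose[OF dm smooth_on_imp_has_derivative[OF s\<psi> y]])
    then have "(\<gamma> has_vector_derivative t *\<^sub>R g t) (at t)"
      unfolding has_vector_derivative_def
      by (rule has_derivative_eq_rhs)
         (simp add: D[OF y] g_def fun_eq_iff scaleR_add_right power2_eq_square ac_simps)
    then show "vector_derivative \<gamma> (at t) = t *\<^sub>R g t" by (rule vector_derivative_at)
    show "g t \<noteq> 0"
      using inj[OF y, of "(2, 3 * t)"] D[OF y, of 2 "3 * t"] by (auto simp: g_def zero_prod_def)
  next
    have m0: "m 0 = (0, 0)" by (simp add: m_def)
    have y: "m 0 \<in> V" using V0 m0 by simp
    have dP: "((\<lambda>t. P (m t)) has_vector_derivative 0) (at 0)"
    proof -
      have dPm: "(P has_derivative frechet_derivative P (at (m 0))) (at (m 0))"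
        by (rule smooth_on_imp_has_derivative[OF sPQ(1) y])
      have "((\<lambda>t. P (m t)) has_derivative (\<lambda>h. frechet_derivative P (at (m 0)) (2 * 0 * h, 3 * 0\<^sup>2 * h))) (at 0)"
        by (rule has_derivative_compose[OF dm dPm])
      then show ?thesis
        unfolding has_vector_derivative_def
        using linear_0[OF has_derivative_linear[OF dPm]] by (simp add: zero_prod_def)
    qed
    have "((\<lambda>t. Q (m t)) has_vector_derivative vector_derivative (\<lambda>t. Q (m t)) (at 0)) (at 0)"
      by (rule smooth_on_imp_has_vector_derivative[OF sQ]) (use r in simp)
    then have "(g has_vector_derivative 3 *\<^sub>R Q (m 0)) (at 0)"
      using dP unfolding g_def has_vector_derivative_def by (auto intro!: derivative_eq_intros)
    then have g': "vector_derivative g (at 0) = 3 *\<^sub>R Q (m 0)" by (rule vector_derivative_at)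
    have "cross (P (m 0)) (Q (m 0)) \<noteq> 0"
    proof
      let ?a = "P (m 0)" and ?b = "Q (m 0)"
      \<comment> \<open>Linearly dependent vectors satisfy \<open>\<langle>a, a\<rangle> b = \<langle>a, b\<rangle> a\<close>, which contradicts injectivity.\<close>
      assume "cross ?a ?b = 0"
      then have "(- (?a \<bullet> ?b)) *\<^sub>R ?a + (?a \<bullet> ?a) *\<^sub>R ?b = 0"
        by (simp add: prod_eq_iff cross_def inner_prod_def) algebra
      then have "(- (?a \<bullet> ?b), ?a \<bullet> ?a) = (0 :: real \<times> real)"
        using D[OF y] inj[OF y] by metis
      then have "?a = 0" by (simp add: zero_prod_def)
      then show False using inj[OF y, of "(1, 0)"] by (simp add: P_def zero_prod_def)
    qed
    moreover have "cross (g 0) (vector_derivative g (at 0)) = 6 * cross (P (m 0)) (Q (m 0))"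
      unfolding g' g_def by (simp add: cross_def algebra_simps)
    ultimately show "cross (g 0) (vector_derivative g (at 0)) \<noteq> 0" by simp
  qed simp
  moreover have "\<gamma> ` ?I = \<psi> ` B \<inter> S"
  proof (intro equalityI subsetI)
    fix z assume "z \<in> \<gamma> ` ?I"
    then obtain t where t: "t \<in> ?I" and z: "z = \<psi> (m t)" by (auto simp: \<gamma>_def)
    have "m t \<in> B" using t mB by blast
    moreover have "m t \<in> V \<inter> range (\<lambda>t::real. (t\<^sup>2, t ^ 3))" using t mV by (auto simp: m_def)
    then have "m t \<in> \<phi> ` (U \<inter> S)" using im by simp
    then have "\<psi> (m t) \<in> S" using maps(3) by auto
    ultimately show "z \<in> \<psi> ` B \<inter> S" using z by blast
  next
    fix z assume "z \<in> \<psi> ` B \<inter> S"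
    then obtain y where y: "y \<in> B" "z = \<psi> y" "z \<in> S" by blast
    then have "y \<in> V" using BV by blast
    then have "z \<in> U" "\<phi> z = y" using maps y by auto
    then have "y \<in> V \<inter> range (\<lambda>t::real. (t\<^sup>2, t ^ 3))" using im y(3) by blast
    then obtain t where "y = m t" by (auto simp: m_def)
    then have "t \<in> ?I" "z = \<gamma> t" using y mB by (auto simp: \<gamma>_def)
    then show "z \<in> \<gamma> ` ?I" by blast
  qed
  moreover have "open (\<psi> ` B)"
  proof -
    have "\<psi> ` B = U \<inter> \<phi> -` B"
    proof (intro equalityI subsetI)
      fix z assume "z \<in> \<psi> ` B"
      then obtain y where y: "y \<in> B" "z = \<psi> y" by blast
      then have "y \<in> V" using BV(1) by blast
      then have "z \<in> U" "\<phi> z = y" using y(2) maps(2) maps(4)[of y] by auto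
      then show "z \<in> U \<inter> \<phi> -` B" using y(1) by simp
    next
      fix z assume "z \<in> U \<inter> \<phi> -` B"
      then have "\<phi> z \<in> B" "z = \<psi> (\<phi> z)" using maps(3)[of z] by auto
      then show "z \<in> \<psi> ` B" by blast
    qed
    then show ?thesis
      using continuous_open_preimage[OF smooth_on_imp_continuous_on[OF s\<phi>] U(1) B] by simp
  qed
  moreover have "p \<in> \<psi> ` B"
    by (rule image_eqI[of _ _ "m 0"]) (use \<psi>0 r mB[of 0] in \<open>simp_all add: m_def\<close>)
  moreover have "\<gamma> 0 = p" by (simp add: \<gamma>_def m_def \<psi>0)
  ultimately show "\<exists>U \<gamma> \<epsilon>. U \<subseteq> W \<and> open U \<and> p \<in> U \<and> \<epsilon> > 0 \<and>
    front \<gamma> {- \<epsilon> <..< \<epsilon>} \<and> \<gamma> 0 = p \<and> \<gamma> ` {- \<epsilon> <..< \<epsilon>} = U \<inter> S"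
    using BV(2) r(1) by (intro exI[of _ "\<psi> ` B"] exI[of _ \<gamma>] exI[of _ r]) simp
qed


section \<open>The origin when the conic is a parabola\<close>

text \<open>In complex notation, the squared modulus of \<open>1 + cnj p * z\<close>.\<close>

definition translation_factor :: "real \<times> real \<Rightarrow> real \<times> real \<Rightarrow> real" where
  "translation_factor p z = 1 + 2 * (z \<bullet> p) + (p \<bullet> p) * (z \<bullet> z)"

text \<open>
  The translation by \<open>p\<close>, conjugated with the inversion.  In complex notation this is the Moebius
  map \<open>z \<mapsto> z / (1 + cnj p * z)\<close>, whence it is a diffeomorphism near the origin.  It relates the
  inversions of the plane with two different centres.
\<close>

definition conjugate_translation :: "real \<times> real \<Rightarrow> real \<times> real \<Rightarrow> real \<times> real" where
  "conjugate_translation p z = inverse (translation_factor p z) *\<^sub>R (z + (z \<bullet> z) *\<^sub>R p)"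

lemma conjugate_translation_self_inner:
  assumes "translation_factor p z \<noteq> 0"
  shows "conjugate_translation p z \<bullet> conjugate_translation p z = (z \<bullet> z) / translation_factor p z"
proof -
  let ?N = "translation_factor p z"
  have "(z + (z \<bullet> z) *\<^sub>R p) \<bullet> (z + (z \<bullet> z) *\<^sub>R p) = (z \<bullet> z) * ?N"
    by (simp add: translation_factor_def inner_add_left inner_add_right inner_commute[of p z] algebra_simps)
  then show ?thesis using assms
    by (simp add: conjugate_translation_def power2_eq_square divide_simps)
qed

lemma conjugate_translation_inverse:
  assumes N: "translation_factor p z \<noteq> 0"
  shows "translation_factor (- p) (conjugate_translation p z) = inverse (translation_factor p z)"
    and "conjugate_translation (- p) (conjugate_translation p z) = z"
proof -
  let ?N = "translation_factor p z" and ?w = "conjugate_translation p z"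
  have ip: "?w \<bullet> p = (z \<bullet> p + (z \<bullet> z) * (p \<bullet> p)) / ?N"
    by (simp add: conjugate_translation_def inner_add_left divide_inverse mult.commute)
  have "translation_factor (- p) ?w = (?N - 2 * (z \<bullet> p + (z \<bullet> z) * (p \<bullet> p)) + (p \<bullet> p) * (z \<bullet> z)) / ?N"
    using N by (simp add: translation_factor_def[of "- p"] ip conjugate_translation_self_inner[OF N] diff_divide_distrib add_divide_distrib)
  also have "\<dots> = inverse ?N" by (simp add: translation_factor_def divide_inverse mult.commute)
  finally show *: "translation_factor (- p) ?w = inverse ?N" .
  have "conjugate_translation (- p) ?w = ?N *\<^sub>R (?w - ((z \<bullet> z) / ?N) *\<^sub>R p)"
    using * by (simp add: conjugate_translation_def[of "- p"] conjugate_translation_self_inner[OF N])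
  also have "\<dots> = z"
    using N by (simp add: conjugate_translation_def scaleR_diff_right scaleR_add_right divide_inverse mult.commute)
  finally show "conjugate_translation (- p) ?w = z" .
qed

lemma inversion_map_eq: "inversion_map z = inverse (z \<bullet> z) *\<^sub>R z"
  by (simp add: inversion_map_def dot_square_norm)

lemma inversion_map_conjugate_translation:
  assumes N: "translation_factor p z \<noteq> 0" and "z \<noteq> 0"
  shows "inversion_map (conjugate_translation p z) = inversion_map z + p"
  unfolding inversion_map_eq conjugate_translation_self_inner[OF N]
  using assms by (simp add: conjugate_translation_def scaleR_add_right inverse_eq_divide)

lemma smooth_on_translation_factor: "open S \<Longrightarrow> smooth_on S f \<Longrightarrow> smooth_on S (\<lambda>x. translation_factor p (f x))"
  unfolding translation_factor_def by (intro smooth_intros)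

lemma smooth_on_conjugate_translation:
  assumes "open S" "smooth_on S f" "\<And>x. x \<in> S \<Longrightarrow> translation_factor p (f x) \<noteq> 0"
  shows "smooth_on S (\<lambda>x. conjugate_translation p (f x))"
  unfolding conjugate_translation_def
  using assms by (intro smooth_intros smooth_on_inverse smooth_on_translation_factor)

lemma open_translation_factor_nonzero:
  assumes "open S" "smooth_on S f"
  shows "open {x \<in> S. translation_factor p (f x) \<noteq> 0}"
proof -
  have "open (S \<inter> (\<lambda>x. translation_factor p (f x)) -` (- {0}))"
    by (rule continuous_open_preimage[OF smooth_on_imp_continuous_on[OF smooth_on_translation_factor[OF assms]] assms(1)]) auto
  then show ?thesis by (simp add: vimage_def Int_def)
qed

context irreducible_conic
begin

lemma mem_IC_iff_inversion:
  assumes "z \<noteq> 0"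
  shows "z \<in> IC \<longleftrightarrow> inversion_map z \<in> C"
proof -
  define s where "s = z \<bullet> z"
  have s: "s \<noteq> 0" using assms by (simp add: s_def)
  have "F (inversion_map z) = (inverse s)\<^sup>2 * q z + 2 * inverse s * l z + c"
    by (simp add: F_def inversion_map_eq q_scaleR s_def[symmetric]) (simp add: l_def algebra_simps)
  then have "s\<^sup>2 * F (inversion_map z) = G z"
    using s by (simp add: G_def s_def[symmetric] field_simps power2_eq_square)
  then show ?thesis using s by (auto simp: mem_C mem_IC)
qed

text \<open>
  Seen from the vertex \<open>p\<close>, the inversion of the parabola \<open>Y\<^sup>2 = 4 k X\<close> is the cissoid
  \<open>Y\<^sup>2 = 4 k X (X\<^sup>2 + Y\<^sup>2)\<close>.  With \<open>P = 4 k X\<close> its equation reads \<open>(4 k Y)\<^sup>2 (1 - P) = P\<^sup>3\<close>, which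
  becomes the standard cusp \<open>R\<^sup>2 = P\<^sup>3\<close> for \<open>R = 4 k Y sqrt (1 - P)\<close>.  The conjugate translation
  carries this coordinate change from the vertex to the given centre of inversion.
\<close>

lemma has_ordinary_cusp_IC:
  assumes "is_parabola C"
  shows "has_ordinary_cusp IC (0, 0)"
proof -
  obtain p u v k where fr: "orthonormal_frame u v" and k: "k > 0"
    and CC: "C = {p + X *\<^sub>R u + Y *\<^sub>R v | X Y. Y\<^sup>2 = 4 * k * X}"
    using assms unfolding is_parabola_def parabola_in_frame_def by blast
  note frD = orthonormal_frameD[OF fr]
  have coord: "(x *\<^sub>R u + y *\<^sub>R v) \<bullet> u = x" "(x *\<^sub>R u + y *\<^sub>R v) \<bullet> v = y" for x y
    using frD by (simp_all add: inner_add_left)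
  have mem_C: "z + p \<in> C \<longleftrightarrow> (z \<bullet> v)\<^sup>2 = 4 * k * (z \<bullet> u)" for z
  proof
    assume "z + p \<in> C"
    then obtain X Y where "z = X *\<^sub>R u + Y *\<^sub>R v" "Y\<^sup>2 = 4 * k * X"
      unfolding CC by (auto simp: add.commute add.left_commute)
    then show "(z \<bullet> v)\<^sup>2 = 4 * k * (z \<bullet> u)" by (simp add: coord)
  next
    assume *: "(z \<bullet> v)\<^sup>2 = 4 * k * (z \<bullet> u)"
    have "z + p = p + (z \<bullet> u) *\<^sub>R u + (z \<bullet> v) *\<^sub>R v"
      using orthonormal_frame_expand[OF fr, of z] by (simp add: add.commute add.left_commute)
    with * show "z + p \<in> C" unfolding CC by blast
  qed
  define w where "w z = conjugate_translation (- p) z" for z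
  define A where "A = {z. translation_factor (- p) z \<noteq> 0}"
  have A: "open A"
    using open_translation_factor_nonzero[OF open_UNIV smooth_on_id, of "- p"] by (simp add: A_def)
  have sw: "smooth_on A w"
    unfolding w_def by (rule smooth_on_conjugate_translation[OF A smooth_on_id[OF A]]) (simp add: A_def)
  define U where "U = {z \<in> A. 4 * k * (w z \<bullet> u) < 1}"
  have U: "open U"
  proof -
    have "open (A \<inter> (\<lambda>z. 4 * k * (w z \<bullet> u)) -` {..<1})"
      by (rule continuous_open_preimage) (auto intro!: A continuous_intros smooth_on_imp_continuous_on[OF sw])
    then show ?thesis by (simp add: U_def vimage_def Int_def)
  qed
  define \<phi> where "\<phi> z = (4 * k * (w z \<bullet> u), 4 * k * (w z \<bullet> v) * sqrt (1 - 4 * k * (w z \<bullet> u)))" for z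
  have swU: "smooth_on U w" by (rule smooth_on_subset[OF sw]) (auto simp: U_def)
  have s\<phi>: "smooth_on U \<phi>"
    unfolding \<phi>_def by (intro smooth_intros smooth_on_sqrt swU U) (auto simp: U_def)
  define B where "B = {y :: real \<times> real. fst y < 1}"
  have B: "open B" unfolding B_def by (intro open_Collect_less continuous_intros)
  define \<xi> where "\<xi> y = (fst y / (4 * k)) *\<^sub>R u + (snd y / (4 * k * sqrt (1 - fst y))) *\<^sub>R v" for y
  have s\<xi>: "smooth_on B \<xi>"
    unfolding \<xi>_def using k by (intro smooth_intros smooth_on_divide smooth_on_sqrt B) (auto simp: B_def)
  define V where "V = {y \<in> B. translation_factor p (\<xi> y) \<noteq> 0}"
  have V: "open V" unfolding V_def by (rule open_translation_factor_nonzero[OF B s\<xi>])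
  define \<psi> where "\<psi> y = conjugate_translation p (\<xi> y)" for y
  have s\<psi>: "smooth_on V \<psi>"
    unfolding \<psi>_def
    by (rule smooth_on_conjugate_translation[OF V smooth_on_subset[OF s\<xi>]]) (auto simp: V_def)
  have wN: "translation_factor p (w z) = inverse (translation_factor (- p) z)" "conjugate_translation p (w z) = z"
    if "z \<in> A" for z
    using conjugate_translation_inverse[of "- p" z] that by (simp_all add: A_def w_def)
  have UV: "\<phi> z \<in> V" "\<psi> (\<phi> z) = z" if z: "z \<in> U" for z
  proof -
    have zA: "z \<in> A" and P: "4 * k * (w z \<bullet> u) < 1" using z by (auto simp: U_def)
    have "sqrt (1 - 4 * k * (w z \<bullet> u)) \<noteq> 0" using P by simp
    then have "\<xi> (\<phi> z) = (w z \<bullet> u) *\<^sub>R u + (w z \<bullet> v) *\<^sub>R v"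
      using k by (simp add: \<xi>_def \<phi>_def)
    then have \<xi>: "\<xi> (\<phi> z) = w z" using orthonormal_frame_expand[OF fr, of "w z"] by simp
    show "\<phi> z \<in> V" unfolding V_def using wN(1)[OF zA] zA P \<xi> by (simp add: B_def A_def) (simp add: \<phi>_def)
    show "\<psi> (\<phi> z) = z" unfolding \<psi>_def \<xi> by (rule wN(2)[OF zA])
  qed
  have VU: "\<psi> y \<in> U" "\<phi> (\<psi> y) = y" if y: "y \<in> V" for y
  proof -
    have N: "translation_factor p (\<xi> y) \<noteq> 0" and P: "fst y < 1" using y by (auto simp: V_def B_def)
    have w: "w (\<psi> y) = \<xi> y" "\<psi> y \<in> A"
      using conjugate_translation_inverse[OF N] N by (simp_all add: w_def \<psi>_def A_def)
    have "4 * k * (\<xi> y \<bullet> u) = fst y" using k by (simp add: \<xi>_def coord)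
    moreover have "4 * k * (\<xi> y \<bullet> v) * sqrt (1 - fst y) = snd y" using k P by (simp add: \<xi>_def coord)
    ultimately show "\<psi> y \<in> U" "\<phi> (\<psi> y) = y"
      unfolding U_def \<phi>_def w(1) using w P by (auto intro: prod_eqI)
  qed
  have hom: "homeomorphism U V \<phi> \<psi>"
    by (rule homeomorphismI)
       (use UV VU smooth_on_imp_continuous_on[OF s\<phi>] smooth_on_imp_continuous_on[OF s\<psi>] in auto)
  have w0: "w 0 = 0" by (simp add: w_def conjugate_translation_def)
  have 0: "0 \<in> U" "\<phi> 0 = (0, 0)" by (simp_all add: U_def A_def w0 translation_factor_def \<phi>_def)
  have mem: "z \<in> IC \<longleftrightarrow> (snd (\<phi> z))\<^sup>2 = fst (\<phi> z) ^ 3" if z: "z \<in> U" for z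
  proof (cases "z = 0")
    case True
    then show ?thesis using 0 G_0 by (simp add: mem_IC)
  next
    case False
    have zA: "z \<in> A" and P: "4 * k * (w z \<bullet> u) < 1" using z by (auto simp: U_def)
    have N: "translation_factor p (w z) \<noteq> 0" using wN(1)[OF zA] zA by (simp add: A_def)
    have wz: "w z \<noteq> 0" using False wN(2)[OF zA] by (auto simp: conjugate_translation_def)
    define X Y where "X = w z \<bullet> u" and "Y = w z \<bullet> v"
    have ww: "w z \<bullet> w z = X\<^sup>2 + Y\<^sup>2"
    proof -
      have "w z \<bullet> w z = w z \<bullet> (X *\<^sub>R u + Y *\<^sub>R v)"
        unfolding X_def Y_def using orthonormal_frame_expand[OF fr, of "w z"] by simp
      then show ?thesis by (simp add: inner_add_right X_def Y_def power2_eq_square)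
    qed
    then have s: "X\<^sup>2 + Y\<^sup>2 \<noteq> 0" using wz by (metis inner_eq_zero_iff)
    have clear_denominator: "(Y / t)\<^sup>2 = 4 * k * (X / t) \<longleftrightarrow> Y\<^sup>2 = 4 * k * X * t" if "t \<noteq> 0" for t
      using that by (simp add: field_simps power2_eq_square)
    have "inversion_map z = inversion_map (w z) + p"
      using inversion_map_conjugate_translation[OF N wz] wN(2)[OF zA] by simp
    then have "z \<in> IC \<longleftrightarrow> (inversion_map (w z) \<bullet> v)\<^sup>2 = 4 * k * (inversion_map (w z) \<bullet> u)"
      using mem_IC_iff_inversion[OF False] mem_C by simp
    also have "\<dots> \<longleftrightarrow> (Y / (X\<^sup>2 + Y\<^sup>2))\<^sup>2 = 4 * k * (X / (X\<^sup>2 + Y\<^sup>2))"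
      unfolding inversion_map_eq ww by (simp add: X_def[symmetric] Y_def[symmetric] divide_inverse mult.commute)
    also have "\<dots> \<longleftrightarrow> Y\<^sup>2 = 4 * k * X * (X\<^sup>2 + Y\<^sup>2)"
      by (rule clear_denominator[OF s])
    also have "\<dots> \<longleftrightarrow> Y\<^sup>2 * (1 - 4 * k * X) = 4 * k * X ^ 3"
      by (simp add: algebra_simps power2_eq_square power3_eq_cube)
    also have "\<dots> \<longleftrightarrow> 16 * k\<^sup>2 * (Y\<^sup>2 * (1 - 4 * k * X)) = 16 * k\<^sup>2 * (4 * k * X ^ 3)"
      using k by (simp add: mult.assoc)
    also have "\<dots> \<longleftrightarrow> (4 * k * Y * sqrt (1 - 4 * k * X))\<^sup>2 = (4 * k * X) ^ 3"
      using P by (simp add: X_def[symmetric] power_mult_distrib power2_eq_square power3_eq_cube algebra_simps)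
    finally show ?thesis by (simp add: \<phi>_def X_def Y_def)
  qed
  have "\<phi> ` (U \<inter> IC) = V \<inter> range (\<lambda>t::real. (t\<^sup>2, t ^ 3))"
  proof (intro equalityI subsetI)
    fix y assume "y \<in> \<phi> ` (U \<inter> IC)"
    then obtain z where z: "z \<in> U" "z \<in> IC" "y = \<phi> z" by blast
    then show "y \<in> V \<inter> range (\<lambda>t::real. (t\<^sup>2, t ^ 3))" unfolding range_cusp using UV(1) mem by simp
  next
    fix y assume "y \<in> V \<inter> range (\<lambda>t::real. (t\<^sup>2, t ^ 3))"
    then have y: "y \<in> V" "(snd y)\<^sup>2 = fst y ^ 3" unfolding range_cusp by simp_all
    then have "\<psi> y \<in> IC" using mem[OF VU(1)[OF y(1)]] VU(2)[OF y(1)] by simp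
    then show "y \<in> \<phi> ` (U \<inter> IC)" using VU[OF y(1)] by (metis IntI image_eqI)
  qed
  then show ?thesis
    unfolding has_ordinary_cusp_def zero_prod_def[symmetric]
    using U V 0 s\<phi> s\<psi> hom
    by (intro exI[of _ U] exI[of _ V] exI[of _ \<phi>] exI[of _ \<psi>] conjI) (simp_all add: zero_prod_def)
qed

end

section \<open>The three types of conics\<close>

context irreducible_conic
begin

lemma null_vectors_of_discriminant_neg:
  assumes \<delta>: "a11 * a22 - a12\<^sup>2 < 0"
  obtains d e where "cross d e \<noteq> 0" "q d = 0" "q e = 0"
proof (cases "a11 = 0")
  case True
  then have "q (1, 0) = 0" "q (- a22, 2 * a12) = 0" "cross (1, 0) (- a22, 2 * a12) \<noteq> 0"
    using \<delta> unfolding q_def cross_def by (auto simp: power2_eq_square)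
  then show ?thesis using that by blast
next
  case False
  define r where "r = sqrt (a12\<^sup>2 - a11 * a22)"
  have r: "r\<^sup>2 = a12\<^sup>2 - a11 * a22" "r > 0" using \<delta> by (simp_all add: r_def)
  have *: "q (- a12 + t, a11) = a11 * (t\<^sup>2 - (a12\<^sup>2 - a11 * a22))" for t
    by (simp add: q_def power2_eq_square algebra_simps)
  have "q (- a12 + r, a11) = 0" "q (- a12 + - r, a11) = 0" using *[of r] *[of "- r"] r(1) by simp_all
  moreover have "cross (- a12 + r, a11) (- a12 + - r, a11) \<noteq> 0"
    using False r(2) by (simp add: cross_def algebra_simps)
  ultimately show ?thesis using that by blast
qed

lemma front_arcs_near_IC:
  assumes "z \<in> IC" shows "arcs_near front IC z"
proof (cases "z = 0")
  case False
  from regular_arcs_near_IC[OF assms False] show ?thesis by (rule arcs_near_mono) auto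
next
  case True
  consider "a11 * a22 - a12\<^sup>2 > 0" | "a11 * a22 - a12\<^sup>2 < 0" | "a11 * a22 - a12\<^sup>2 = 0" by linarith
  then show ?thesis
  proof cases
    case 1
    then obtain N where "open N" "N \<inter> IC = {(0, 0)}" using isolated_IC unfolding isolated_in_def by blast
    then show ?thesis using arcs_near_isolated True by (simp add: zero_prod_def)
  next
    case 2
    then obtain d e where "cross d e \<noteq> 0" "q d = 0" "q e = 0"
      by (rule null_vectors_of_discriminant_neg)
    from regular_arcs_near_node[OF this] show ?thesis unfolding True by (rule arcs_near_mono) auto
  next
    case 3
    from arcs_near_front_cusp[OF has_ordinary_cusp_IC[OF parabola_of_discriminant_zero[OF 3]]]
    show ?thesis using True by (simp add: zero_prod_def)
  qed
qed

lemma front_set_component: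
  assumes "K \<in> irreducible_components IP" shows "front_set K"
proof -
  obtain Q R where K: "K = zero_locus Q" and QR: "IP = Q * R"
    using assms unfolding irreducible_components_def dvd_def by blast
  show ?thesis unfolding front_set_def
  proof (rule locally_finite_union_ofI)
    fix z assume z: "z \<in> K"
    then have "z \<in> IC"
      unfolding K inversion_curve_def QR zero_locus_def by (auto simp: eval2_mult)
    then show "arcs_near front K z"
      using front_arcs_near_component[OF QR] z front_arcs_near_IC unfolding K by blast
  qed
qed

end

theorem theorem3p6:
  fixes a11 a12 a22 a1 a2 c :: real and C IC :: "(real \<times> real) set"
  defines "C \<equiv> quadratic_curve a11 a12 a22 a1 a2 c"
    and "IC \<equiv> inversion_curve a11 a12 a22 a1 a2 c"
  assumes irr: "irreducible_quadratic_curve a11 a12 a22 a1 a2 c"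
    and nonempty: "C \<noteq> {}"
  shows "total_degree (inversion_poly a11 a12 a22 a1 a2 c) \<in> {3, 4}
    \<and> (\<forall>K \<in> irreducible_components (inversion_poly a11 a12 a22 a1 a2 c). front_set K)
    \<and> (is_ellipse C \<longrightarrow>
        (0, 0) isolated_in IC \<and> regular_as_parametrized_curve (IC - {(0, 0)}))
    \<and> (is_hyperbola C \<longrightarrow>
        regular_as_parametrized_curve IC \<and> has_node IC (0, 0) \<and>
        tangent_directions IC (0, 0) = asymptotic_directions C)
    \<and> (is_parabola C \<longrightarrow>
        has_ordinary_cusp IC (0, 0) \<and> regular_as_parametrized_curve (IC - {(0, 0)}) \<and>
        tangent_directions IC (0, 0) = axis_directions C)"
proof -
  interpret irreducible_conic a11 a12 a22 a1 a2 c
  proof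
    show "a11 * a22 * c + 2 * a12 * a2 * a1 - a11 * a2\<^sup>2 - a12\<^sup>2 * c - a22 * a1\<^sup>2 \<noteq> 0"
      using irr unfolding irreducible_quadratic_curve_iff_det
      by (simp add: det_3 power2_eq_square algebra_simps)
  qed
  have "regular_as_parametrized_curve IC \<and> has_node IC (0, 0)" if hyp: "is_hyperbola C"
  proof -
    obtain p u v \<alpha> \<beta> where "hyperbola_in_frame C p u v \<alpha> \<beta>"
      using hyp unfolding is_hyperbola_def by blast
    from hyperbola_frame_q(3,1,2)[OF this[unfolded C_def]] show ?thesis
      unfolding IC_def using regular_IC_node has_node_IC by blast
  qed
  then show ?thesis
    using total_degree_IP front_set_component isolated_IC[OF ellipse_discriminant] regular_minus_origin
      hyperbola_tangents has_ordinary_cusp_IC parabola_tangents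
    unfolding C_def IC_def by blast
qed

end
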